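(* Let $X$ be a proper CAT(0) space, let $\Gamma$ be a group acting properly on $X$ by semisimple isometries, and let $\mathcal{A}$ be a $\Gamma$-well-behaved space of axes in $X$. Then there exist $\Gamma$-good covers $\mathcal{U}$ of $X$ and $\mathcal{V}$ of $\mathcal{A}$, and for such covers the join $N(\mathcal{U})\ast N(\mathcal{V})$ is an $E_{\mathcal{VC}}\Gamma$-complex.
   Context: An isometry is semisimple if it either fixes a point or acts by translation on some geodesic line (an axis). $\mathcal{L}(X)$ is the set of images of geodesic lines in $X$, with $d(\ell_1,\ell_2)=K$ if $\ell_1,\ell_2$ are parallel and bound a flat strip of width $K$ and $d=\infty$ if not parallel; it is a disjoint union of proper CAT(0) spaces, with components the parallelism classes, and $\Gamma$ acts on it isometrically. $\mathcal{A}(X;\Gamma)\subseteq\mathcal{L}(X)$ is the set of lines that are axes of some $\gamma\in\Gamma$. A subset $\mathcal{A}\subseteq\mathcal{A}(X;\Gamma)$ is a $\Gamma$-well-behaved space of axes if it is closed and component-wise convex in $\mathcal{L}(X)$ (its intersection with each component is convex), $\Gamma\cdot\mathcal{A}=\mathcal{A}$, and every component of $\mathcal{L}(X)$ that contains an element of $\mathcal{A}(X;\Gamma)$ also contains an element of $\mathcal{A}$. A $\Gamma$-good cover of a space $Y$ (a proper CAT(0) space or disjoint union of such, with isometric $\Gamma$-action) is a cover $\mathcal{U}$ by open balls with $\Gamma\cdot\mathcal{U}=\mathcal{U}$ such that $\gamma B\cap B\ne\emptyset$ implies $\gamma B=B$. $N(\mathcal{U})$ is the nerve: simplicial complex on vertex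 set $\mathcal{U}$ with a simplex for each finite subcollection with nonempty intersection. $\mathcal{VC}$ is the family of virtually cyclic subgroups of $\Gamma$. A $\Gamma$-CW complex $Z$ in which a cell is invariant under $\gamma$ iff fixed pointwise by $\gamma$ is an $E_{\mathcal{VC}}\Gamma$-complex if $Z$ is contractible, the fixed set of every $H\in\mathcal{VC}$ is contractible, and the fixed set of every $H\notin\mathcal{VC}$ is empty. *)

theory Defs
  imports "HOL-Analysis.Analysis" "HOL-Algebra.Group_Action" "HOL-Algebra.Generated_Groups"
begin

definition geodesic_seg :: "(real \<Rightarrow> 'a::metric_space) \<Rightarrow> 'a \<Rightarrow> 'a \<Rightarrow> bool" where
  "geodesic_seg c x y \<longleftrightarrow> c 0 = x \<and> c (dist x y) = y \<and>
     (\<forall>s\<in>{0..dist x y}. \<forall>t\<in>{0..dist x y}. dist (c s) (c t) = \<bar>s - t\<bar>)"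

definition geodesic_line :: "(real \<Rightarrow> 'a::metric_space) \<Rightarrow> bool" where
  "geodesic_line c \<longleftrightarrow> (\<forall>s t. dist (c s) (c t) = \<bar>s - t\<bar>)"

definition cmp_pt :: "real^2 \<Rightarrow> real^2 \<Rightarrow> real \<Rightarrow> real^2" where
  "cmp_pt a b s = a + (s / dist a b) *\<^sub>R (b - a)"

definition tri_pairs ::
  "(real \<Rightarrow> 'a::metric_space) \<Rightarrow> (real \<Rightarrow> 'a) \<Rightarrow> (real \<Rightarrow> 'a) \<Rightarrow> 'a \<Rightarrow> 'a \<Rightarrow> 'a
   \<Rightarrow> real^2 \<Rightarrow> real^2 \<Rightarrow> real^2 \<Rightarrow> ('a \<times> (real^2)) set" where
  "tri_pairs c1 c2 c3 x y z a b e =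
     {(c1 s, cmp_pt a b s) | s. s \<in> {0..dist x y}} \<union>
     {(c2 s, cmp_pt b e s) | s. s \<in> {0..dist y z}} \<union>
     {(c3 s, cmp_pt e a s) | s. s \<in> {0..dist z x}}"

definition CAT0_space :: "'a::metric_space itself \<Rightarrow> bool" where
  "CAT0_space _ \<longleftrightarrow>
     (\<forall>x y::'a. \<exists>c. geodesic_seg c x y) \<and>
     (\<forall>(x::'a) y z c1 c2 c3 a b e.
        geodesic_seg c1 x y \<and> geodesic_seg c2 y z \<and> geodesic_seg c3 z x \<and>
        dist a b = dist x y \<and> dist b e = dist y z \<and> dist e a = dist z x \<longrightarrow>
        (\<forall>(p, pb)\<in>tri_pairs c1 c2 c3 x y z a b e. \<forall>(q, qb)\<in>tri_pairs c1 c2 c3 x y z a b e.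
           dist p q \<le> dist pb qb))"

definition proper_space :: "'a::metric_space itself \<Rightarrow> bool" where
  "proper_space _ \<longleftrightarrow> (\<forall>(x::'a) r. compact (cball x r))"

definition isometric_action :: "('g, 'm) monoid_scheme \<Rightarrow> ('g \<Rightarrow> 'a::metric_space \<Rightarrow> 'a) \<Rightarrow> bool" where
  "isometric_action G \<phi> \<longleftrightarrow> (\<forall>g\<in>carrier G. \<forall>x y. dist (\<phi> g x) (\<phi> g y) = dist x y)"

definition proper_action :: "('g, 'm) monoid_scheme \<Rightarrow> ('g \<Rightarrow> 'a::metric_space \<Rightarrow> 'a) \<Rightarrow> bool" where
  "proper_action G \<phi> \<longleftrightarrow>
     (\<forall>x. \<exists>r>0. finite {g\<in>carrier G. \<phi> g ` ball x r \<inter> ball x r \<noteq> {}})"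

definition semisimple_action :: "('g, 'm) monoid_scheme \<Rightarrow> ('g \<Rightarrow> 'a::metric_space \<Rightarrow> 'a) \<Rightarrow> bool" where
  "semisimple_action G \<phi> \<longleftrightarrow>
     (\<forall>g\<in>carrier G. (\<exists>x. \<phi> g x = x) \<or>
        (\<exists>c a. geodesic_line c \<and> (\<forall>t. \<phi> g (c t) = c (t + a))))"

definition lines :: "'a::metric_space set set" where
  "lines = {range c | c. geodesic_line (c :: real \<Rightarrow> 'a)}"

definition flat_strip :: "'a::metric_space set \<Rightarrow> 'a set \<Rightarrow> real \<Rightarrow> bool" where
  "flat_strip l1 l2 K \<longleftrightarrow> 0 \<le> K \<and>
     (\<exists>f :: real \<times> real \<Rightarrow> 'a.
        (\<forall>p\<in>UNIV \<times> {0..K}. \<forall>q\<in>UNIV \<times> {0..K}. dist (f p) (f q) = dist p q) \<and>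
        f ` (UNIV \<times> {0}) = l1 \<and> f ` (UNIV \<times> {K}) = l2)"

text \<open>Distance in L(X): the width of the flat strip if parallel, \<infinity> otherwise.\<close>
definition line_dist :: "'a::metric_space set \<Rightarrow> 'a set \<Rightarrow> ereal" where
  "line_dist l1 l2 = Inf {ereal K | K. flat_strip l1 l2 K}"

definition line_geodesic :: "(real \<Rightarrow> 'a::metric_space set) \<Rightarrow> 'a set \<Rightarrow> 'a set \<Rightarrow> real \<Rightarrow> bool" where
  "line_geodesic c l1 l2 D \<longleftrightarrow> 0 \<le> D \<and> c 0 = l1 \<and> c D = l2 \<and> (\<forall>t\<in>{0..D}. c t \<in> lines) \<and>
     (\<forall>s\<in>{0..D}. \<forall>t\<in>{0..D}. line_dist (c s) (c t) = ereal \<bar>s - t\<bar>)"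

definition lines_closed :: "'a::metric_space set set \<Rightarrow> bool" where
  "lines_closed A \<longleftrightarrow> A \<subseteq> lines \<and>
     (\<forall>s l. (\<forall>n. s n \<in> A) \<and> l \<in> lines \<and> ((\<lambda>n. line_dist (s n) l) \<longlongrightarrow> 0) sequentially
        \<longrightarrow> l \<in> A)"

text \<open>Intersection with each component (parallelism class) is convex.\<close>
definition componentwise_convex :: "'a::metric_space set set \<Rightarrow> bool" where
  "componentwise_convex A \<longleftrightarrow>
     (\<forall>l1\<in>A. \<forall>l2\<in>A. \<forall>c D. line_geodesic c l1 l2 D \<longrightarrow> (\<forall>t\<in>{0..D}. c t \<in> A))"

definition axes :: "('g, 'm) monoid_scheme \<Rightarrow> ('g \<Rightarrow> 'a::metric_space \<Rightarrow> 'a) \<Rightarrow> 'a set set" where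
  "axes G \<phi> = {l \<in> lines. \<exists>g\<in>carrier G. \<exists>c a. geodesic_line c \<and> range c = l \<and> 0 < a \<and>
                  (\<forall>t. \<phi> g (c t) = c (t + a))}"

definition well_behaved_axes ::
  "('g, 'm) monoid_scheme \<Rightarrow> ('g \<Rightarrow> 'a::metric_space \<Rightarrow> 'a) \<Rightarrow> 'a set set \<Rightarrow> bool" where
  "well_behaved_axes G \<phi> A \<longleftrightarrow> A \<subseteq> axes G \<phi> \<and> lines_closed A \<and> componentwise_convex A \<and>
     (\<forall>g\<in>carrier G. (\<lambda>l. \<phi> g ` l) ` A = A) \<and>
     (\<forall>l\<in>axes G \<phi>. \<exists>l'\<in>A. line_dist l l' < \<infinity>)"

definition good_cover ::
  "('g, 'm) monoid_scheme \<Rightarrow> ('g \<Rightarrow> 'y \<Rightarrow> 'y) \<Rightarrow> 'y set \<Rightarrow> ('y \<Rightarrow> real \<Rightarrow> 'y set) \<Rightarrow> 'y set set \<Rightarrow> bool" where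
  "good_cover G act Y balls U \<longleftrightarrow>
     U \<subseteq> {balls y r | y r. y \<in> Y \<and> 0 < r} \<and> \<Union>U = Y \<and>
     (\<forall>g\<in>carrier G. (\<lambda>B. act g ` B) ` U = U) \<and>
     (\<forall>g\<in>carrier G. \<forall>B\<in>U. act g ` B \<inter> B \<noteq> {} \<longrightarrow> act g ` B = B)"

definition line_ball :: "'a::metric_space set set \<Rightarrow> 'a set \<Rightarrow> real \<Rightarrow> 'a set set" where
  "line_ball A l r = {l' \<in> A. line_dist l l' < ereal r}"

text \<open>Abstract simplicial complexes are sets of finite nonempty vertex sets.\<close>
definition nerve :: "'y set set \<Rightarrow> 'y set set set" where
  "nerve U = {\<sigma>. \<sigma> \<subseteq> U \<and> finite \<sigma> \<and> \<sigma> \<noteq> {} \<and> \<Inter>\<sigma> \<noteq> {}}"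

definition sjoin :: "'v set set \<Rightarrow> 'w set set \<Rightarrow> ('v + 'w) set set" where
  "sjoin K L = {Inl ` \<sigma> \<union> Inr ` \<tau> | \<sigma> \<tau>. (\<sigma> \<in> K \<or> \<sigma> = {}) \<and> (\<tau> \<in> L \<or> \<tau> = {}) \<and>
                                      (\<sigma> \<noteq> {} \<or> \<tau> \<noteq> {})}"

definition realization :: "'v set set \<Rightarrow> ('v \<Rightarrow> real) set" where
  "realization K = {p. (\<forall>v. 0 \<le> p v) \<and> {v. p v \<noteq> 0} \<in> K \<and> sum p {v. p v \<noteq> 0} = 1}"

definition closed_simplex :: "'v set set \<Rightarrow> 'v set \<Rightarrow> ('v \<Rightarrow> real) set" where
  "closed_simplex K \<sigma> = {p \<in> realization K. {v. p v \<noteq> 0} \<subseteq> \<sigma>}"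

text \<open>Weak (CW) topology: open iff the trace on every closed simplex is open
  (closed simplices carry the Euclidean = product topology).\<close>
definition realization_top :: "'v set set \<Rightarrow> ('v \<Rightarrow> real) topology" where
  "realization_top K = topology (\<lambda>S. S \<subseteq> realization K \<and>
     (\<forall>\<sigma>\<in>K. openin (top_of_set (closed_simplex K \<sigma>)) (S \<inter> closed_simplex K \<sigma>)))"

definition realization_act ::
  "('g, 'm) monoid_scheme \<Rightarrow> ('g \<Rightarrow> 'v \<Rightarrow> 'v) \<Rightarrow> 'g \<Rightarrow> ('v \<Rightarrow> real) \<Rightarrow> ('v \<Rightarrow> real)" where
  "realization_act G act g p = (\<lambda>v. p (act (inv\<^bsub>G\<^esub> g) v))"

definition fixed_set ::
  "('g, 'm) monoid_scheme \<Rightarrow> ('g \<Rightarrow> 'v \<Rightarrow> 'v) \<Rightarrow> 'v set set \<Rightarrow> 'g set \<Rightarrow> ('v \<Rightarrow> real) set" where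
  "fixed_set G act K H = {p \<in> realization K. \<forall>h\<in>H. realization_act G act h p = p}"

definition virtually_cyclic :: "('g, 'm) monoid_scheme \<Rightarrow> 'g set \<Rightarrow> bool" where
  "virtually_cyclic G H \<longleftrightarrow> subgroup H G \<and>
     (\<exists>x\<in>H. finite ((\<lambda>h. generate G {x} #>\<^bsub>G\<^esub> h) ` H))"

definition E_VC_complex :: "('g, 'm) monoid_scheme \<Rightarrow> ('g \<Rightarrow> 'v \<Rightarrow> 'v) \<Rightarrow> 'v set set \<Rightarrow> bool" where
  "E_VC_complex G act K \<longleftrightarrow>
     (\<forall>g\<in>carrier G. \<forall>\<sigma>\<in>K. act g ` \<sigma> \<in> K) \<and>
     (\<forall>g\<in>carrier G. \<forall>\<sigma>\<in>K. act g ` \<sigma> = \<sigma> \<longrightarrow> (\<forall>v\<in>\<sigma>. act g v = v)) \<and>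
     realization K \<noteq> {} \<and> contractible_space (realization_top K) \<and>
     (\<forall>H. subgroup H G \<longrightarrow>
        (if virtually_cyclic G H
         then fixed_set G act K H \<noteq> {} \<and>
              contractible_space (subtopology (realization_top K) (fixed_set G act K H))
         else fixed_set G act K H = {}))"

definition join_act :: "('g \<Rightarrow> 'a \<Rightarrow> 'a) \<Rightarrow> 'g \<Rightarrow> ('a set + 'a set set) \<Rightarrow> ('a set + 'a set set)" where
  "join_act \<phi> g v = (case v of Inl B \<Rightarrow> Inl (\<phi> g ` B) | Inr B \<Rightarrow> Inr ((\<lambda>l. \<phi> g ` l) ` B))"

end

theory Submission
  imports Defs
begin

text \<open>
  Everything rests on the inequality of Stewart type satisfied by geodesics of a CAT(0) space.

  Lines: for two lines at bounded distance the function \<open>s \<mapsto> d(c(0), c'(s))\<^sup>2 - s\<^sup>2\<close> is affine, which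
  gives the flat strip theorem, and parallel lines can be parametrized synchronously without
  holonomy. Hence the cross-section through a point of a line \<open>l\<close> identifies the part of \<open>\<A>\<close> parallel
  to \<open>l\<close> isometrically with a closed convex subset of \<open>X\<close>, and both covers become families of balls
  in closed convex subsets of \<open>X\<close>.

  Nerves: let balls cover a closed convex set \<open>Y\<close>. Minimizing strongly convex functions gives a
  continuous map \<open>F\<close> from the nerve to \<open>Y\<close> such that \<open>F p\<close> lies in some ball of the carrier of \<open>p\<close>;
  a partition of unity gives a map \<open>G\<close> back. Straight-line homotopies connect the identity
  with \<open>G \<circ> F\<close>, and contracting \<open>Y\<close> along geodesics makes \<open>G \<circ> F\<close> null-homotopic.

  Groups: the fixed set of \<open>H\<close> is the join of the nerves of the \<open>H\<close>-invariant balls. By properness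
  distances between orbits are discrete, so circumcenters of orbits provide fixed points (lines)
  inside any nonempty intersection of \<open>H\<close>-invariant balls. If \<open>H\<close> is finite, the first nerve is
  contractible, hence so is the join. If \<open>H\<close> is infinite, the first nerve is empty; an \<open>H\<close>-invariant
  line exists iff \<open>H\<close> is virtually cyclic, and then all invariant lines are parallel, so the second
  nerve is contractible.
\<close>

subsection \<open>CAT(0) geometry\<close>

text \<open>Three obstacles shape the proof. The cover is given, not chosen: it may be uncountable
  and far from locally finite, and the weak topology of its nerve need not be metrizable. Maps and
  homotopies are therefore controlled on one closed simplex at a time, where they use finitely many
  vertices and continuity is coordinatewise. Next, an isometry may slide or reverse the lines that
  it preserves, so it does not act on a cross-section as it acts on the space. The absence of
  holonomy makes the induced map of base points a well-defined isometry. Finally, circumcenters are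
  controlled by closed balls while covers consist of open ones. An orbit has to stay in a smaller
  concentric ball, which is what discreteness of orbit distances provides. The join serves to
  separate two kinds of subgroups: lines invariant under a finite group may be absent or belong to
  several parallelism classes, and only a contractible first factor absorbs this.\<close>

lemma comparison_triangle_exists:
  fixes x y z :: "'a::metric_space"
  obtains a b e :: "real^2"
  where "dist a b = dist x y" "dist b e = dist y z" "dist e a = dist z x"
proof -
  define A B C where "A = dist x y" and "B = dist y z" and "C = dist z x"
  have tri: "A \<le> B + C" "B \<le> A + C" "C \<le> A + B" "0 \<le> A" "0 \<le> B" "0 \<le> C"
    unfolding A_def B_def C_def
    using dist_triangle[of x y z] dist_triangle[of y z x] dist_triangle[of z x y]
    by (simp_all add: dist_commute)
  have norm2: "norm (vector [u, v] :: real^2) = sqrt (u\<^sup>2 + v\<^sup>2)" for u v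
    by (simp add: norm_eq_sqrt_inner inner_vec_def sum_2 power2_eq_square)
  show ?thesis
  proof (cases "A = 0")
    case True
    then have "B = C" using tri by linarith
    moreover have "dist (0::real^2) 0 = A" using True by simp
    moreover have "dist (0::real^2) (vector [C, 0]) = C" "dist (vector [C, 0]) (0::real^2) = C"
      using tri norm2[of C 0] by (simp_all add: dist_norm)
    ultimately show ?thesis using that A_def B_def C_def by metis
  next
    case False
    then have A0: "A > 0" using tri by linarith
    \<comment> \<open>Law of cosines with x at the origin and y at (A, 0): z goes to (u, v), and |u|
      <= C, the condition for v to exist, is the triangle inequality.\<close>
    define u where "u = (A\<^sup>2 + C\<^sup>2 - B\<^sup>2) / (2 * A)"
    have uA: "2 * A * u = A\<^sup>2 + C\<^sup>2 - B\<^sup>2" using A0 by (simp add: u_def)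
    have "\<bar>2 * A * u\<bar> \<le> 2 * A * C"
    proof -
      have "(A - C)\<^sup>2 \<le> B\<^sup>2" using tri by (intro abs_le_square_iff[THEN iffD1]) auto
      moreover have "B\<^sup>2 \<le> (A + C)\<^sup>2" using tri by (intro power_mono) auto
      ultimately show ?thesis unfolding uA by (simp add: power2_eq_square algebra_simps abs_le_iff)
    qed
    then have "\<bar>u\<bar> \<le> C" using A0 by (simp add: abs_mult)
    then have uC: "u\<^sup>2 \<le> C\<^sup>2" using tri(6) by (metis abs_le_square_iff abs_of_nonneg)
    define v where "v = sqrt (C\<^sup>2 - u\<^sup>2)"
    have v2: "v\<^sup>2 = C\<^sup>2 - u\<^sup>2" using uC by (simp add: v_def)
    have "dist (0::real^2) (vector [A, 0]) = A"
      using tri norm2[of A 0] by (simp add: dist_norm)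
    moreover have "dist (vector [u, v] :: real^2) 0 = C"
      using tri norm2[of u v] v2 by (simp add: dist_norm)
    moreover have "dist (vector [A, 0] :: real^2) (vector [u, v]) = B"
    proof -
      have "(vector [A, 0] :: real^2) - vector [u, v] = vector [A - u, - v]"
        by (simp add: vec_eq_iff forall_2)
      moreover have "(A - u)\<^sup>2 + (-v)\<^sup>2 = B\<^sup>2"
        using uA v2 by (simp add: power2_eq_square algebra_simps)
      ultimately show ?thesis using norm2[of "A - u" "- v"] tri by (simp add: dist_norm)
    qed
    ultimately show ?thesis using that A_def B_def C_def by metis
  qed
qed

text \<open>Stewart's theorem for the point at ratio s on the side from a to b. The comparison axiom
  turns this identity into the inequality on which the locale below is based.\<close>

lemma stewart_identity:
  fixes a b e :: "'b::real_inner"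
  shows "(dist e (a + s *\<^sub>R (b - a)))\<^sup>2 =
    (1 - s) * (dist e a)\<^sup>2 + s * (dist e b)\<^sup>2 - s * (1 - s) * (dist a b)\<^sup>2"
proof -
  define p q where "p = e - a" and "q = b - a"
  have "e - (a + s *\<^sub>R (b - a)) = p - s *\<^sub>R q" "e - a = p" "e - b = p - q" "norm (a - b) = norm q"
    by (simp_all add: p_def q_def norm_minus_commute)
  then show ?thesis
    unfolding dist_norm power2_norm_eq_inner
    by (simp add: power2_norm_eq_inner inner_diff_left inner_diff_right inner_commute[of q p]
        algebra_simps)
qed

text \<open>\<open>w x y s\<close> stands for the point at ratio s on the geodesic from x to y. Its
  distances to x and y and its uniqueness follow from the inequality, by taking z among x, y and a
  competitor. One formula thus replaces paths and comparison triangles.\<close>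

locale hadamard =
  fixes w :: "'a::metric_space \<Rightarrow> 'a \<Rightarrow> real \<Rightarrow> 'a"
  assumes stewart: "\<lbrakk>0 \<le> s; s \<le> 1\<rbrakk> \<Longrightarrow>
      (dist z (w x y s))\<^sup>2 \<le> (1 - s) * (dist z x)\<^sup>2 + s * (dist z y)\<^sup>2 - s * (1 - s) * (dist x y)\<^sup>2"
    and proper: "compact (cball (x::'a) r)"

text \<open>Only one pair of points is compared: the vertex z and a point of the opposite side. The
  side from x to y is fixed before z is chosen, so one point serves all z.\<close>

lemma CAT0_imp_hadamard:
  assumes cat: "CAT0_space TYPE('a::metric_space)" and pro: "proper_space TYPE('a::metric_space)"
  obtains w :: "'a::metric_space \<Rightarrow> 'a \<Rightarrow> real \<Rightarrow> 'a" where "hadamard w"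
proof -
  have geo: "\<exists>c. geodesic_seg c x y" for x y :: 'a
    using cat unfolding CAT0_space_def by blast
  have cmp: "\<forall>(p, pb)\<in>tri_pairs c1 c2 c3 x y z a b e. \<forall>(q, qb)\<in>tri_pairs c1 c2 c3 x y z a b e.
           dist p q \<le> dist pb qb"
    if "geodesic_seg c1 x y" "geodesic_seg c2 y z" "geodesic_seg c3 z x"
      "dist a b = dist x y" "dist b e = dist y z" "dist e a = dist z x"
    for x y z :: 'a and c1 c2 c3 a b e
    using cat that unfolding CAT0_space_def by simp
  have "\<exists>m. \<forall>z. (dist z m)\<^sup>2 \<le> (1 - s) * (dist z x)\<^sup>2 + s * (dist z y)\<^sup>2 - s * (1 - s) * (dist x y)\<^sup>2"
    if s: "0 \<le> s" "s \<le> 1" for x y :: 'a and s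
  proof -
    obtain c1 where c1: "geodesic_seg c1 x y" using geo by blast
    show ?thesis
    proof (intro exI allI)
      fix z
      obtain c2 c3 where c2: "geodesic_seg c2 y z" and c3: "geodesic_seg c3 z x"
        using geo by meson
      obtain a b e :: "real^2"
        where abe: "dist a b = dist x y" "dist b e = dist y z" "dist e a = dist z x"
        using comparison_triangle_exists .
      have main: "\<forall>(p, pb)\<in>tri_pairs c1 c2 c3 x y z a b e. \<forall>(q, qb)\<in>tri_pairs c1 c2 c3 x y z a b e.
           dist p q \<le> dist pb qb"
        using cmp[OF c1 c2 c3 abe] .
      have "(c1 (s * dist x y), cmp_pt a b (s * dist x y)) \<in> tri_pairs c1 c2 c3 x y z a b e"
        using s unfolding tri_pairs_def by (auto simp: mult_left_le_one_le)
      \<comment> \<open>For x = y the parameter is divided by zero, which gives 0, and a = b, so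
        both sides are still a.\<close>
      moreover have "cmp_pt a b (s * dist x y) = a + s *\<^sub>R (b - a)"
        using abe(1) by (cases "x = y") (auto simp: cmp_pt_def)
      moreover have "(c2 (dist y z), cmp_pt b e (dist y z)) \<in> tri_pairs c1 c2 c3 x y z a b e"
        unfolding tri_pairs_def by auto
      moreover have "cmp_pt b e (dist y z) = e"
        using abe(2) by (cases "y = z") (auto simp: cmp_pt_def)
      moreover have "c2 (dist y z) = z" using c2 by (simp add: geodesic_seg_def)
      ultimately have "dist z (c1 (s * dist x y)) \<le> dist e (a + s *\<^sub>R (b - a))"
        using main by fastforce
      then have "(dist z (c1 (s * dist x y)))\<^sup>2 \<le> (dist e (a + s *\<^sub>R (b - a)))\<^sup>2"
        by (simp add: power_mono)
      then show "(dist z (c1 (s * dist x y)))\<^sup>2 \<le>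
          (1 - s) * (dist z x)\<^sup>2 + s * (dist z y)\<^sup>2 - s * (1 - s) * (dist x y)\<^sup>2"
        unfolding stewart_identity using abe by (metis dist_commute)
    qed
  qed
  note ex = this
  define w where "w = (\<lambda>(x::'a) y s. SOME m. \<forall>z. (dist z m)\<^sup>2 \<le>
      (1 - s) * (dist z x)\<^sup>2 + s * (dist z y)\<^sup>2 - s * (1 - s) * (dist x y)\<^sup>2)"
  have "\<forall>z. (dist z (w x y s))\<^sup>2 \<le>
      (1 - s) * (dist z x)\<^sup>2 + s * (dist z y)\<^sup>2 - s * (1 - s) * (dist x y)\<^sup>2"
    if "0 \<le> s" "s \<le> 1" for x y s
    unfolding w_def by (rule someI_ex[OF ex[OF that]])
  then have "hadamard w"
    using pro unfolding proper_space_def by unfold_locales auto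
  then show ?thesis using that by blast
qed

context hadamard
begin

text \<open>Stewart at z = x and z = y bounds both distances from above. Since they add up to at
  least d(x, y), both bounds are attained.\<close>

lemma
  assumes s: "0 \<le> s" "s \<le> 1"
  shows dist_w_left: "dist x (w x y s) = s * dist x y"
    and dist_w_right: "dist y (w x y s) = (1 - s) * dist x y"
proof -
  have "(dist x (w x y s))\<^sup>2 \<le> (s * dist x y)\<^sup>2"
    using stewart[OF s, of x x y] by (simp add: power2_eq_square algebra_simps)
  then have 1: "dist x (w x y s) \<le> s * dist x y" by (rule power2_le_imp_le) (use s in simp)
  have "(dist y (w x y s))\<^sup>2 \<le> ((1 - s) * dist x y)\<^sup>2"
    using stewart[OF s, of y x y] by (simp add: power2_eq_square algebra_simps dist_commute)
  then have 2: "dist y (w x y s) \<le> (1 - s) * dist x y" by (rule power2_le_imp_le) (use s in simp)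
  have "dist x y \<le> dist x (w x y s) + dist y (w x y s)" by (metis dist_commute dist_triangle)
  then show "dist x (w x y s) = s * dist x y" "dist y (w x y s) = (1 - s) * dist x y"
    using 1 2 by (auto simp: algebra_simps)
qed

text \<open>Stewart with z = m makes the right-hand side vanish.\<close>

lemma w_unique:
  assumes s: "0 \<le> s" "s \<le> 1" and "dist x m = s * dist x y" "dist y m = (1 - s) * dist x y"
  shows "m = w x y s"
proof -
  have "(dist m (w x y s))\<^sup>2 \<le> (1 - s) * (s * dist x y)\<^sup>2 + s * ((1 - s) * dist x y)\<^sup>2 - s * (1 - s) * (dist x y)\<^sup>2"
    using stewart[OF s, of m x y] assms by (simp add: dist_commute)
  also have "\<dots> = 0" by (simp add: power2_eq_square algebra_simps)
  finally show ?thesis by simp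
qed

lemma w_0 [simp]: "w x y 0 = x" and w_1 [simp]: "w x y 1 = y" and w_same [simp]:
    "0 \<le> s \<Longrightarrow> s \<le> 1 \<Longrightarrow> w x x s = x"
  using w_unique[of 0 x x y] w_unique[of 1 x y y] w_unique[of s x x x] by (auto simp: dist_commute)

lemma midpoint: "(dist z (w x y (1/2)))\<^sup>2 \<le> ((dist z x)\<^sup>2 + (dist z y)\<^sup>2) / 2 - (dist x y)\<^sup>2 / 4"
  using stewart[of "1/2" z x y] by (simp add: field_simps)

text \<open>Stewart is applied with z on one geodesic and once more with z = y'; all terms except
  s^2 d(y, y')^2 cancel.\<close>

lemma dist_w_w_right:
  assumes s: "0 \<le> s" "s \<le> 1"
  shows "dist (w x y s) (w x y' s) \<le> s * dist y y'"
proof -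
  have "(dist (w x y s) (w x y' s))\<^sup>2 \<le> (1 - s) * (dist (w x y s) x)\<^sup>2 + s * (dist (w x y s) y')\<^sup>2 - s * (1 - s) * (dist x y')\<^sup>2"
    using stewart[OF s] .
  also have "\<dots> \<le> (1 - s) * (s * dist x y)\<^sup>2 + s * ((1 - s) * (dist y' x)\<^sup>2 + s * (dist y' y)\<^sup>2 - s * (1 - s) * (dist x y)\<^sup>2) - s * (1 - s) * (dist x y')\<^sup>2"
    using stewart[OF s, of y' x y] dist_w_left[OF s, of x y] s
    by (intro diff_mono add_mono mult_left_mono) (auto simp: dist_commute)
  also have "\<dots> = (s * dist y y')\<^sup>2" by (simp add: power2_eq_square algebra_simps dist_commute)
  finally show ?thesis by (rule power2_le_imp_le) (use s in simp)
qed

lemma w_swap: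
  assumes s: "0 \<le> s" "s \<le> 1"
  shows "w x y s = w y x (1 - s)"
  using w_unique[of "1 - s" y "w x y s" x] dist_w_left[OF s] dist_w_right[OF s] s
  by (simp add: dist_commute)

text \<open>Convexity of the metric: the quadrilateral is cut along the diagonal from x to y', which
  leaves two pairs of geodesics with a common end.\<close>

lemma dist_w_w:
  assumes s: "0 \<le> s" "s \<le> 1"
  shows "dist (w x y s) (w x' y' s) \<le> (1 - s) * dist x x' + s * dist y y'"
proof -
  have "dist (w x y s) (w x' y' s) \<le> dist (w x y s) (w x y' s) + dist (w x y' s) (w x' y' s)"
    by (rule dist_triangle)
  moreover have "dist (w x y' s) (w x' y' s) \<le> (1 - s) * dist x x'"
    using dist_w_w_right[of "1 - s" y' x x'] w_swap[OF s] s by simp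
  ultimately show ?thesis using dist_w_w_right[OF s, of x y y'] by linarith
qed

text \<open>For s < t, the point at ratio s / t between x and \<open>w x y t\<close> has the
  distances from x and y that single out \<open>w x y s\<close>, so uniqueness identifies the
  two.\<close>

lemma dist_w_param:
  assumes "0 \<le> s" "s \<le> 1" "0 \<le> t" "t \<le> 1"
  shows "dist (w x y s) (w x y t) = \<bar>s - t\<bar> * dist x y"
proof -
  have le: "dist (w x y s) (w x y t) = (t - s) * dist x y" if "s < t" "0 \<le> s" "t \<le> 1" for s t
  proof -
    have t: "0 < t" using that by linarith
    define r where "r = s / t"
    have r: "0 \<le> r" "r \<le> 1" using that t by (auto simp: r_def divide_le_eq)
    define m where "m = w x (w x y t) r"
    have dm: "dist x m = s * dist x y" "dist (w x y t) m = (t - s) * dist x y"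
      unfolding m_def
      using dist_w_left[OF r, of x "w x y t"] dist_w_right[OF r, of "w x y t" x]
        dist_w_left[of t x y] that t
      by (auto simp: r_def algebra_simps)
    have "dist y m \<le> dist y (w x y t) + dist (w x y t) m" by (rule dist_triangle)
    then have "dist y m \<le> (1 - s) * dist x y"
      using dm dist_w_right[of t y x] that t by (simp add: algebra_simps)
    moreover have "dist x y \<le> dist x m + dist y m" by (metis dist_commute dist_triangle)
    ultimately have "dist y m = (1 - s) * dist x y" using dm by (simp add: algebra_simps)
    then have "m = w x y s" using w_unique dm(1) that by simp
    then show ?thesis using dm(2) by (simp add: dist_commute)
  qed
  show ?thesis using le[of s t] le[of t s] assms
    by (cases s t rule: linorder_cases) (auto simp: dist_commute)
qed

lemma continuous_on_w:
  "continuous_on ({0..1} \<times> UNIV) (\<lambda>(t, x). w x y t)"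
proof (clarsimp simp: continuous_on_iff)
  fix t :: real and x :: 'a and e :: real
  assume t: "0 \<le> t" "t \<le> 1" and e: "0 < e"
  define d where "d = e / (2 * (1 + dist x y))"
  have d: "d > 0" using e by (simp add: d_def add_pos_nonneg)
  show "\<exists>d>0. \<forall>t'\<in>{0..1}. \<forall>x'. dist (t', x') (t, x) < d \<longrightarrow> dist (w x' y t') (w x y t) < e"
  proof (intro exI[of _ "min d (e/2)"] conjI ballI allI impI)
    fix t' :: real and x'
    assume t': "t' \<in> {0..1}" and lt: "dist (t', x') (t, x) < min d (e/2)"
    have a: "\<bar>t' - t\<bar> < d" "dist x' x < e/2"
      using lt dist_fst_le[of "(t', x')" "(t, x)"] dist_snd_le[of "(t', x')" "(t, x)"]
      by (auto simp: dist_real_def)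
    have "dist (w x' y t') (w x y t) \<le> dist (w x' y t') (w x y t') + dist (w x y t') (w x y t)"
      by (rule dist_triangle)
    also have "dist (w x' y t') (w x y t') \<le> (1 - t') * dist x' x"
      using dist_w_w[of t' x' y x y] t' by simp
    also have "\<dots> \<le> dist x' x" using t' by (simp add: mult_left_le_one_le)
    also have "dist (w x y t') (w x y t) = \<bar>t' - t\<bar> * dist x y"
      using dist_w_param t t' by simp
    also have "\<dots> \<le> d * (1 + dist x y)" using a by (intro mult_mono) auto
    also have "\<dots> = e / 2" using add_pos_nonneg[of 1 "dist x y"]
      by (simp add: d_def field_simps)
    finally show "dist (w x' y t') (w x y t) < e" using a by linarith
  qed (use d e in auto)
qed

section \<open>Convex sets, strongly convex functions and circumcenters\<close>

definition cconvex :: "'a set \<Rightarrow> bool" where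
  "cconvex Y \<longleftrightarrow> (\<forall>x\<in>Y. \<forall>y\<in>Y. \<forall>s. 0 \<le> s \<longrightarrow> s \<le> 1 \<longrightarrow> w x y s \<in> Y)"

lemma cconvexD: "cconvex Y \<Longrightarrow> x \<in> Y \<Longrightarrow> y \<in> Y \<Longrightarrow> 0 \<le> s \<Longrightarrow> s \<le> 1 \<Longrightarrow> w x y s \<in> Y"
  by (simp add: cconvex_def)

lemma cconvex_cball: "cconvex (cball k r)"
  unfolding cconvex_def
proof (intro ballI allI impI)
  fix x y s assume a: "x \<in> cball k r" "y \<in> cball k r" "0 \<le> s" "s \<le> (1::real)"
  have "dist (w k k s) (w x y s) \<le> (1 - s) * dist k x + s * dist k y" using a by (intro dist_w_w) auto
  also have "\<dots> \<le> (1 - s) * r + s * r" using a by (intro add_mono mult_left_mono) auto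
  finally show "w x y s \<in> cball k r" using a by (simp add: algebra_simps)
qed

lemma compact_closed_bounded:
  assumes "closed S" "bounded (S :: 'a set)" shows "compact S"
proof -
  obtain x r where "S \<subseteq> cball x r" using assms(2) bounded_subset_cball by blast
  then have "S = cball x r \<inter> S" by auto
  then show ?thesis using proper[of x r] assms(1) compact_Int_closed by metis
qed

text \<open>The modulus is that of the squared distance to a point, as in \<open>midpoint\<close>.
  It survives maxima, suprema and added constants, which is how the functions minimized later
  acquire it.\<close>

definition strongly_convex_on :: "'a set \<Rightarrow> ('a \<Rightarrow> real) \<Rightarrow> bool" where
  "strongly_convex_on Y f \<longleftrightarrow> (\<forall>x\<in>Y. \<forall>y\<in>Y. f (w x y (1/2)) \<le> (f x + f y) / 2 - (dist x y)\<^sup>2 / 4)"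

text \<open>Evaluating f halfway between x and a base point shows that a lower bound on f makes
  sublevel sets bounded, so properness yields a minimum. The same evaluation against the minimizer
  gives the quadratic gap, the source of uniqueness and of continuous dependence.\<close>

lemma strongly_convex_minimum:
  assumes Y: "closed Y" "cconvex Y" "Y \<noteq> {}" and cont: "continuous_on Y f"
    and conv: "strongly_convex_on Y f" and below: "\<And>x. x \<in> Y \<Longrightarrow> b \<le> f x"
  obtains z where "z \<in> Y" "\<And>x. x \<in> Y \<Longrightarrow> f z + (dist x z)\<^sup>2 / 2 \<le> f x"
proof -
  obtain x0 where x0: "x0 \<in> Y" using Y by auto
  define S where "S = {x \<in> Y. f x \<le> f x0}"
  have "S = Y \<inter> f -` {..f x0}" by (auto simp: S_def)
  then have "closed S" using continuous_closed_preimage[OF cont Y(1), of "{..f x0}"] by auto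
  moreover have "bounded S"
  proof -
    have "dist x0 x \<le> sqrt (4 * (f x0 - b))" if "x \<in> S" for x
    proof -
      have x: "x \<in> Y" "f x \<le> f x0" using that by (auto simp: S_def)
      have "b \<le> f (w x0 x (1/2))" using below cconvexD[OF Y(2) x0 x(1)] by simp
      also have "\<dots> \<le> (f x0 + f x) / 2 - (dist x0 x)\<^sup>2 / 4"
        using conv x0 x by (simp add: strongly_convex_on_def)
      finally have "(dist x0 x)\<^sup>2 \<le> 4 * (f x0 - b)" using x(2) by (simp add: field_simps)
      then show ?thesis by (simp add: real_le_rsqrt)
    qed
    then show ?thesis unfolding bounded_def by blast
  qed
  ultimately have "compact S" by (rule compact_closed_bounded)
  moreover have "x0 \<in> S" using x0 by (simp add: S_def)
  moreover have "continuous_on S f" using cont by (rule continuous_on_subset) (auto simp: S_def)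
  ultimately obtain z where z: "z \<in> S" "\<forall>x\<in>S. f z \<le> f x"
    using continuous_attains_inf[of S f] by blast
  have zY: "z \<in> Y" using z by (simp add: S_def)
  have min: "f z \<le> f x" if "x \<in> Y" for x
    using z that unfolding S_def by (cases "f x \<le> f x0") auto
  have "f z + (dist x z)\<^sup>2 / 2 \<le> f x" if "x \<in> Y" for x
  proof -
    have "f z \<le> f (w x z (1/2))" using min cconvexD[OF Y(2) that zY] by simp
    also have "\<dots> \<le> (f x + f z) / 2 - (dist x z)\<^sup>2 / 4"
      using conv that zY by (simp add: strongly_convex_on_def)
    finally show ?thesis by (simp add: field_simps)
  qed
  then show ?thesis using that zY by blast
qed

text \<open>The circumradius is minimized not over Y but over the part C of Y that lies in all
  closed balls centred in Y and containing S. This puts the center into each such ball, as is needed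
  to stay inside every ball of a simplex. An isometry preserving Y and S maps z into C without
  increasing the radius, so the quadratic gap forces it to fix z.\<close>

lemma circumcenter:
  assumes Y: "closed Y" "cconvex Y" and S: "S \<subseteq> Y" "S \<noteq> {}" "bounded S"
  obtains z where "z \<in> Y" "\<And>k r. \<lbrakk>k \<in> Y; S \<subseteq> cball k r\<rbrakk> \<Longrightarrow> dist k z \<le> r"
    "\<And>f. \<lbrakk>f ` Y = Y; f ` S = S; \<And>x y. x \<in> Y \<Longrightarrow> y \<in> Y \<Longrightarrow> dist (f x) (f y) = dist x y\<rbrakk> \<Longrightarrow> f z = z"
proof -
  define C where "C = {x \<in> Y. \<forall>k\<in>Y. \<forall>r. S \<subseteq> cball k r \<longrightarrow> x \<in> cball k r}"
  have "C = Y \<inter> \<Inter>{cball k r | k r. k \<in> Y \<and> S \<subseteq> cball k r}"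
    unfolding C_def by blast
  then have clC: "closed C" using Y by (auto intro!: closed_Int closed_Inter)
  have coC: "cconvex C"
    unfolding cconvex_def
  proof (intro ballI allI impI)
    fix x y s assume a: "x \<in> C" "y \<in> C" "0 \<le> s" "s \<le> (1::real)"
    have "w x y s \<in> Y" using a by (intro cconvexD[OF Y(2)]) (auto simp: C_def)
    moreover have "w x y s \<in> cball k r" if "k \<in> Y" "S \<subseteq> cball k r" for k r
      using that a by (intro cconvexD[OF cconvex_cball]) (auto simp: C_def)
    ultimately show "w x y s \<in> C" unfolding C_def by blast
  qed
  have SC: "S \<subseteq> C" using S by (auto simp: C_def)
  define R where "R x = (SUP s\<in>S. dist x s)" for x
  have bdd: "bdd_above (dist x ` S)" for x
    using S(3) by (metis bounded_any_center bdd_aboveI2)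
  have Rge: "dist x s \<le> R x" if "s \<in> S" for x s
    unfolding R_def using that bdd by (intro cSUP_upper)
  have Rle: "R x \<le> B" if "\<And>s. s \<in> S \<Longrightarrow> dist x s \<le> B" for x B
    unfolding R_def using that S(2) by (intro cSUP_least)
  have R0: "0 \<le> R x" for x using S(2) Rge zero_le_dist by (metis all_not_in_conv order_trans)
  have lip: "R x \<le> R y + dist x y" for x y
  proof (rule Rle)
    fix s assume "s \<in> S"
    then show "dist x s \<le> R y + dist x y" using Rge[of s y] dist_triangle[of x s y] by linarith
  qed
  have contR: "continuous_on C R"
  proof (clarsimp simp: continuous_on_iff)
    fix x and e :: real assume "0 < e"
    then show "\<exists>d>0. \<forall>x'\<in>C. dist x' x < d \<longrightarrow> dist (R x') (R x) < e"
    proof (intro exI[of _ e] conjI ballI impI)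
      fix x' assume "dist x' x < e"
      then show "dist (R x') (R x) < e"
        using lip[of x x'] lip[of x' x] by (auto simp: dist_real_def dist_commute)
    qed
  qed
  have conv: "strongly_convex_on C (\<lambda>x. (R x)\<^sup>2)"
    unfolding strongly_convex_on_def
  proof (intro ballI)
    fix x y assume "x \<in> C" "y \<in> C"
    define B where "B = ((R x)\<^sup>2 + (R y)\<^sup>2) / 2 - (dist x y)\<^sup>2 / 4"
    have s2: "(dist (w x y (1/2)) s)\<^sup>2 \<le> B" if "s \<in> S" for s
    proof -
      have "(dist s x)\<^sup>2 \<le> (R x)\<^sup>2" "(dist s y)\<^sup>2 \<le> (R y)\<^sup>2"
        using Rge[OF that, of x] Rge[OF that, of y] by (auto intro!: power_mono simp: dist_commute)
      then show ?thesis using midpoint[of s x y] unfolding B_def dist_commute[of _ s] by (simp add: field_simps)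
    qed
    obtain s0 where "s0 \<in> S" using S(2) by blast
    then have B0: "0 \<le> B" using s2 by (meson order_trans zero_le_power2)
    have "R (w x y (1/2)) \<le> sqrt B" using s2 by (intro Rle) (simp add: real_le_rsqrt)
    then have "(R (w x y (1/2)))\<^sup>2 \<le> (sqrt B)\<^sup>2" using R0 by (intro power_mono)
    then show "(R (w x y (1/2)))\<^sup>2 \<le> ((R x)\<^sup>2 + (R y)\<^sup>2) / 2 - (dist x y)\<^sup>2 / 4"
      using B0 unfolding B_def by simp
  qed
  have "C \<noteq> {}" using SC S by auto
  moreover have "continuous_on C (\<lambda>x. (R x)\<^sup>2)" using contR by (intro continuous_intros)
  ultimately obtain z where z: "z \<in> C" "\<And>x. x \<in> C \<Longrightarrow> (R z)\<^sup>2 + (dist x z)\<^sup>2 / 2 \<le> (R x)\<^sup>2"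
    using strongly_convex_minimum[OF clC coC _ _ conv, of 0] zero_le_power2 by blast
  show ?thesis
  proof (rule that)
    show "z \<in> Y" using z by (simp add: C_def)
    show "dist k z \<le> r" if "k \<in> Y" "S \<subseteq> cball k r" for k r
      using z(1) that unfolding C_def by auto
  next
    fix f assume f: "f ` Y = Y" "f ` S = S" "\<And>x y. x \<in> Y \<Longrightarrow> y \<in> Y \<Longrightarrow> dist (f x) (f y) = dist x y"
    have zY: "z \<in> Y" using z by (simp add: C_def)
    have fz: "f z \<in> Y" using f(1) zY by blast
    have "f z \<in> C"
      unfolding C_def
    proof (clarsimp simp: fz)
      fix k r assume k: "k \<in> Y" "S \<subseteq> cball k r"
      obtain k' where k': "k' \<in> Y" "k = f k'" using f(1) k by blast
      have "S \<subseteq> cball k' r"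
      proof
        fix s assume s: "s \<in> S"
        then have "f s \<in> cball k r" using f(2) k by blast
        then show "s \<in> cball k' r" using f(3)[OF k'(1), of s] s S k' by auto
      qed
      then have "dist k' z \<le> r" using z(1) k' unfolding C_def by auto
      then show "dist k (f z) \<le> r" using f(3)[OF k'(1) zY] k' by simp
    qed
    moreover have "R (f z) \<le> R z"
    proof (rule Rle)
      fix s assume "s \<in> S"
      then obtain s' where s': "s' \<in> S" "s = f s'" using f(2) by blast
      then have "dist (f z) s = dist z s'" using f(3)[OF zY, of s'] S by auto
      then show "dist (f z) s \<le> R z" using Rge s' by simp
    qed
    then have "(R (f z))\<^sup>2 \<le> (R z)\<^sup>2" using R0 by (intro power_mono)
    ultimately have "(dist (f z) z)\<^sup>2 / 2 \<le> 0" using z(2)[of "f z"] by linarith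
    then show "f z = z" by simp
  qed
qed

end

subsection \<open>Flat strips and cross-sections\<close>

text \<open>Along an arithmetic progression the increments of a midpoint-convex function never
  decrease. If f a > f b, stepping from b by h = a - b adds at least f a - f b each time and finally
  exceeds M.\<close>

lemma bounded_midconvex_const:
  fixes f :: "real \<Rightarrow> real"
  assumes mid: "\<And>t s. f t \<le> (f (t + s) + f (t - s)) / 2" and M: "\<And>t. f t \<le> M"
  shows "f a = f b"
proof -
  have "f a \<le> f b" for a b
  proof (rule ccontr)
    assume "\<not> f a \<le> f b"
    define h \<delta> where "h = a - b" and "\<delta> = f a - f b"
    have d: "\<delta> > 0" using \<open>\<not> f a \<le> f b\<close> by (simp add: \<delta>_def)
    have step: "\<delta> \<le> f (b + real (Suc n) * h) - f (b + real n * h)" for n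
    proof (induction n)
      case (Suc n)
      have eqs: "b + real (Suc n) * h + h = b + real (Suc (Suc n)) * h"
        "b + real (Suc n) * h - h = b + real n * h"
        by (simp_all add: algebra_simps)
      show ?case using mid[of "b + real (Suc n) * h" h] Suc unfolding eqs by argo
    qed (simp add: h_def \<delta>_def)
    have grow: "f b + real n * \<delta> \<le> f (b + real n * h)" for n
    proof (induction n)
      case (Suc n)
      then show ?case using step[of n] by (simp add: algebra_simps)
    qed simp
    obtain n :: nat where "(M - f b) / \<delta> < real n" using reals_Archimedean2 by blast
    then have "M - f b < real n * \<delta>" using d by (simp add: divide_less_eq)
    then show False using grow[of n] M[of "b + real n * h"] by linarith
  qed
  then show ?thesis by (intro order_antisym)
qed

text \<open>A Cauchy-type equation with a bound in place of continuity. After subtracting the affine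
  interpolation through 0 and 1, the remainder H has period 1. The bound on the unit interval is
  then global, and H is constant.\<close>

lemma bounded_on_unit_midaffine:
  fixes f :: "real \<Rightarrow> real"
  assumes mid: "\<And>t s. f (t + s) + f (t - s) = 2 * f t" and M: "\<And>t. 0 \<le> t \<Longrightarrow> t \<le> 1 \<Longrightarrow> f t \<le> M"
  shows "f t = f 0 + t * (f 1 - f 0)"
proof -
  define H where "H t = f t - f 0 - t * (f 1 - f 0)" for t
  have H0: "H 0 = 0" "H 1 = 0" by (simp_all add: H_def)
  have Hmid: "H (t + s) + H (t - s) = 2 * H t" for t s
    using mid[of t s] by (simp add: H_def algebra_simps)
  have H2: "H (2 * x) = 2 * H x" for x using Hmid[of x x] H0 by simp
  have per: "H (x + 1) = H x" for x
  proof -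
    have e: "(x + 1) / 2 + (x - 1) / 2 = x" "(x + 1) / 2 - (x - 1) / 2 = 1" "2 * ((x + 1) / 2) = x + 1"
      by (simp_all add: field_simps)
    have "H x + H 1 = 2 * H ((x + 1) / 2)" using Hmid[of "(x + 1) / 2" "(x - 1) / 2"] unfolding e .
    moreover have "H (x + 1) = 2 * H ((x + 1) / 2)" using H2[of "(x + 1) / 2"] unfolding e .
    ultimately show ?thesis using H0 by simp
  qed
  have pern: "H (x + real n) = H x" for x n
    proof (induction n)
    case (Suc n)
    have "x + real (Suc n) = x + real n + 1" by simp
    then show ?case using per Suc by metis
  qed simp
  have periodic: "H (x + of_int k) = H x" for x k
  proof (cases "k \<ge> 0")
    case True then show ?thesis using pern[of x "nat k"] by simp
  next
    case False then show ?thesis using pern[of "x + of_int k" "nat (- k)"] by simp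
  qed
  have "H x \<le> M - f 0 + \<bar>f 1 - f 0\<bar>" for x
  proof -
    have fr: "0 \<le> frac x" "frac x \<le> 1" by (auto simp: frac_lt_1 less_imp_le)
    have "H x = H (frac x)" using periodic[of "frac x" "\<lfloor>x\<rfloor>"] by (simp add: frac_def)
    also have "\<dots> \<le> M - f 0 + \<bar>frac x * (f 1 - f 0)\<bar>" using M[OF fr] by (simp add: H_def)
    also have "\<bar>frac x * (f 1 - f 0)\<bar> \<le> \<bar>f 1 - f 0\<bar>"
      using fr by (simp add: abs_mult mult_left_le_one_le)
    finally show ?thesis by simp
  qed
  moreover have "H t \<le> (H (t + s) + H (t - s)) / 2" for t s using Hmid[of t s] by simp
  ultimately have "H t = H 0" using bounded_midconvex_const[of H] by blast
  then show ?thesis by (simp add: H_def)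
qed

section \<open>Parametrized lines and flat strips\<close>

lemma geodesic_line_dist: "geodesic_line c \<Longrightarrow> dist (c s) (c t) = \<bar>s - t\<bar>"
  by (simp add: geodesic_line_def)

lemma geodesic_line_affine:
  assumes "geodesic_line c" "\<bar>e\<bar> = 1"
  shows "geodesic_line (\<lambda>t. c (e * t + b))"
proof -
  have "\<bar>(e * s + b) - (e * t + b)\<bar> = \<bar>e\<bar> * \<bar>s - t\<bar>" for s t
    by (simp add: abs_mult[symmetric] right_diff_distrib)
  then show ?thesis using assms by (simp add: geodesic_line_def)
qed

lemma range_affine:
  assumes "\<bar>e\<bar> = (1::real)" shows "range (\<lambda>t. c (e * t + b)) = range c"
proof -
  have "c s \<in> range (\<lambda>t. c (e * t + b))" for s
    using assms by (intro image_eqI[of _ _ "e * (s - b)"]) (auto simp: abs_if split: if_splits)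
  then show ?thesis by auto
qed

text \<open>The images of 0 and 1 fix the orientation; every other image is determined by its
  distances to these two.\<close>

lemma real_isometry_cases:
  fixes g :: "real \<Rightarrow> real"
  assumes "\<And>s t. \<bar>g s - g t\<bar> = \<bar>s - t\<bar>"
  obtains e where "\<bar>e\<bar> = 1" "\<And>t. g t = e * t + g 0"
proof -
  define e where "e = g 1 - g 0"
  have e: "\<bar>e\<bar> = 1" using assms[of 1 0] by (simp add: e_def)
  have "g t = e * t + g 0" for t
  proof -
    consider "e = 1" | "e = -1" using e by linarith
    then show ?thesis
    proof cases
      case 1
      then have "g 1 = g 0 + 1" by (simp add: e_def)
      then have "g t = g 0 + t" using assms[of t 0] assms[of t 1] by (auto simp: abs_if split: if_splits)
      then show ?thesis using 1 by simp
    next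
      case 2
      then have "g 1 = g 0 - 1" by (simp add: e_def)
      then have "g t = g 0 - t" using assms[of t 0] assms[of t 1] by (auto simp: abs_if split: if_splits)
      then show ?thesis using 2 by simp
    qed
  qed
  then show ?thesis using that e by blast
qed

lemma geodesic_line_reparam:
  assumes c: "geodesic_line c" "geodesic_line c'" and r: "range c' \<subseteq> range c"
  obtains e b where "\<bar>e\<bar> = 1" "\<And>t. c' t = c (e * t + b)"
proof -
  have "\<exists>g. \<forall>t. c' t = c (g t)" using r by (intro choice) blast
  then obtain g where g: "\<And>t. c' t = c (g t)" by blast
  have "\<bar>g s - g t\<bar> = \<bar>s - t\<bar>" for s t
    using geodesic_line_dist[OF c(2), of s t] geodesic_line_dist[OF c(1), of "g s" "g t"] g by simp
  then obtain e where e: "\<bar>e\<bar> = 1" "\<And>t. g t = e * t + g 0" using real_isometry_cases by blast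
  have "c' t = c (e * t + g 0)" for t using g[of t] e(2)[of t] by simp
  then show ?thesis using that[of e "g 0"] e(1) by blast
qed

text \<open>Parallelism together with matching parametrizations: the equation is Pythagoras in a
  flat strip where c t and c' t lie opposite each other. Encoding it by distances alone makes
  symmetry and invariance under isometries immediate; the strip is recovered in
  \<open>sync_imp_flat_strip\<close>.\<close>

definition sync :: "(real \<Rightarrow> 'a::metric_space) \<Rightarrow> (real \<Rightarrow> 'a) \<Rightarrow> bool" where
  "sync c c' \<longleftrightarrow> geodesic_line c \<and> geodesic_line c' \<and>
     (\<forall>s t. (dist (c s) (c' t))\<^sup>2 = (s - t)\<^sup>2 + (dist (c 0) (c' 0))\<^sup>2)"

lemma sync_lines: "sync c c' \<Longrightarrow> geodesic_line c" "sync c c' \<Longrightarrow> geodesic_line c'"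
  by (auto simp: sync_def)

lemma sync_dist: "sync c c' \<Longrightarrow> (dist (c s) (c' t))\<^sup>2 = (s - t)\<^sup>2 + (dist (c 0) (c' 0))\<^sup>2"
  unfolding sync_def by blast

lemma sync_dist_eq: "sync c c' \<Longrightarrow> dist (c t) (c' t) = dist (c 0) (c' 0)"
  using sync_dist[of c c' t t] by simp

lemma syncI:
  assumes "geodesic_line c" "geodesic_line c'" "\<And>s t. (dist (c s) (c' t))\<^sup>2 = (s - t)\<^sup>2 + k"
  shows "sync c c'"
proof -
  have "(dist (c 0) (c' 0))\<^sup>2 = k" using assms(3)[of 0 0] by simp
  then show ?thesis unfolding sync_def using assms by blast
qed

lemma sync_sym:
  assumes "sync c c'" shows "sync c' c"
proof (rule syncI)
  show "(dist (c' s) (c t))\<^sup>2 = (s - t)\<^sup>2 + (dist (c 0) (c' 0))\<^sup>2" for s t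
    using sync_dist[OF assms, of t s] unfolding dist_commute[of "c' s"] power2_commute[of s t] .
qed (use assms sync_lines in auto)

lemma sync_refl: "geodesic_line c \<Longrightarrow> sync c c"
  by (rule syncI[where k = 0]) (auto simp: geodesic_line_def)

lemma sync_affine:
  assumes "sync c c'" "\<bar>e\<bar> = 1"
  shows "sync (\<lambda>t. c (e * t + b)) (\<lambda>t. c' (e * t + b))"
proof (rule syncI)
  show "geodesic_line (\<lambda>t. c (e * t + b))" "geodesic_line (\<lambda>t. c' (e * t + b))"
    using assms sync_lines geodesic_line_affine by blast+
  have "e\<^sup>2 = 1" using assms(2) by (metis power2_abs one_power2)
  then have "(e * s + b - (e * t + b))\<^sup>2 = (s - t)\<^sup>2" for s t
    by (simp add: right_diff_distrib[symmetric] power_mult_distrib)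
  then show "(dist (c (e * s + b)) (c' (e * t + b)))\<^sup>2 = (s - t)\<^sup>2 + (dist (c 0) (c' 0))\<^sup>2" for s t
    using sync_dist[OF assms(1), of "e * s + b" "e * t + b"] by simp
qed

text \<open>At a common point both summands of Pythagoras vanish, so the width is 0. Lines in sync
  are therefore equal or disjoint.\<close>

lemma sync_same_range:
  assumes "sync c c'" "range c \<inter> range c' \<noteq> {}" shows "c = c'"
proof -
  obtain s t where "c s = c' t" using assms(2) by blast
  then have "(s - t)\<^sup>2 + (dist (c 0) (c' 0))\<^sup>2 = 0" using sync_dist[OF assms(1), of s t] by simp
  then have "dist (c 0) (c' 0) = 0"
    by (metis add_nonneg_eq_0_iff zero_le_power2 power2_eq_iff_nonneg zero_eq_power2)
  then show ?thesis using sync_dist_eq[OF assms(1)] by auto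
qed

text \<open>The width is the distance from any point of one side to the other side, so the two lines
  determine it. Hence the infimum in \<open>line_dist\<close> runs over at most one value.\<close>

lemma flat_strip_width:
  fixes l1 l2 :: "'a::metric_space set"
  assumes "flat_strip l1 l2 K" "p \<in> l1"
  shows "\<And>q. q \<in> l2 \<Longrightarrow> K \<le> dist p q" "\<exists>q\<in>l2. dist p q = K"
proof -
  obtain f :: "real \<times> real \<Rightarrow> 'a" where K: "0 \<le> K" and "\<forall>p\<in>UNIV \<times> {0..K}. \<forall>q\<in>UNIV \<times> {0..K}. dist (f p) (f q) = dist p q"
    and l: "f ` (UNIV \<times> {0}) = l1" "f ` (UNIV \<times> {K}) = l2"
    using assms(1) unfolding flat_strip_def by blast
  then have f: "dist (f p) (f q) = dist p q" if "p \<in> UNIV \<times> {0..K}" "q \<in> UNIV \<times> {0..K}" for p q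
    using that by blast
  obtain s where s: "p = f (s, 0)" using l assms(2) by auto
  have d: "dist p (f (t, K)) = sqrt ((s - t)\<^sup>2 + K\<^sup>2)" for t
    using f[of "(s, 0)" "(t, K)"] K s by (simp add: dist_Pair_Pair dist_real_def)
  show "K \<le> dist p q" if q: "q \<in> l2" for q
  proof -
    obtain t where "q = f (t, K)" using l q by auto
    then show ?thesis using d[of t] by (simp add: real_le_rsqrt)
  qed
  show "\<exists>q\<in>l2. dist p q = K" using d[of s] l K by (intro bexI[of _ "f (s, K)"]) auto
qed

lemma flat_strip_imp_sync:
  fixes l1 l2 :: "'a::metric_space set"
  assumes "flat_strip l1 l2 K"
  obtains c1 c2 where "sync c1 c2" "range c1 = l1" "range c2 = l2" "dist (c1 0) (c2 0) = K"
proof -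
  obtain f :: "real \<times> real \<Rightarrow> 'a" where K: "0 \<le> K" and "\<forall>p\<in>UNIV \<times> {0..K}. \<forall>q\<in>UNIV \<times> {0..K}. dist (f p) (f q) = dist p q"
    and l: "f ` (UNIV \<times> {0}) = l1" "f ` (UNIV \<times> {K}) = l2"
    using assms(1) unfolding flat_strip_def by blast
  then have f: "dist (f p) (f q) = dist p q" if "p \<in> UNIV \<times> {0..K}" "q \<in> UNIV \<times> {0..K}" for p q
    using that by blast
  have d: "dist (f (s, u)) (f (t, v)) = sqrt ((s - t)\<^sup>2 + (u - v)\<^sup>2)" if "u \<in> {0..K}" "v \<in> {0..K}" for s t u v
    using f[of "(s, u)" "(t, v)"] that by (simp add: dist_Pair_Pair dist_real_def)
  have "sync (\<lambda>t. f (t, 0)) (\<lambda>t. f (t, K))"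
    by (rule syncI[where k = "K\<^sup>2"]) (use d K in \<open>auto simp: geodesic_line_def\<close>)
  moreover have "range (\<lambda>t. f (t, 0)) = l1" "range (\<lambda>t. f (t, K)) = l2"
    using l by auto
  moreover have "dist (f (0, 0)) (f (0, K)) = K" using d K by simp
  ultimately show ?thesis using that by blast
qed

context hadamard
begin

text \<open>Both x2 and x4 are compared with the midpoint of x1 and x3, and (u + v)^2 <= 2 u^2 + 2
  v^2 joins the two estimates.\<close>

lemma quadrilateral:
  "(dist x1 x3)\<^sup>2 + (dist x2 x4)\<^sup>2 \<le> (dist x1 x2)\<^sup>2 + (dist x2 x3)\<^sup>2 + (dist x3 x4)\<^sup>2 + (dist x4 (x1::'a))\<^sup>2"
proof -
  define m where "m = w x1 x3 (1/2)"
  have 1: "(dist x2 m)\<^sup>2 \<le> ((dist x1 x2)\<^sup>2 + (dist x2 x3)\<^sup>2) / 2 - (dist x1 x3)\<^sup>2 / 4"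
    using midpoint[of x2 x1 x3] unfolding m_def by (simp add: dist_commute)
  have 2: "(dist x4 m)\<^sup>2 \<le> ((dist x4 x1)\<^sup>2 + (dist x3 x4)\<^sup>2) / 2 - (dist x1 x3)\<^sup>2 / 4"
    using midpoint[of x4 x1 x3] unfolding m_def by (simp add: dist_commute)
  have "dist x2 x4 \<le> dist x2 m + dist x4 m" by (rule dist_triangle2)
  then have "(dist x2 x4)\<^sup>2 \<le> (dist x2 m + dist x4 m)\<^sup>2" by (intro power_mono) auto
  also have "\<dots> \<le> 2 * (dist x2 m)\<^sup>2 + 2 * (dist x4 m)\<^sup>2"
    using sum_squares_bound[of "dist x2 m" "dist x4 m"] by (simp add: power2_sum)
  finally show ?thesis using 1 2 by argo
qed

lemma geodesic_line_w:
  assumes "geodesic_line c" "0 \<le> u" "u \<le> 1"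
  shows "c ((1 - u) * s + u * t) = w (c s) (c t) u"
proof (rule w_unique)
  have "s - ((1 - u) * s + u * t) = u * (s - t)" "t - ((1 - u) * s + u * t) = (1 - u) * (t - s)"
    by (simp_all add: algebra_simps)
  then show "dist (c s) (c ((1 - u) * s + u * t)) = u * dist (c s) (c t)"
    "dist (c t) (c ((1 - u) * s + u * t)) = (1 - u) * dist (c s) (c t)"
    using assms by (simp_all add: geodesic_line_dist abs_mult abs_minus_commute)
qed (use assms in auto)

text \<open>By convexity of the metric, the distance at equal times is midpoint convex; being
  bounded, it is constant.\<close>

lemma bounded_lines_dist_const:
  fixes c c' :: "real \<Rightarrow> 'a"
  assumes c: "geodesic_line c" "geodesic_line c'" and M: "\<And>t. dist (c t) (c' t) \<le> M"
  shows "dist (c t) (c' t) = dist (c 0) (c' 0)"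
proof (rule bounded_midconvex_const[of "\<lambda>t. dist (c t) (c' t)", OF _ M])
  fix t s
  have "c t = w (c (t + s)) (c (t - s)) (1/2)" "c' t = w (c' (t + s)) (c' (t - s)) (1/2)"
    using geodesic_line_w[OF c(1), of "1/2" "t + s" "t - s"]
      geodesic_line_w[OF c(2), of "1/2" "t + s" "t - s"] by (simp_all add: field_simps)
  then show "dist (c t) (c' t) \<le> (dist (c (t + s)) (c' (t + s)) + dist (c (t - s)) (c' (t - s))) / 2"
    using dist_w_w[of "1/2" "c (t + s)" "c (t - s)" "c' (t + s)" "c' (t - s)"] by simp
qed

text \<open>Flat strip theorem: \<open>s \<mapsto> d(c(0), c'(s))\<^sup>2 - s\<^sup>2\<close> is midpoint convex by the CN inequality and
  midpoint concave by the quadrilateral inequality.\<close>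

lemma bounded_lines_imp_sync:
  fixes c c' :: "real \<Rightarrow> 'a"
  assumes c: "geodesic_line c" "geodesic_line c'" and M: "\<And>t. dist (c t) (c' t) \<le> M"
  obtains a where "sync c (\<lambda>t. c' (t + a))"
proof -
  define g where "g s = dist (c 0) (c' s)" for s
  have shift: "geodesic_line (\<lambda>t. c' (t + s))" for s
    using geodesic_line_affine[OF c(2), of 1 s] by simp
  \<comment> \<open>For each shift s the distance of matched points is bounded in t, hence constant.
    All distances between the two lines are thus values of the one function g.\<close>
  have g: "dist (c t) (c' (t + s)) = g s" for s t
  proof -
    have "dist (c t) (c' (t + s)) \<le> M + \<bar>s\<bar>" for t
      using dist_triangle[of "c t" "c' (t + s)" "c' t"] M[of t] geodesic_line_dist[OF c(2), of t "t + s"]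
      by simp
    then have "dist (c t) (c' (t + s)) = dist (c 0) (c' (0 + s))"
      by (rule bounded_lines_dist_const[OF c(1) shift])
    then show ?thesis by (simp add: g_def)
  qed
  have g': "dist (c s) (c' t) = g (t - s)" for s t using g[of s "t - s"] by simp
  define F where "F s = (g s)\<^sup>2 - s\<^sup>2" for s
  have "F (t + s) + F (t - s) = 2 * F t" for t s
  proof -
    have "(g t)\<^sup>2 \<le> ((g (t + s))\<^sup>2 + (g (t - s))\<^sup>2) / 2 - s\<^sup>2"
    proof -
      have "c' t = w (c' (t + s)) (c' (t - s)) (1/2)"
        using geodesic_line_w[OF c(2), of "1/2" "t + s" "t - s"] by (simp add: field_simps)
      moreover have "(dist (c' (t + s)) (c' (t - s)))\<^sup>2 / 4 = s\<^sup>2"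
        using geodesic_line_dist[OF c(2), of "t + s" "t - s"] by (simp add: power2_eq_square)
      ultimately show ?thesis
        using midpoint[of "c 0" "c' (t + s)" "c' (t - s)"] by (simp add: g_def)
    qed
    moreover have "(g (t + s))\<^sup>2 + (g (t - s))\<^sup>2 \<le> s\<^sup>2 + (g t)\<^sup>2 + s\<^sup>2 + (g t)\<^sup>2"
      using quadrilateral[of "c 0" "c' (t + s)" "c s" "c' t"]
        geodesic_line_dist[OF c(1), of 0 s] geodesic_line_dist[OF c(2), of "t + s" t]
      by (simp add: g' dist_commute[of "c' t" "c 0"])
    ultimately show ?thesis by (simp add: F_def power2_eq_square algebra_simps)
  qed
  moreover have "F t \<le> (g 0 + 1)\<^sup>2" if "0 \<le> t" "t \<le> 1" for t
  proof -
    have "g t \<le> g 0 + 1"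
      using dist_triangle[of "c 0" "c' t" "c' 0"] geodesic_line_dist[OF c(2), of 0 t] that
      by (simp add: g_def)
    then have "(g t)\<^sup>2 \<le> (g 0 + 1)\<^sup>2" by (intro power_mono) (auto simp: g_def)
    then show ?thesis unfolding F_def by (meson diff_le_eq le_add_same_cancel1 order_trans zero_le_power2)
  qed
  ultimately have "F t = F 0 + t * (F 1 - F 0)" for t by (rule bounded_on_unit_midaffine)
  then have gsq: "(g t)\<^sup>2 = t\<^sup>2 + t * (F 1 - F 0) + F 0" for t
    using F_def[of t] by (metis add.commute add.left_commute diff_add_cancel)
  \<comment> \<open>F is affine, so g^2 is a quadratic with leading term t^2; a is its vertex, the
    time at which c' is nearest to c 0.\<close>
  define a where "a = - (F 1 - F 0) / 2"
  have sq: "(g t)\<^sup>2 = (t - a)\<^sup>2 + (F 0 - a\<^sup>2)" for t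
    unfolding gsq by (simp add: a_def power2_eq_square field_simps)
  have "sync c (\<lambda>t. c' (t + a))"
  proof (rule syncI[OF c(1) shift])
    fix s t
    have "(t + a - s - a)\<^sup>2 = (s - t)\<^sup>2" by (simp add: power2_eq_square algebra_simps)
    then show "(dist (c s) (c' (t + a)))\<^sup>2 = (s - t)\<^sup>2 + (F 0 - a\<^sup>2)" unfolding g' sq by simp
  qed
  then show ?thesis using that by blast
qed

text \<open>There is no holonomy: a shift \<open>a\<close> between \<open>c1\<close> and \<open>c3\<close> would violate the triangle
  inequality through \<open>c2 (T / 2)\<close> for one of the directions \<open>T \<rightarrow> \<plusminus>\<infinity>\<close>.\<close>

lemma sync_trans:
  fixes c1 c2 c3 :: "real \<Rightarrow> 'a"
  assumes s12: "sync c1 c2" and s23: "sync c2 c3"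
  shows "sync c1 c3"
proof -
  define K L where "K = dist (c1 0) (c2 0)" and "L = dist (c2 0) (c3 0)"
  have "dist (c1 t) (c3 t) \<le> K + L" for t
    using dist_triangle[of "c1 t" "c3 t" "c2 t"] sync_dist_eq[OF s12, of t] sync_dist_eq[OF s23, of t]
    by (simp add: K_def L_def)
  then obtain a where a: "sync c1 (\<lambda>t. c3 (t + a))"
    using bounded_lines_imp_sync sync_lines s12 s23 by metis
  \<comment> \<open>By this tangent estimate the path through \<open>c2 (T/2)\<close> is at most
    (K^2 + L^2) / |T| longer than |T|.\<close>
  have sqb: "sqrt (x\<^sup>2 + k\<^sup>2) \<le> x + k\<^sup>2 / (2 * x)" if "x > 0" for x k :: real
  proof (rule real_le_lsqrt)
    show "x\<^sup>2 + k\<^sup>2 \<le> (x + k\<^sup>2 / (2 * x))\<^sup>2"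
      using that by (simp add: power2_sum)
  qed (use that in auto)
  have bound: "\<bar>T - a\<bar> \<le> \<bar>T\<bar> + (K\<^sup>2 + L\<^sup>2) / \<bar>T\<bar>" if "T \<noteq> 0" for T
  proof -
    have "(T - a)\<^sup>2 \<le> (dist (c1 0) (c3 T))\<^sup>2"
      using sync_dist[OF a, of 0 "T - a"] by (simp add: power2_commute)
    then have "\<bar>T - a\<bar> \<le> dist (c1 0) (c3 T)" by (metis abs_le_square_iff abs_of_nonneg zero_le_dist)
    also have "\<dots> \<le> dist (c1 0) (c2 (T/2)) + dist (c2 (T/2)) (c3 T)" by (rule dist_triangle)
    also have "dist (c1 0) (c2 (T/2)) = sqrt ((\<bar>T\<bar> / 2)\<^sup>2 + K\<^sup>2)"
      using sync_dist[OF s12, of 0 "T/2"] unfolding K_def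
      by (intro real_sqrt_unique[symmetric]) (auto simp: power_divide)
    also have "\<dots> \<le> \<bar>T\<bar> / 2 + K\<^sup>2 / \<bar>T\<bar>" using sqb[of "\<bar>T\<bar> / 2" K] that by simp
    also have "dist (c2 (T/2)) (c3 T) = sqrt ((\<bar>T\<bar> / 2)\<^sup>2 + L\<^sup>2)"
    proof -
      have "(T / 2 - T)\<^sup>2 = (\<bar>T\<bar> / 2)\<^sup>2" by (simp add: power2_eq_square)
      then show ?thesis using sync_dist[OF s23, of "T/2" T] unfolding L_def
        by (intro real_sqrt_unique[symmetric]) auto
    qed
    also have "\<dots> \<le> \<bar>T\<bar> / 2 + L\<^sup>2 / \<bar>T\<bar>" using sqb[of "\<bar>T\<bar> / 2" L] that by simp
    finally show ?thesis by (simp add: add_divide_distrib)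
  qed
  have "a = 0"
  proof (rule ccontr)
    assume "a \<noteq> 0"
    define C where "C = K\<^sup>2 + L\<^sup>2 + 1"
    have C: "C > 0" by (simp add: C_def add_nonneg_pos)
    \<comment> \<open>T points away from a and is so long that the error (K^2 + L^2) / |T| is
      smaller than |a|; the summand 1 in C makes this strict.\<close>
    define T where "T = - sgn a * (C / \<bar>a\<bar>)"
    have T: "\<bar>T\<bar> = C / \<bar>a\<bar>" "T \<noteq> 0" "\<bar>T - a\<bar> = \<bar>T\<bar> + \<bar>a\<bar>"
    proof -
      show "\<bar>T\<bar> = C / \<bar>a\<bar>" "T \<noteq> 0" using C \<open>a \<noteq> 0\<close> by (auto simp: T_def abs_mult sgn_if)
      have "C / \<bar>a\<bar> > 0" using C \<open>a \<noteq> 0\<close> by simp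
      then show "\<bar>T - a\<bar> = \<bar>T\<bar> + \<bar>a\<bar>"
        using \<open>a \<noteq> 0\<close> unfolding T_def by (cases "a > 0") (simp_all add: sgn_if abs_real_def)
    qed
    have "\<bar>a\<bar> \<le> (K\<^sup>2 + L\<^sup>2) / \<bar>T\<bar>" using bound[OF T(2)] T(3) by simp
    also have "\<dots> = (K\<^sup>2 + L\<^sup>2) * \<bar>a\<bar> / C" unfolding T(1) by simp
    also have "\<dots> < \<bar>a\<bar>" using C \<open>a \<noteq> 0\<close> by (simp add: divide_less_eq C_def)
    finally show False by simp
  qed
  then show ?thesis using a by simp
qed

text \<open>The upper bound is Stewart, applied twice to the rungs from c1 to c2. For a < b the
  lower bound comes from prolonging the segment to both boundary lines: the distance of its ends is
  known, and the upper bounds on the two outer pieces leave enough for the middle one. The case a =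
  b is a limit.\<close>

lemma strip_dist:
  fixes c1 c2 :: "real \<Rightarrow> 'a"
  assumes sy: "sync c1 c2" and ab: "0 \<le> a" "a \<le> 1" "0 \<le> b" "b \<le> 1"
  shows "(dist (w (c1 s) (c2 s) a) (w (c1 t) (c2 t) b))\<^sup>2 = (s - t)\<^sup>2 + ((a - b) * dist (c1 0) (c2 0))\<^sup>2"
proof -
  define K where "K = dist (c1 0) (c2 0)"
  define P where "P s a = w (c1 s) (c2 s) a" for s a
  have d12: "(dist (c1 s) (c2 t))\<^sup>2 = (s - t)\<^sup>2 + K\<^sup>2" for s t
    unfolding K_def by (rule sync_dist[OF sy])
  have d11: "(dist (c1 s) (c1 t))\<^sup>2 = (s - t)\<^sup>2" "(dist (c2 s) (c2 t))\<^sup>2 = (s - t)\<^sup>2" for s t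
    using sync_lines[OF sy] by (auto simp: geodesic_line_dist)
  have up1: "(dist (c1 s) (P t b))\<^sup>2 \<le> (s - t)\<^sup>2 + b\<^sup>2 * K\<^sup>2" if "0 \<le> b" "b \<le> 1" for s t b
    using stewart[OF that, of "c1 s" "c1 t" "c2 t"] unfolding P_def d12 d11
    by (simp add: power2_eq_square algebra_simps)
  have up2: "(dist (c2 s) (P t b))\<^sup>2 \<le> (s - t)\<^sup>2 + (1 - b)\<^sup>2 * K\<^sup>2" if "0 \<le> b" "b \<le> 1" for s t b
    using stewart[OF that, of "c2 s" "c1 t" "c2 t"] unfolding P_def d12 d11 dist_commute[of "c2 s" "c1 t"]
    by (simp add: power2_eq_square algebra_simps)
  have up: "(dist (P s a) (P t b))\<^sup>2 \<le> (s - t)\<^sup>2 + (a - b)\<^sup>2 * K\<^sup>2"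
    if "0 \<le> a" "a \<le> 1" "0 \<le> b" "b \<le> 1" for s t a b
  proof -
    have "(dist (P t b) (P s a))\<^sup>2 \<le> (1 - a) * (dist (P t b) (c1 s))\<^sup>2 + a * (dist (P t b) (c2 s))\<^sup>2 - a * (1 - a) * K\<^sup>2"
      using stewart[OF that(1,2), of "P t b" "c1 s" "c2 s"] d12[of s s] unfolding P_def[of s a] by simp
    also have "\<dots> \<le> (1 - a) * ((s - t)\<^sup>2 + b\<^sup>2 * K\<^sup>2) + a * ((s - t)\<^sup>2 + (1 - b)\<^sup>2 * K\<^sup>2) - a * (1 - a) * K\<^sup>2"
      using that up1[of b s t] up2[of b s t]
      by (intro diff_mono add_mono mult_left_mono) (auto simp: dist_commute)
    also have "\<dots> = (s - t)\<^sup>2 + (a - b)\<^sup>2 * K\<^sup>2" by (simp add: power2_eq_square algebra_simps)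
    finally show ?thesis by (simp add: dist_commute)
  qed
  have lt: "(s - t)\<^sup>2 + (a - b)\<^sup>2 * K\<^sup>2 \<le> (dist (P s a) (P t b))\<^sup>2"
    if "0 \<le> a" "a < b" "b \<le> 1" for s t a b
  proof -
    \<comment> \<open>Slope of the segment through the two points in the strip: ratio x is passed at
      time s + (x - a) v.\<close>
    define v where "v = (t - s) / (b - a)"
    define D where "D = sqrt (v\<^sup>2 + K\<^sup>2)"
    have D0: "0 \<le> D" and D2: "D\<^sup>2 = v\<^sup>2 + K\<^sup>2" by (simp_all add: D_def)
    have vt: "v * (b - a) = t - s" using that by (simp add: v_def)
    have seg: "dist (P (s + (x - a) * v) x) (P (s + (y - a) * v) y) \<le> (y - x) * D"
      if "0 \<le> x" "x \<le> y" "y \<le> 1" for x y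
    proof (rule power2_le_imp_le)
      have "(dist (P (s + (x - a) * v) x) (P (s + (y - a) * v) y))\<^sup>2
        \<le> ((s + (x - a) * v) - (s + (y - a) * v))\<^sup>2 + (x - y)\<^sup>2 * K\<^sup>2"
        by (rule up) (use that in auto)
      also have "\<dots> = ((y - x) * D)\<^sup>2"
        unfolding power_mult_distrib D2 by (simp add: power2_eq_square algebra_simps)
      finally show "(dist (P (s + (x - a) * v) x) (P (s + (y - a) * v) y))\<^sup>2 \<le> ((y - x) * D)\<^sup>2" .
    qed (use that D0 in auto)
    define p0 p1 where "p0 = P (s + (0 - a) * v) 0" and "p1 = P (s + (1 - a) * v) 1"
    have pb: "P (s + (b - a) * v) b = P t b" using vt by (simp add: mult.commute)
    have "(dist p0 p1)\<^sup>2 = D\<^sup>2"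
      unfolding p0_def p1_def P_def w_0 w_1 d12 D2 by (simp add: power2_eq_square algebra_simps)
    then have "dist p0 p1 = D" using D0 by simp
    moreover have "dist p0 (P s a) \<le> a * D" using seg[of 0 a] that by (simp add: p0_def)
    moreover have "dist (P t b) p1 \<le> (1 - b) * D" using seg[of b 1] that pb by (simp add: p1_def)
    moreover have "dist p0 p1 \<le> dist p0 (P s a) + dist (P s a) (P t b) + dist (P t b) p1"
      using dist_triangle[of p0 p1 "P s a"] dist_triangle[of "P s a" p1 "P t b"] by linarith
    ultimately have "(b - a) * D \<le> dist (P s a) (P t b)" by (simp add: algebra_simps)
    then have "((b - a) * D)\<^sup>2 \<le> (dist (P s a) (P t b))\<^sup>2" using that D0 by (intro power_mono) auto
    moreover have "((b - a) * D)\<^sup>2 = (v * (b - a))\<^sup>2 + (b - a)\<^sup>2 * K\<^sup>2"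
      unfolding power_mult_distrib D2 by (simp add: algebra_simps)
    ultimately show ?thesis unfolding vt by (simp add: power2_commute)
  qed
  have eq: "(s - t)\<^sup>2 \<le> (dist (P s a) (P t a))\<^sup>2" if "0 \<le> a" "a \<le> 1" for s t a
  proof -
    have "\<bar>s - t\<bar> \<le> dist (P s a) (P t a) + e" if "e > 0" for e
    proof -
      \<comment> \<open>The slope is undefined for equal ratios, so b is moved off a by \<eta>, to
        the side that stays within [0, 1], at a cost of \<eta> K <= e.\<close>
      define \<eta> where "\<eta> = min (1/2) (e / (K + 1))"
      have K0: "0 \<le> K" by (simp add: K_def)
      have \<eta>: "0 < \<eta>" "\<eta> \<le> 1/2" "\<eta> * K \<le> e"
      proof -
        show "0 < \<eta>" using that K0 by (auto simp: \<eta>_def)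
        show "\<eta> \<le> 1/2" unfolding \<eta>_def by (rule min.cobounded1)
        have "\<eta> * K \<le> e / (K + 1) * (K + 1)" using K0 that by (intro mult_mono) (auto simp: \<eta>_def)
        then show "\<eta> * K \<le> e" using K0 by simp
      qed
      define b where "b = (if a \<le> 1/2 then a + \<eta> else a - \<eta>)"
      have b: "0 \<le> b" "b \<le> 1" "b \<noteq> a" "\<bar>b - a\<bar> = \<eta>"
        using \<eta> \<open>0 \<le> a\<close> \<open>a \<le> 1\<close> by (auto simp: b_def)
      have "(s - t)\<^sup>2 \<le> (dist (P s a) (P t b))\<^sup>2"
      proof (cases "a < b")
        case True
        have "(s - t)\<^sup>2 + (a - b)\<^sup>2 * K\<^sup>2 \<le> (dist (P s a) (P t b))\<^sup>2" by (rule lt) (use True b \<open>0 \<le> a\<close> in auto)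
        then show ?thesis by (meson le_add_same_cancel1 order_trans zero_le_mult_iff zero_le_power2)
      next
        case False
        have "(t - s)\<^sup>2 + (b - a)\<^sup>2 * K\<^sup>2 \<le> (dist (P t b) (P s a))\<^sup>2" by (rule lt) (use False b \<open>a \<le> 1\<close> in auto)
        then have "(t - s)\<^sup>2 \<le> (dist (P t b) (P s a))\<^sup>2"
          by (meson le_add_same_cancel1 order_trans zero_le_mult_iff zero_le_power2)
        then show ?thesis unfolding power2_commute[of s t] dist_commute[of "P s a"] .
      qed
      then have "\<bar>s - t\<bar> \<le> dist (P s a) (P t b)" by (metis abs_le_square_iff abs_of_nonneg zero_le_dist)
      also have "\<dots> \<le> dist (P s a) (P t a) + dist (P t a) (P t b)" by (rule dist_triangle)
      also have "dist (P t a) (P t b) = \<bar>a - b\<bar> * K"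
        unfolding P_def using dist_w_param b \<open>0 \<le> a\<close> \<open>a \<le> 1\<close> sync_dist_eq[OF sy, of t] by (simp add: K_def)
      also have "\<dots> \<le> e" using b(4) \<eta>(3) by (simp add: abs_minus_commute)
      finally show ?thesis by simp
    qed
    then have "\<bar>s - t\<bar> \<le> dist (P s a) (P t a)" by (rule field_le_epsilon)
    then show ?thesis by (metis abs_le_square_iff abs_of_nonneg zero_le_dist)
  qed
  have "(s - t)\<^sup>2 + (a - b)\<^sup>2 * K\<^sup>2 \<le> (dist (P s a) (P t b))\<^sup>2"
  proof (cases a b rule: linorder_cases)
    case less then show ?thesis using lt ab by blast
  next
    case equal then show ?thesis using eq[of a s t] ab by simp
  next
    case greater
    have "(t - s)\<^sup>2 + (b - a)\<^sup>2 * K\<^sup>2 \<le> (dist (P t b) (P s a))\<^sup>2" using lt greater ab by blast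
    then show ?thesis
      unfolding power2_commute[of s t] power2_commute[of a b] dist_commute[of "P s a"] .
  qed
  then have "(dist (P s a) (P t b))\<^sup>2 = (s - t)\<^sup>2 + (a - b)\<^sup>2 * K\<^sup>2"
    using up[of a b s t] ab by (intro order_antisym)
  then show ?thesis by (simp add: P_def K_def power_mult_distrib)
qed

lemma strip_lines_sync:
  fixes c1 c2 :: "real \<Rightarrow> 'a"
  assumes sy: "sync c1 c2" and ab: "0 \<le> a" "a \<le> 1" "0 \<le> b" "b \<le> 1"
  shows "sync (\<lambda>t. w (c1 t) (c2 t) a) (\<lambda>t. w (c1 t) (c2 t) b)"
proof (rule syncI[OF _ _ strip_dist[OF sy ab]])
  have "geodesic_line (\<lambda>t. w (c1 t) (c2 t) a)" if a: "0 \<le> a" "a \<le> 1" for a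
    unfolding geodesic_line_def
  proof (intro allI)
    fix s t
    have "(dist (w (c1 s) (c2 s) a) (w (c1 t) (c2 t) a))\<^sup>2 = \<bar>s - t\<bar>\<^sup>2"
      using strip_dist[OF sy a a, of s t] by simp
    then show "dist (w (c1 s) (c2 s) a) (w (c1 t) (c2 t) a) = \<bar>s - t\<bar>"
      by (rule power2_eq_imp_eq) auto
  qed
  then show "geodesic_line (\<lambda>t. w (c1 t) (c2 t) a)" "geodesic_line (\<lambda>t. w (c1 t) (c2 t) b)"
    using ab by auto
qed

lemma sync_imp_flat_strip:
  fixes c1 c2 :: "real \<Rightarrow> 'a"
  assumes sy: "sync c1 c2"
  shows "flat_strip (range c1) (range c2) (dist (c1 0) (c2 0))"
proof -
  define K where "K = dist (c1 0) (c2 0)"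
  have K0: "0 \<le> K" by (simp add: K_def)
  \<comment> \<open>For K = 0 the quotient u / K is 0, and the strip degenerates to c1, which then
    equals c2.\<close>
  define f where "f = (\<lambda>(t, u). w (c1 t) (c2 t) (u / K))"
  have c12: "c1 = c2" if "K = 0" using that sync_dist_eq[OF sy] by (auto simp: K_def)
  have "dist (f p) (f q) = dist p q" if mem: "p \<in> UNIV \<times> {0..K}" "q \<in> UNIV \<times> {0..K}" for p q
  proof -
    obtain s u t v where pq: "p = (s, u)" "q = (t, v)" "0 \<le> u" "u \<le> K" "0 \<le> v" "v \<le> K"
      using mem by (cases p; cases q) auto
    have r: "0 \<le> u / K" "u / K \<le> 1" "0 \<le> v / K" "v / K \<le> 1"
      using pq K0 by (auto simp: divide_le_eq_1)
    have "(u / K - v / K) * K = u - v" using pq K0 by (cases "K = 0") (auto simp: field_simps)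
    then have "(dist (f p) (f q))\<^sup>2 = (s - t)\<^sup>2 + (u - v)\<^sup>2"
      using strip_dist[OF sy r, of s t] unfolding K_def[symmetric] by (simp add: f_def pq)
    then show ?thesis
      by (simp add: pq dist_Pair_Pair dist_real_def real_sqrt_unique[symmetric])
  qed
  moreover have "f ` (UNIV \<times> {0}) = range c1" by (auto simp: f_def image_def)
  moreover have "f ` (UNIV \<times> {K}) = range c2"
    using c12 by (cases "K = 0") (auto simp: f_def image_def)
  ultimately show ?thesis unfolding flat_strip_def K_def[symmetric] using K0 by blast
qed

section \<open>The distance between lines as a metric on each parallelism class\<close>

lemma line_dist_sync:
  fixes c1 c2 :: "real \<Rightarrow> 'a"
  assumes sy: "sync c1 c2"
  shows "line_dist (range c1) (range c2) = ereal (dist (c1 0) (c2 0))"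
proof -
  have "K = dist (c1 0) (c2 0)" if "flat_strip (range c1) (range c2) K" for K
  proof -
    have p: "c1 0 \<in> range c1" by simp
    note A = flat_strip_width[OF that p] and B = flat_strip_width[OF sync_imp_flat_strip[OF sy] p]
    obtain q q' where "q \<in> range c2" "dist (c1 0) q = K" "q' \<in> range c2" "dist (c1 0) q' = dist (c1 0) (c2 0)"
      using A(2) B(2) by blast
    then have "K \<le> dist (c1 0) (c2 0)" "dist (c1 0) (c2 0) \<le> K" using A(1)[of q'] B(1)[of q] by auto
    then show ?thesis by (rule order_antisym)
  qed
  then have "{ereal K | K. flat_strip (range c1) (range c2) K} = {ereal (dist (c1 0) (c2 0))}"
    using sync_imp_flat_strip[OF sy] by blast
  then show ?thesis unfolding line_dist_def by simp
qed

text \<open>The infimum of the empty set is infinite, so a finite distance yields a strip. Its first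
  side is some parametrization of the given line; the affine change to c is applied to the other
  side as well, which keeps the two in sync.\<close>

lemma line_dist_finiteE:
  fixes c :: "real \<Rightarrow> 'a"
  assumes fin: "line_dist (range c) l < \<infinity>" and c: "geodesic_line c"
  obtains c' where "sync c c'" "range c' = l"
proof -
  have "{ereal K | K. flat_strip (range c) l K} \<noteq> {}"
  proof
    assume "{ereal K | K. flat_strip (range c) l K} = {}"
    then have "line_dist (range c) l = Inf {}" unfolding line_dist_def by (rule arg_cong)
    then show False using fin by (simp add: top_ereal_def)
  qed
  then obtain K where "flat_strip (range c) l K" by blast
  then obtain c1 c2 where c12: "sync c1 c2" "range c1 = range c" "range c2 = l"
    by (rule flat_strip_imp_sync)
  obtain e b where eb: "\<bar>e\<bar> = 1" "\<And>t. c t = c1 (e * t + b)"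
    using geodesic_line_reparam[OF sync_lines(1)[OF c12(1)] c] c12(2) by (metis order_refl)
  have "c = (\<lambda>t. c1 (e * t + b))" using eb by auto
  then have "sync c (\<lambda>t. c2 (e * t + b))" using sync_affine[OF c12(1) eb(1)] by metis
  then show ?thesis using that range_affine[OF eb(1), of c2 b] c12(3) by blast
qed

lemma line_dist_finite_sym:
  assumes "line_dist l l' < \<infinity>" "l \<in> (lines :: 'a set set)"
  shows "line_dist l' l = line_dist l l'"
proof -
  obtain c where c: "geodesic_line c" "l = range c" using assms by (auto simp: lines_def)
  obtain c' where "sync c c'" "range c' = l'" using line_dist_finiteE[of c l'] assms c by blast
  then show ?thesis
    using line_dist_sync[of c c'] line_dist_sync[OF sync_sym, of c c'] c by (simp add: dist_commute)
qed

lemma line_dist_commute: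
  assumes "l \<in> (lines :: 'a set set)" "l' \<in> lines"
  shows "line_dist l' l = line_dist l l'"
proof (cases "line_dist l l' < \<infinity> \<or> line_dist l' l < \<infinity>")
  case True
  then show ?thesis using line_dist_finite_sym assms by metis
next
  case False
  then show ?thesis by simp
qed

text \<open>Since \<open>sync\<close> is transitive, three parallel lines can be parametrized so
  that all mutual distances are those of the points at time 0, and the triangle inequality of the
  space applies.\<close>

lemma line_dist_triangle:
  assumes "l1 \<in> (lines :: 'a set set)"
  shows "line_dist l1 l3 \<le> line_dist l1 l2 + line_dist l2 l3"
proof (cases "line_dist l1 l2 < \<infinity> \<and> line_dist l2 l3 < \<infinity>")
  case True
  obtain c1 where c1: "geodesic_line c1" "l1 = range c1" using assms by (auto simp: lines_def)
  obtain c2 where c2: "sync c1 c2" "range c2 = l2" using line_dist_finiteE[of c1 l2] True c1 by blast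
  obtain c3 where c3: "sync c2 c3" "range c3 = l3"
    using line_dist_finiteE[of c2 l3] True c2 sync_lines by blast
  show ?thesis
    using line_dist_sync[OF c2(1)] line_dist_sync[OF c3(1)] line_dist_sync[OF sync_trans[OF c2(1) c3(1)]]
      dist_triangle[of "c1 0" "c3 0" "c2 0"] c1 c2 c3 by simp
next
  case False
  then have "line_dist l1 l2 = \<infinity> \<or> line_dist l2 l3 = \<infinity>" by auto
  moreover have nn: "0 \<le> line_dist l l'" for l l' :: "'a set"
    unfolding line_dist_def by (rule Inf_greatest) (auto simp: flat_strip_def)
  ultimately have inf: "line_dist l1 l2 + line_dist l2 l3 = \<infinity>"
    using nn[of l1 l2] nn[of l2 l3] by auto
  show ?thesis unfolding inf by simp
qed

lemma line_dist_self: "l \<in> (lines :: 'a set set) \<Longrightarrow> line_dist l l = 0"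
  using line_dist_sync[OF sync_refl] by (auto simp: lines_def)

lemma line_dist_zeroD:
  assumes "line_dist l l' = 0" "l \<in> (lines :: 'a set set)"
  shows "l = l'"
proof -
  obtain c where c: "geodesic_line c" "l = range c" using assms by (auto simp: lines_def)
  obtain c' where c': "sync c c'" "range c' = l'" using line_dist_finiteE[of c l'] assms c by auto
  then have "dist (c 0) (c' 0) = 0" using line_dist_sync[OF c'(1)] assms(1) c by simp
  then have "c = c'" using sync_dist_eq[OF c'(1)] by auto
  then show ?thesis using c c' by simp
qed

lemma sync_isometry:
  assumes "\<And>x y. dist (f x) (f y) = dist x y" "sync c c'"
  shows "sync (\<lambda>t. f (c t)) (\<lambda>t. f (c' t))"
proof (rule syncI)
  show "geodesic_line (\<lambda>t. f (c t))" "geodesic_line (\<lambda>t. f (c' t))"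
    using sync_lines[OF assms(2)] assms(1) by (auto simp: geodesic_line_def)
  show "(dist (f (c s)) (f (c' t)))\<^sup>2 = (s - t)\<^sup>2 + (dist (c 0) (c' 0))\<^sup>2" for s t
    unfolding assms(1) by (rule sync_dist[OF assms(2)])
qed

lemma line_dist_isometry_le:
  fixes f :: "'a \<Rightarrow> 'a"
  assumes f: "\<And>x y. dist (f x) (f y) = dist x y" and l: "l \<in> lines"
  shows "line_dist (f ` l) (f ` l') \<le> line_dist l l'"
proof (cases "line_dist l l' < \<infinity>")
  case True
  obtain c where c: "geodesic_line c" "l = range c" using l by (auto simp: lines_def)
  obtain c' where c': "sync c c'" "range c' = l'" using line_dist_finiteE[of c l'] True c by auto
  have "range (\<lambda>t. f (c t)) = f ` l" "range (\<lambda>t. f (c' t)) = f ` l'" using c c' by auto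
  then show ?thesis
    using line_dist_sync[OF sync_isometry[OF f c'(1)]] line_dist_sync[OF c'(1)] c c' f by simp
qed (simp add: less_top[symmetric])

text \<open>The cross-section at \<open>c0 0\<close> of the lines of \<open>A\<close> parallel to \<open>c0\<close>; it identifies the
  part of \<open>A\<close> in the component of \<open>range c0\<close> isometrically with a subset of the space.\<close>

definition cross_section :: "(real \<Rightarrow> 'a) \<Rightarrow> 'a set set \<Rightarrow> 'a set" where
  "cross_section c0 A = {c 0 | c. sync c0 c \<and> range c \<in> A}"

lemma cross_section_line_dist:
  fixes c0 :: "real \<Rightarrow> 'a"
  assumes "sync c0 c" "sync c0 c'"
  shows "line_dist (range c) (range c') = ereal (dist (c 0) (c' 0))"
  by (rule line_dist_sync[OF sync_trans[OF sync_sym[OF assms(1)] assms(2)]])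

lemma cross_section_inj:
  fixes c0 :: "real \<Rightarrow> 'a"
  assumes "sync c0 c" "sync c0 c'" "c 0 = c' 0"
  shows "c = c'"
proof -
  have "c 0 \<in> range c \<inter> range c'" using assms(3) by (metis IntI rangeI)
  then show ?thesis
    using sync_same_range[OF sync_trans[OF sync_sym[OF assms(1)] assms(2)]] by blast
qed

lemma cross_section_inj_range:
  fixes c0 :: "real \<Rightarrow> 'a"
  assumes "sync c0 c" "sync c0 c'" "range c = range c'"
  shows "c = c'"
  using sync_same_range[OF sync_trans[OF sync_sym[OF assms(1)] assms(2)]] assms(3) by auto

text \<open>The points at ratio a of the rungs form a line of the strip between c and c'. Rescaled
  by the width K, these lines are a geodesic in the space of lines, which convexity keeps in A;
  their points at time 0 trace the geodesic from c 0 to c' 0.\<close>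

lemma cconvex_cross_section:
  assumes conv: "componentwise_convex A"
  shows "cconvex (cross_section c0 A)"
  unfolding cconvex_def
proof (intro ballI allI impI)
  fix x y s assume xy: "x \<in> cross_section c0 A" "y \<in> cross_section c0 A" and s: "0 \<le> s" "s \<le> (1::real)"
  obtain c c' where c: "x = c 0" "sync c0 c" "range c \<in> A" and c': "y = c' 0" "sync c0 c'" "range c' \<in> A"
    using xy by (auto simp: cross_section_def)
  have sy: "sync c c'" using sync_trans sync_sym c c' by blast
  define K where "K = dist (c 0) (c' 0)"
  define m where "m a = (\<lambda>t. w (c t) (c' t) a)" for a
  have m01: "m 0 = c" "m 1 = c'" by (auto simp: m_def)
  have msy: "sync (m a) (m b)" if "0 \<le> a" "a \<le> 1" "0 \<le> b" "b \<le> 1" for a b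
    unfolding m_def by (rule strip_lines_sync[OF sy that])
  have c0m: "sync c0 (m s)" using sync_trans[OF c(2), of "m s"] msy[of 0 s] m01 s by simp
  have "range (m s) \<in> A"
  proof (cases "K = 0")
    case True
    then have "c = c'" using sync_dist_eq[OF sy] by (auto simp: K_def)
    then have "m s = c" using s by (auto simp: m_def)
    then show ?thesis using c by simp
  next
    case False
    then have K: "K > 0" by (simp add: K_def)
    have md: "dist (m a 0) (m b 0) = \<bar>a - b\<bar> * K" if "0 \<le> a" "a \<le> 1" "0 \<le> b" "b \<le> 1" for a b
      unfolding m_def K_def by (rule dist_w_param[OF that])
    have "line_geodesic (\<lambda>u. range (m (u / K))) (range c) (range c') K"
      unfolding line_geodesic_def
    proof (intro conjI ballI)
      fix u assume u: "u \<in> {0..K}"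
      then have "sync c (m (u / K))" using msy[of 0 "u / K"] m01 K by simp
      then show "range (m (u / K)) \<in> lines" using sync_lines(2) unfolding lines_def by blast
      fix v assume v: "v \<in> {0..K}"
      have r: "0 \<le> u / K" "u / K \<le> 1" "0 \<le> v / K" "v / K \<le> 1" using u v K by auto
      have "\<bar>u / K - v / K\<bar> * K = \<bar>u - v\<bar>"
        using K by (simp add: diff_divide_distrib[symmetric] abs_divide)
      then show "line_dist (range (m (u / K))) (range (m (v / K))) = ereal \<bar>u - v\<bar>"
        using line_dist_sync[OF msy[OF r]] md[OF r] by simp
    qed (use K m01 in auto)
    then have "\<forall>u\<in>{0..K}. range (m (u / K)) \<in> A"
      using conv c(3) c'(3) unfolding componentwise_convex_def by blast
    moreover have "s * K \<in> {0..K}" using s K by (simp add: mult_left_le_one_le)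
    ultimately have "range (m ((s * K) / K)) \<in> A" by blast
    then show ?thesis using K by simp
  qed
  then have "m s 0 \<in> cross_section c0 A" using c0m by (auto simp: cross_section_def)
  then show "w x y s \<in> cross_section c0 A" by (simp add: m_def c c')
qed

text \<open>The lines through x n and x k have the same distance at all times, so convergence at
  time 0 makes every time Cauchy and the lines converge pointwise. The limit is in sync with c0, and
  line distances are distances of base points, so closedness of A applies.\<close>

lemma closed_cross_section:
  assumes cl: "lines_closed A"
  shows "closed (cross_section c0 A)"
  unfolding closed_sequential_limits
proof (intro allI impI, elim conjE)
  fix x p assume x: "\<forall>n. x n \<in> cross_section c0 A" and lim: "x \<longlonglongrightarrow> p"
  have "\<forall>n. \<exists>c. x n = c 0 \<and> sync c0 c \<and> range c \<in> A" using x by (auto simp: cross_section_def)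
  then obtain c where c: "\<And>n. x n = c n 0" "\<And>n. sync c0 (c n)" "\<And>n. range (c n) \<in> A" by metis
  have sy: "sync (c n) (c k)" for n k using sync_trans sync_sym c by blast
  have dd: "dist (c n t) (c k t) = dist (x n) (x k)" for n k t using sync_dist_eq[OF sy[of n k], of t] by (simp add: c(1))
  have cau: "Cauchy x" using lim by (rule LIMSEQ_imp_Cauchy)
  have "\<exists>q. (\<lambda>n. c n t) \<longlonglongrightarrow> q" for t
  proof -
    have cc: "Cauchy (\<lambda>n. c n t)" using cau unfolding Cauchy_def dd .
    have cs: "\<forall>n. c n t \<in> closure (range (\<lambda>n. c n t))" by (intro allI subsetD[OF closure_subset] rangeI)
    have "compact (closure (range (\<lambda>n. c n t)))"
      using cauchy_imp_bounded[OF cc]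
      by (intro compact_closed_bounded) auto
    then show ?thesis by (rule completeE[OF compact_imp_complete cs cc]) blast
  qed
  then obtain q where q: "\<And>t. (\<lambda>n. c n t) \<longlonglongrightarrow> q t" by metis
  have q0: "q 0 = p" using q[of 0] lim LIMSEQ_unique[of x] by (simp add: c(1)[symmetric])
  have gl: "geodesic_line q"
    unfolding geodesic_line_def
  proof (intro allI)
    fix s t
    have "(\<lambda>n. dist (c n s) (c n t)) \<longlonglongrightarrow> dist (q s) (q t)" using q by (intro tendsto_dist)
    moreover have "dist (c n s) (c n t) = \<bar>s - t\<bar>" for n
      using geodesic_line_dist sync_lines c(2) by blast
    ultimately show "dist (q s) (q t) = \<bar>s - t\<bar>" using LIMSEQ_unique by (simp add: LIMSEQ_const_iff)
  qed
  have sq: "sync c0 q"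
  proof (rule syncI[OF sync_lines(1)[OF c(2)] gl])
    fix s t
    have "(\<lambda>n. (dist (c0 s) (c n t))\<^sup>2 - (dist (c0 0) (c n 0))\<^sup>2) \<longlonglongrightarrow> (dist (c0 s) (q t))\<^sup>2 - (dist (c0 0) (q 0))\<^sup>2"
      using q by (intro tendsto_intros)
    moreover have "(dist (c0 s) (c n t))\<^sup>2 - (dist (c0 0) (c n 0))\<^sup>2 = (s - t)\<^sup>2" for n
      using sync_dist[OF c(2)[of n], of s t] by simp
    ultimately show "(dist (c0 s) (q t))\<^sup>2 = (s - t)\<^sup>2 + (dist (c0 0) (q 0))\<^sup>2"
      by (simp add: LIMSEQ_const_iff algebra_simps)
  qed
  have "line_dist (range (c n)) (range q) = ereal (dist (x n) p)" for n
    using cross_section_line_dist[OF c(2) sq, of n] by (simp add: c(1) q0)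
  moreover have "(\<lambda>n. ereal (dist (x n) p)) \<longlonglongrightarrow> 0"
    using tendsto_dist[OF lim tendsto_const[of p]] by (simp add: zero_ereal_def)
  ultimately have "(\<lambda>n. line_dist (range (c n)) (range q)) \<longlonglongrightarrow> 0" by simp
  moreover have "range q \<in> lines" using gl by (auto simp: lines_def)
  ultimately have "range q \<in> A"
    using cl c(3) unfolding lines_closed_def by (elim conjE allE[of _ "\<lambda>n. range (c n)"]) blast
  then show "p \<in> cross_section c0 A" using sq q0 by (auto simp: cross_section_def)
qed

end

subsection \<open>Simplicial complexes in the weak topology\<close>

abbreviation supp :: "('v \<Rightarrow> real) \<Rightarrow> 'v set" where
  "supp p \<equiv> {v. p v \<noteq> 0}"

definition scomplex :: "'v set set \<Rightarrow> bool" where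
  "scomplex K \<longleftrightarrow> (\<forall>\<sigma>\<in>K. finite \<sigma> \<and> \<sigma> \<noteq> {}) \<and> (\<forall>\<sigma>\<in>K. \<forall>\<tau>. \<tau> \<subseteq> \<sigma> \<longrightarrow> \<tau> \<noteq> {} \<longrightarrow> \<tau> \<in> K)"

lemma scomplex_finite: "scomplex K \<Longrightarrow> \<sigma> \<in> K \<Longrightarrow> finite \<sigma>"
  by (simp add: scomplex_def)

lemma scomplex_face: "scomplex K \<Longrightarrow> \<sigma> \<in> K \<Longrightarrow> \<tau> \<subseteq> \<sigma> \<Longrightarrow> \<tau> \<noteq> {} \<Longrightarrow> \<tau> \<in> K"
  unfolding scomplex_def by blast

lemma sum_supp:
  assumes "finite S" "supp p \<subseteq> S" shows "sum p (supp p) = sum p S"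
  using assms by (intro sum.mono_neutral_left) auto

lemma realizationI:
  assumes "\<And>v. 0 \<le> p v" "supp p \<in> K" "finite S" "supp p \<subseteq> S" "sum p S = 1"
  shows "p \<in> realization K"
  using assms sum_supp[OF assms(3,4)] by (simp add: realization_def)

lemma realizationD:
  assumes "p \<in> realization K"
  shows "0 \<le> p v" "supp p \<in> K" "sum p (supp p) = 1"
  using assms by (auto simp: realization_def)

lemma realization_sum:
  assumes "p \<in> realization K" "finite S" "supp p \<subseteq> S" shows "sum p S = 1"
  using sum_supp[OF assms(2,3)] realizationD(3)[OF assms(1)] by simp

lemma realization_mono: "L \<subseteq> K \<Longrightarrow> realization L \<subseteq> realization K"
  by (auto simp: realization_def)

lemma supp_nonempty_if_sum: "sum p S \<noteq> 0 \<Longrightarrow> \<exists>v\<in>S. (p v :: real) \<noteq> 0"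
  by (meson sum.neutral)

text \<open>The description by coordinates does not mention K, so a simplex shared by two complexes
  has the same points in both.\<close>

lemma closed_simplex_eq:
  assumes "scomplex K" "\<sigma> \<in> K"
  shows "closed_simplex K \<sigma> = {p. (\<forall>v. 0 \<le> p v) \<and> (\<forall>v. v \<notin> \<sigma> \<longrightarrow> p v = 0) \<and> sum p \<sigma> = 1}"
proof (intro equalityI subsetI)
  fix p assume "p \<in> closed_simplex K \<sigma>"
  then have p: "p \<in> realization K" "supp p \<subseteq> \<sigma>" by (auto simp: closed_simplex_def)
  then have "sum p \<sigma> = 1" using realization_sum scomplex_finite[OF assms] by blast
  then show "p \<in> {p. (\<forall>v. 0 \<le> p v) \<and> (\<forall>v. v \<notin> \<sigma> \<longrightarrow> p v = 0) \<and> sum p \<sigma> = 1}"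
    using p realizationD(1)[OF p(1)] by auto
next
  fix p assume "p \<in> {p. (\<forall>v. (0::real) \<le> p v) \<and> (\<forall>v. v \<notin> \<sigma> \<longrightarrow> p v = 0) \<and> sum p \<sigma> = 1}"
  then have p: "\<And>v. 0 \<le> p v" "\<And>v. v \<notin> \<sigma> \<Longrightarrow> p v = 0" "sum p \<sigma> = 1" by auto
  have sub: "supp p \<subseteq> \<sigma>" using p(2) by blast
  have "supp p \<noteq> {}" using supp_nonempty_if_sum[of p \<sigma>] p(3) by auto
  then have "supp p \<in> K" using scomplex_face[OF assms sub] by blast
  then have "p \<in> realization K" using realizationI[OF p(1) _ scomplex_finite[OF assms] sub p(3)] by blast
  then show "p \<in> closed_simplex K \<sigma>" using sub by (simp add: closed_simplex_def)
qed

lemma closed_simplex_sub: "scomplex K \<Longrightarrow> scomplex L \<Longrightarrow> \<sigma> \<in> K \<Longrightarrow> \<sigma> \<in> L \<Longrightarrow> closed_simplex K \<sigma> = closed_simplex L \<sigma>"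
  by (simp add: closed_simplex_eq)

lemma closed_simplex_le_1:
  assumes "p \<in> closed_simplex K \<sigma>" shows "p v \<le> 1"
proof (cases "v \<in> supp p")
  case True
  have p: "p \<in> realization K" using assms by (simp add: closed_simplex_def)
  have "finite (supp p)" using realizationD(3)[OF p] by (metis sum.infinite zero_neq_one)
  then have "p v \<le> sum p (supp p)" using True realizationD(1)[OF p] by (intro member_le_sum) auto
  then show ?thesis using realizationD(3)[OF p] by simp
qed auto

lemma closed_simplex_sub_realization: "closed_simplex K \<sigma> \<subseteq> realization K"
  by (auto simp: closed_simplex_def)

lemma realization_in_closed_simplex: "p \<in> realization K \<Longrightarrow> supp p \<in> K \<and> p \<in> closed_simplex K (supp p)"
  by (auto simp: closed_simplex_def realization_def)

lemma continuous_on_coord: "continuous_on S (\<lambda>p. (p v :: real))"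
  by (rule continuous_on_subset[OF continuous_on_product_coordinates]) simp

lemma continuous_on_fst_snd: "continuous_on A fst" "continuous_on A snd"
  by (intro continuous_on_fst continuous_on_id, intro continuous_on_snd continuous_on_id)

lemma closed_closed_simplex:
  assumes "scomplex K" "\<sigma> \<in> K" shows "closed (closed_simplex K \<sigma>)"
proof -
  have "closed {p. (\<forall>v. (0::real) \<le> p v)}"
    by (intro closed_Collect_all closed_Collect_le continuous_on_coord continuous_on_const)
  moreover have "closed {p. \<forall>v. v \<notin> \<sigma> \<longrightarrow> p v = (0::real)}"
    by (intro closed_Collect_all closed_Collect_imp closed_Collect_eq continuous_on_coord continuous_on_const) auto
  moreover have "closed {p. sum p \<sigma> = (1::real)}"
    by (intro closed_Collect_eq continuous_on_sum continuous_on_coord continuous_on_const)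
  ultimately show ?thesis
    unfolding closed_simplex_eq[OF assms] by (intro closed_Collect_conj)
qed

section \<open>The weak topology, its subspaces and its homotopies\<close>

lemma openin_realization_top:
  "openin (realization_top K) S \<longleftrightarrow> S \<subseteq> realization K \<and>
     (\<forall>\<sigma>\<in>K. openin (top_of_set (closed_simplex K \<sigma>)) (S \<inter> closed_simplex K \<sigma>))"
proof -
  have "istopology (\<lambda>S. S \<subseteq> realization K \<and>
     (\<forall>\<sigma>\<in>K. openin (top_of_set (closed_simplex K \<sigma>)) (S \<inter> closed_simplex K \<sigma>)))"
    unfolding istopology_def
  proof (intro conjI allI impI)
    fix S T
    assume ST: "S \<subseteq> realization K \<and> (\<forall>\<sigma>\<in>K. openin (top_of_set (closed_simplex K \<sigma>)) (S \<inter> closed_simplex K \<sigma>))"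
      and TT: "T \<subseteq> realization K \<and> (\<forall>\<sigma>\<in>K. openin (top_of_set (closed_simplex K \<sigma>)) (T \<inter> closed_simplex K \<sigma>))"
    then show "S \<inter> T \<subseteq> realization K" by blast
    show "\<forall>\<sigma>\<in>K. openin (top_of_set (closed_simplex K \<sigma>)) (S \<inter> T \<inter> closed_simplex K \<sigma>)"
    proof
      fix \<sigma> assume \<sigma>: "\<sigma> \<in> K"
      have eq: "S \<inter> T \<inter> closed_simplex K \<sigma> = (S \<inter> closed_simplex K \<sigma>) \<inter> (T \<inter> closed_simplex K \<sigma>)" by blast
      show "openin (top_of_set (closed_simplex K \<sigma>)) (S \<inter> T \<inter> closed_simplex K \<sigma>)"
        unfolding eq by (rule openin_Int) (use ST TT \<sigma> in blast)+
    qed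
  next
    fix \<K>
    assume *: "\<forall>S\<in>\<K>. S \<subseteq> realization K \<and> (\<forall>\<sigma>\<in>K. openin (top_of_set (closed_simplex K \<sigma>)) (S \<inter> closed_simplex K \<sigma>))"
    then show "\<Union>\<K> \<subseteq> realization K" by blast
    show "\<forall>\<sigma>\<in>K. openin (top_of_set (closed_simplex K \<sigma>)) (\<Union>\<K> \<inter> closed_simplex K \<sigma>)"
    proof
      fix \<sigma> assume "\<sigma> \<in> K"
      then have "openin (top_of_set (closed_simplex K \<sigma>)) (\<Union>((\<lambda>S. S \<inter> closed_simplex K \<sigma>) ` \<K>))"
        using * by (intro openin_Union) auto
      moreover have "\<Union>((\<lambda>S. S \<inter> closed_simplex K \<sigma>) ` \<K>) = \<Union>\<K> \<inter> closed_simplex K \<sigma>" by blast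
      ultimately show "openin (top_of_set (closed_simplex K \<sigma>)) (\<Union>\<K> \<inter> closed_simplex K \<sigma>)" by simp
    qed
  qed
  then show ?thesis unfolding realization_top_def by (simp add: topology_inverse')
qed

lemma topspace_realization_top [simp]: "topspace (realization_top K) = realization K"
proof -
  have "realization K \<inter> closed_simplex K \<sigma> = closed_simplex K \<sigma>" for \<sigma>
    using closed_simplex_sub_realization by blast
  then have "openin (realization_top K) (realization K)"
    unfolding openin_realization_top by auto
  moreover have "topspace (realization_top K) \<subseteq> realization K"
    using openin_topspace[of "realization_top K"] unfolding openin_realization_top by blast
  ultimately show ?thesis using openin_subset by blast
qed

text \<open>Closed simplices are closed among all functions, so relative closedness of a trace is
  plain closedness. In this form finitely many faces can be glued.\<close>

lemma closedin_realization_top: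
  assumes "scomplex K"
  shows "closedin (realization_top K) S \<longleftrightarrow> S \<subseteq> realization K \<and> (\<forall>\<sigma>\<in>K. closed (S \<inter> closed_simplex K \<sigma>))"
proof -
  have "openin (top_of_set (closed_simplex K \<sigma>)) ((realization K - S) \<inter> closed_simplex K \<sigma>) \<longleftrightarrow>
      closed (S \<inter> closed_simplex K \<sigma>)" if "\<sigma> \<in> K" for \<sigma>
  proof -
    let ?C = "closed_simplex K \<sigma>"
    have "(realization K - S) \<inter> ?C = ?C - (S \<inter> ?C)" using closed_simplex_sub_realization by blast
    then have "openin (top_of_set ?C) ((realization K - S) \<inter> ?C) \<longleftrightarrow> closedin (top_of_set ?C) (S \<inter> ?C)"
      by (simp add: closedin_def)
    also have "\<dots> \<longleftrightarrow> closed (S \<inter> ?C)"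
      using closed_closed_simplex[OF assms that] by (simp add: closedin_closed_eq)
    finally show ?thesis .
  qed
  then show ?thesis unfolding closedin_def openin_realization_top by auto
qed

text \<open>A closed simplex of K meets the subcomplex L in a finite union of closed simplices of L,
  so a set closed in L is closed in K. This lets fixed sets carry their own weak topology.\<close>

lemma subtopology_realization_top:
  assumes K: "scomplex K" and L: "scomplex L" and sub: "L \<subseteq> K"
  shows "subtopology (realization_top K) (realization L) = realization_top L"
proof (rule topology_eq[THEN iffD2], intro allI iffI)
  fix S assume "openin (subtopology (realization_top K) (realization L)) S"
  then obtain T where T: "openin (realization_top K) T" "S = T \<inter> realization L"
    by (auto simp: openin_subtopology)
  have "openin (top_of_set (closed_simplex L \<sigma>)) (S \<inter> closed_simplex L \<sigma>)" if "\<sigma> \<in> L" for \<sigma>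
  proof -
    have "closed_simplex K \<sigma> = closed_simplex L \<sigma>" using that closed_simplex_sub[OF K L] sub by blast
    moreover have "S \<inter> closed_simplex L \<sigma> = T \<inter> closed_simplex L \<sigma>"
      using T closed_simplex_sub_realization by blast
    moreover have "openin (top_of_set (closed_simplex K \<sigma>)) (T \<inter> closed_simplex K \<sigma>)"
      using T(1) that sub unfolding openin_realization_top by blast
    ultimately show ?thesis by simp
  qed
  then show "openin (realization_top L) S" unfolding openin_realization_top using T by blast
next
  fix S assume S: "openin (realization_top L) S"
  define D where "D = realization L - S"
  have "closedin (realization_top L) D"
    using S closedin_diff[OF closedin_topspace] by (metis D_def topspace_realization_top)
  then have D: "closed (D \<inter> closed_simplex L \<rho>)" if "\<rho> \<in> L" for \<rho>
    using that unfolding closedin_realization_top[OF L] by blast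
  have "closedin (realization_top K) D"
    unfolding closedin_realization_top[OF K]
  proof (intro conjI ballI)
    show "D \<subseteq> realization K" using realization_mono[OF sub] by (auto simp: D_def)
    fix \<tau> assume \<tau>: "\<tau> \<in> K"
    have "D \<inter> closed_simplex K \<tau> = (\<Union>\<rho>\<in>{\<rho>\<in>L. \<rho> \<subseteq> \<tau>}. D \<inter> closed_simplex L \<rho>)"
    proof (intro equalityI subsetI)
      fix p assume p: "p \<in> D \<inter> closed_simplex K \<tau>"
      then have "p \<in> realization L" by (simp add: D_def)
      then have "supp p \<in> L \<and> p \<in> closed_simplex L (supp p)" by (rule realization_in_closed_simplex)
      moreover have "supp p \<subseteq> \<tau>" using p by (simp add: closed_simplex_def)
      ultimately show "p \<in> (\<Union>\<rho>\<in>{\<rho>\<in>L. \<rho> \<subseteq> \<tau>}. D \<inter> closed_simplex L \<rho>)" using p by blast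
    next
      fix p assume "p \<in> (\<Union>\<rho>\<in>{\<rho>\<in>L. \<rho> \<subseteq> \<tau>}. D \<inter> closed_simplex L \<rho>)"
      then show "p \<in> D \<inter> closed_simplex K \<tau>"
        using realization_mono[OF sub] unfolding closed_simplex_def by blast
    qed
    moreover have "finite {\<rho>\<in>L. \<rho> \<subseteq> \<tau>}"
      using scomplex_finite[OF K \<tau>] by (rule finite_subset[rotated, OF finite_Pow_iff[THEN iffD2]]) auto
    moreover have "closed (\<Union>\<rho>\<in>{\<rho>\<in>L. \<rho> \<subseteq> \<tau>}. D \<inter> closed_simplex L \<rho>)"
      using D calculation(2) by (intro closed_UN) auto
    ultimately show "closed (D \<inter> closed_simplex K \<tau>)" by simp
  qed
  then have "openin (realization_top K) (realization K - D)"
    by (metis openin_diff openin_topspace topspace_realization_top)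
  moreover have "S = (realization K - D) \<inter> realization L"
    using S realization_mono[OF sub] unfolding openin_realization_top D_def by blast
  ultimately show "openin (subtopology (realization_top K) (realization L)) S"
    by (auto simp: openin_subtopology)
qed

text \<open>Maps into a finite part of a complex: for these, continuity into the weak topology is
  coordinatewise continuity.\<close>

definition fin_map :: "'v set set \<Rightarrow> 'b::topological_space set \<Rightarrow> ('b \<Rightarrow> 'v \<Rightarrow> real) \<Rightarrow> bool" where
  "fin_map K T f \<longleftrightarrow> continuous_on T f \<and> f ` T \<subseteq> realization K \<and> (\<exists>S. finite S \<and> (\<forall>t\<in>T. supp (f t) \<subseteq> S))"

lemma fin_mapI:
  assumes "\<And>v. continuous_on T (\<lambda>t. f t v)" "\<And>t. t \<in> T \<Longrightarrow> f t \<in> realization K"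
    "finite S" "\<And>t. t \<in> T \<Longrightarrow> supp (f t) \<subseteq> S"
  shows "fin_map K T f"
  unfolding fin_map_def using assms by (intro conjI continuous_on_coordinatewise_then_product) blast+

lemma fin_mapE:
  assumes "fin_map K T f"
  obtains S where "finite S" "\<And>t. t \<in> T \<Longrightarrow> supp (f t) \<subseteq> S"
    "\<And>v. continuous_on T (\<lambda>t. f t v)" "\<And>t. t \<in> T \<Longrightarrow> f t \<in> realization K"
proof -
  obtain S where "finite S" "\<forall>t\<in>T. supp (f t) \<subseteq> S" using assms unfolding fin_map_def by blast
  moreover have "continuous_on T (\<lambda>t. f t v)" for v
    using assms unfolding fin_map_def by (blast intro: continuous_on_product_then_coordinatewise)
  ultimately show ?thesis using assms unfolding fin_map_def by (intro that[of S]) blast+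
qed

lemma fin_map_compose:
  assumes "fin_map K T f" "continuous_on T' g" "g ` T' \<subseteq> T"
  shows "fin_map K T' (\<lambda>t. f (g t))"
proof -
  obtain S where S: "finite S" "\<And>t. t \<in> T \<Longrightarrow> supp (f t) \<subseteq> S"
    "\<And>v. continuous_on T (\<lambda>t. f t v)" "\<And>t. t \<in> T \<Longrightarrow> f t \<in> realization K"
    using fin_mapE[OF assms(1)] by blast
  show ?thesis
  proof (rule fin_mapI)
    show "continuous_on T' (\<lambda>t. f (g t) v)" for v
      using S(3) assms(2,3) by (rule continuous_on_compose2)
    show "f (g t) \<in> realization K" "supp (f (g t)) \<subseteq> S" if "t \<in> T'" for t
      using S(2,4) assms(3) that by blast+
  qed (rule S(1))
qed

text \<open>Only the finitely many simplices spanned inside S are met; the trace of a closed set on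
  each of them is closed coordinatewise, hence so is the union D.\<close>

lemma fin_map_continuous_map:
  assumes K: "scomplex K" and f: "fin_map K T f"
  shows "continuous_map (top_of_set T) (realization_top K) f"
  unfolding continuous_map_closedin
proof (intro conjI allI impI)
  have cf: "continuous_on T f" and im: "f ` T \<subseteq> realization K"
    using f by (auto simp: fin_map_def)
  obtain S where S: "finite S" "\<And>t. t \<in> T \<Longrightarrow> supp (f t) \<subseteq> S" using f by (auto simp: fin_map_def)
  show "f \<in> topspace (top_of_set T) \<rightarrow> topspace (realization_top K)" using im by auto
  fix C assume C: "closedin (realization_top K) C"
  define D where "D = (\<Union>\<sigma>\<in>{\<sigma>\<in>K. \<sigma> \<subseteq> S}. C \<inter> closed_simplex K \<sigma>)"
  have "finite {\<sigma>\<in>K. \<sigma> \<subseteq> S}" using S(1) by (rule finite_subset[rotated, OF finite_Pow_iff[THEN iffD2]]) auto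
  then have "closed D" unfolding D_def
    using C[unfolded closedin_realization_top[OF K]] by (intro closed_UN ballI) blast+
  then have "closedin (top_of_set T) (T \<inter> f -` D)" using cf continuous_closedin_preimage by blast
  moreover have "T \<inter> f -` D = {x \<in> topspace (top_of_set T). f x \<in> C}"
  proof (intro equalityI subsetI)
    fix t assume "t \<in> {x \<in> topspace (top_of_set T). f x \<in> C}"
    then have t: "t \<in> T" "f t \<in> C" by auto
    then have "supp (f t) \<in> K \<and> f t \<in> closed_simplex K (supp (f t))"
      using im by (intro realization_in_closed_simplex) blast
    then show "t \<in> T \<inter> f -` D" using t S(2)[OF t(1)] unfolding D_def by blast
  qed (auto simp: D_def)
  ultimately show "closedin (top_of_set T) {x \<in> topspace (top_of_set T). f x \<in> C}" by simp
qed

text \<open>Openness in the product is not a condition on simplices by definition. A compact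
  neighbourhood J of t reduces it to one: the points q with \<open>J \<times> {q}\<close> inside the
  preimage form a set whose trace on every closed simplex is open, by the tube lemma.\<close>

lemma continuous_map_realization_homotopy:
  fixes h :: "real \<times> ('v \<Rightarrow> real) \<Rightarrow> 'z"
  assumes h: "\<And>\<sigma>. \<sigma> \<in> K \<Longrightarrow> continuous_map (top_of_set ({0..1} \<times> closed_simplex K \<sigma>)) Z h"
  shows "continuous_map (prod_topology (top_of_set {0..1}) (realization_top K)) Z h"
  unfolding continuous_map_def
proof (intro conjI allI impI)
  show "h \<in> topspace (prod_topology (top_of_set {0..1}) (realization_top K)) \<rightarrow> topspace Z"
  proof
    fix x :: "real \<times> ('v \<Rightarrow> real)"
    assume "x \<in> topspace (prod_topology (top_of_set {0..1}) (realization_top K))"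
    then obtain t p where x: "x = (t, p)" "t \<in> {0..1}" "p \<in> realization K" by auto
    then show "h x \<in> topspace Z"
      using h[of "supp p"] realization_in_closed_simplex[OF x(3)] unfolding continuous_map_def by auto
  qed
  fix U assume U: "openin Z U"
  define W :: "(real \<times> ('v \<Rightarrow> real)) set" where "W = {x \<in> topspace (prod_topology (top_of_set {0..1}) (realization_top K)). h x \<in> U}"
  have W: "openin (prod_topology (top_of_set {0..1}) (top_of_set (closed_simplex K \<sigma>))) (W \<inter> {0..1} \<times> closed_simplex K \<sigma>)"
    if "\<sigma> \<in> K" for \<sigma>
  proof -
    have "W \<inter> {0..1} \<times> closed_simplex K \<sigma> = {x \<in> topspace (top_of_set ({0..1} \<times> closed_simplex K \<sigma>)). h x \<in> U}"
      using closed_simplex_sub_realization[of K \<sigma>] by (auto simp: W_def)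
    then show ?thesis using h[OF that] U by (simp add: continuous_map_def)
  qed
  have "\<exists>A B. openin (top_of_set {0..1}) A \<and> openin (realization_top K) B \<and> t \<in> A \<and> p \<in> B \<and> A \<times> B \<subseteq> W"
    if tp: "(t, p) \<in> W" for t p
  proof -
    have t: "t \<in> {0..1}" and p: "p \<in> realization K" using tp by (auto simp: W_def)
    note ps = realization_in_closed_simplex[OF p]
    have mem: "(t, p) \<in> W \<inter> {0..1} \<times> closed_simplex K (supp p)" using ps tp t by blast
    have "openin (prod_topology (top_of_set {0..1}) (top_of_set (closed_simplex K (supp p))))
        (W \<inter> {0..1} \<times> closed_simplex K (supp p))" using W ps by blast
    then have "\<exists>U V. openin (top_of_set {0..1}) U \<and> openin (top_of_set (closed_simplex K (supp p))) V \<and>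
        t \<in> U \<and> p \<in> V \<and> U \<times> V \<subseteq> W \<inter> {0..1} \<times> closed_simplex K (supp p)"
      by (rule openin_prod_topology_alt[THEN iffD1, THEN spec, THEN spec, THEN mp, OF _ mem])
    then obtain A0 B0 where A0: "openin (top_of_set {0..1}) A0" "t \<in> A0" "p \<in> B0" "A0 \<times> B0 \<subseteq> W"
      by (elim exE conjE) (erule (1) that, blast+)
    obtain Q where Q: "open Q" "A0 = {0..1} \<inter> Q" using A0(1) unfolding openin_open by blast
    then have "\<exists>e>0. cball t e \<subseteq> Q" using A0(2) open_contains_cball[of Q] by simp
    then obtain e where e: "e > 0" "cball t e \<inter> {0..1} \<subseteq> A0" using Q(2) by blast
    define J where "J = cball t e \<inter> {0..1}"
    have J: "compactin (top_of_set {0..1}) J"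
      unfolding J_def by (simp add: compactin_subtopology compact_Int_closed)
    define B where "B = {q \<in> realization K. J \<times> {q} \<subseteq> W}"
    have "openin (realization_top K) B"
      unfolding openin_realization_top
    proof (intro conjI ballI)
      show "B \<subseteq> realization K" by (auto simp: B_def)
      fix \<sigma> assume \<sigma>: "\<sigma> \<in> K"
      let ?C = "closed_simplex K \<sigma>"
      show "openin (top_of_set ?C) (B \<inter> ?C)"
      proof (subst openin_subopen, intro ballI)
        fix q assume q: "q \<in> B \<inter> ?C"
        have "J \<times> {q} \<subseteq> W \<inter> {0..1} \<times> ?C" using q by (auto simp: B_def J_def)
        then obtain A' V where V: "openin (top_of_set ?C) V" "J \<subseteq> A'" "q \<in> V" "A' \<times> V \<subseteq> W \<inter> {0..1} \<times> ?C"
          using tube_lemma_left[OF W[OF \<sigma>] J, of q] q by auto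
        moreover have "V \<subseteq> B \<inter> ?C"
        proof
          fix x assume x: "x \<in> V"
          then have "x \<in> ?C" using V(1) openin_subset by fastforce
          moreover have "J \<times> {x} \<subseteq> W" using V x by blast
          ultimately show "x \<in> B \<inter> ?C" using closed_simplex_sub_realization[of K \<sigma>] by (auto simp: B_def)
        qed
        ultimately show "\<exists>T. openin (top_of_set ?C) T \<and> q \<in> T \<and> T \<subseteq> B \<inter> ?C" by blast
      qed
    qed
    moreover have "openin (top_of_set {0..1}) ({0..1} \<inter> ball t e)" by (simp add: openin_open_Int)
    moreover have "p \<in> B" using p A0 e unfolding B_def J_def by blast
    moreover have "({0..1} \<inter> ball t e) \<times> B \<subseteq> W" by (auto simp: B_def J_def)
    moreover have "t \<in> {0..1} \<inter> ball t e" using t e by auto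
    ultimately show ?thesis by blast
  qed
  then show "openin (prod_topology (top_of_set {0..1}) (realization_top K))
      {x \<in> topspace (prod_topology (top_of_set {0..1}) (realization_top K)). h x \<in> U}"
    unfolding W_def[symmetric] openin_prod_topology_alt by blast
qed

text \<open>On each closed simplex the homotopy uses finitely many vertices. This makes continuity a
  matter of coordinates and is preserved by concatenation.\<close>

definition fin_htpy :: "'v set set \<Rightarrow> (('v \<Rightarrow> real) \<Rightarrow> 'v \<Rightarrow> real) \<Rightarrow> (('v \<Rightarrow> real) \<Rightarrow> 'v \<Rightarrow> real) \<Rightarrow> bool" where
  "fin_htpy K f g \<longleftrightarrow> (\<exists>h :: real \<times> ('v \<Rightarrow> real) \<Rightarrow> 'v \<Rightarrow> real. (\<forall>\<sigma>\<in>K. fin_map K ({0..1} \<times> closed_simplex K \<sigma>) h) \<and>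
     (\<forall>p\<in>realization K. h (0, p) = f p \<and> h (1, p) = g p))"

lemma fin_htpyE:
  fixes K :: "'v set set"
  assumes "fin_htpy K f g"
  obtains h :: "real \<times> ('v \<Rightarrow> real) \<Rightarrow> 'v \<Rightarrow> real"
  where "\<And>\<sigma>. \<sigma> \<in> K \<Longrightarrow> fin_map K ({0..1} \<times> closed_simplex K \<sigma>) h"
    "\<And>p. p \<in> realization K \<Longrightarrow> h (0, p) = f p \<and> h (1, p) = g p"
  using assms unfolding fin_htpy_def by blast

definition fin_contractible :: "'v set set \<Rightarrow> bool" where
  "fin_contractible K \<longleftrightarrow> (\<exists>a\<in>realization K. fin_htpy K (\<lambda>p. p) (\<lambda>p. a))"

lemma fin_contractible_imp_contractible_space:
  assumes K: "scomplex K" and c: "fin_contractible K"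
  shows "contractible_space (realization_top K)"
proof -
  obtain a where "fin_htpy K (\<lambda>p. p) (\<lambda>p. a)" using c unfolding fin_contractible_def by blast
  then obtain h where h: "\<And>\<sigma>. \<sigma> \<in> K \<Longrightarrow> fin_map K ({0..1::real} \<times> closed_simplex K \<sigma>) h"
    "\<And>p. p \<in> realization K \<Longrightarrow> h (0, p) = p \<and> h (1, p) = a"
    using fin_htpyE by blast
  have "continuous_map (prod_topology (top_of_set {0..1}) (realization_top K)) (realization_top K) h"
    using fin_map_continuous_map[OF K h(1)] by (rule continuous_map_realization_homotopy)
  then have "homotopic_with (\<lambda>x. True) (realization_top K) (realization_top K) id (\<lambda>x. a)"
    by (subst homotopic_with) (use h(2) in auto)
  then show ?thesis unfolding contractible_space_def by blast
qed

lemma fin_htpy_trans: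
  assumes "fin_htpy K f g" "fin_htpy K g k"
  shows "fin_htpy K f k"
proof -
  obtain h where h: "\<And>\<sigma>. \<sigma> \<in> K \<Longrightarrow> fin_map K ({0..1::real} \<times> closed_simplex K \<sigma>) h"
    "\<And>p. p \<in> realization K \<Longrightarrow> h (0, p) = f p \<and> h (1, p) = g p"
    using fin_htpyE[OF assms(1)] by blast
  obtain h' where h': "\<And>\<sigma>. \<sigma> \<in> K \<Longrightarrow> fin_map K ({0..1::real} \<times> closed_simplex K \<sigma>) h'"
    "\<And>p. p \<in> realization K \<Longrightarrow> h' (0, p) = g p \<and> h' (1, p) = k p"
    using fin_htpyE[OF assms(2)] by blast
  define H where "H x = (if fst x \<le> 1/2 then h (2 * fst x, snd x) else h' (2 * fst x - 1, snd x))"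
    for x :: "real \<times> ('a \<Rightarrow> real)"
  have "fin_map K ({0..1} \<times> closed_simplex K \<sigma>) H" if \<sigma>: "\<sigma> \<in> K" for \<sigma>
  proof -
    let ?T = "{0..1::real} \<times> closed_simplex K \<sigma>"
    have h1: "fin_map K {x \<in> ?T. fst x \<le> 1/2} (\<lambda>x. h (2 * fst x, snd x))"
      by (rule fin_map_compose[OF h(1)[OF \<sigma>]]) (auto intro!: continuous_on_Pair continuous_on_mult continuous_on_const continuous_on_fst_snd)
    have h2: "fin_map K {x \<in> ?T. 1/2 \<le> fst x} (\<lambda>x. h' (2 * fst x - 1, snd x))"
      by (rule fin_map_compose[OF h'(1)[OF \<sigma>]]) (auto intro!: continuous_on_Pair continuous_on_mult continuous_on_diff continuous_on_const continuous_on_fst_snd)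
    obtain S where S: "finite S" "\<And>x. x \<in> {x \<in> ?T. fst x \<le> 1/2} \<Longrightarrow> supp (h (2 * fst x, snd x)) \<subseteq> S"
      using h1 by (auto simp: fin_map_def)
    obtain S' where S': "finite S'" "\<And>x. x \<in> {x \<in> ?T. 1/2 \<le> fst x} \<Longrightarrow> supp (h' (2 * fst x - 1, snd x)) \<subseteq> S'"
      using h2 by (auto simp: fin_map_def)
    have "continuous_on ?T H"
      unfolding H_def
    proof (rule continuous_on_cases_le)
      show "continuous_on {x \<in> ?T. fst x \<le> 1/2} (\<lambda>x. h (2 * fst x, snd x))"
        "continuous_on {x \<in> ?T. 1/2 \<le> fst x} (\<lambda>x. h' (2 * fst x - 1, snd x))"
        using h1 h2 by (auto simp: fin_map_def)
      show "continuous_on ?T fst" by (rule continuous_on_fst_snd)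
      fix x assume x: "x \<in> ?T" "fst x = 1/2"
      then have "snd x \<in> realization K" using closed_simplex_sub_realization[of K \<sigma>] by auto
      moreover have "2 * fst x = 1" "2 * fst x - 1 = 0" using x(2) by simp_all
      ultimately show "h (2 * fst x, snd x) = h' (2 * fst x - 1, snd x)"
        using h(2)[of "snd x"] h'(2)[of "snd x"] by metis
    qed
    moreover have "H x \<in> realization K \<and> supp (H x) \<subseteq> S \<union> S'" if x: "x \<in> ?T" for x
    proof (cases "fst x \<le> 1/2")
      case True
      then have "x \<in> {x \<in> ?T. fst x \<le> 1/2}" using x by blast
      then have "h (2 * fst x, snd x) \<in> realization K" "supp (h (2 * fst x, snd x)) \<subseteq> S"
        using h1 S(2) unfolding fin_map_def by blast+
      then show ?thesis using True by (auto simp: H_def)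
    next
      case False
      then have "x \<in> {x \<in> ?T. 1/2 \<le> fst x}" using x by auto
      then have "h' (2 * fst x - 1, snd x) \<in> realization K" "supp (h' (2 * fst x - 1, snd x)) \<subseteq> S'"
        using h2 S'(2) unfolding fin_map_def by blast+
      then show ?thesis using False by (auto simp: H_def)
    qed
    ultimately show ?thesis
      unfolding fin_map_def using S(1) S'(1)
      by (intro conjI exI[of _ "S \<union> S'"]) auto
  qed
  moreover have "H (0, p) = f p \<and> H (1, p) = k p" if "p \<in> realization K" for p
    using h(2) h'(2) that by (auto simp: H_def)
  ultimately show ?thesis unfolding fin_htpy_def by blast
qed

lemma convex_combination_realization:
  assumes K: "scomplex K" and p: "p \<in> realization K" and q: "q \<in> realization K"
    and pq: "supp p \<union> supp q \<in> K" and t: "0 \<le> t" "t \<le> 1"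
  shows "(\<lambda>v. (1 - t) * p v + t * q v) \<in> realization K"
proof (rule realizationI)
  let ?S = "supp p \<union> supp q" and ?r = "\<lambda>v. (1 - t) * p v + t * q v"
  show "0 \<le> (1 - t) * p v + t * q v" for v
    using realizationD(1)[OF p] realizationD(1)[OF q] t by simp
  show fin: "finite ?S" using scomplex_finite[OF K pq] .
  show sub: "supp ?r \<subseteq> ?S" by auto
  have "sum ?r ?S = (1 - t) * sum p ?S + t * sum q ?S" by (simp add: sum.distrib sum_distrib_left)
  also have "\<dots> = 1" using realization_sum[OF p fin] realization_sum[OF q fin] by simp
  finally show sum1: "sum ?r ?S = 1" .
  then have "supp ?r \<noteq> {}" using supp_nonempty_if_sum[of ?r ?S] by auto
  then show "supp ?r \<in> K" using scomplex_face[OF K pq sub] by blast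
qed

text \<open>Contiguity: the two images lie in a common simplex, so the segment between them does not
  leave the realization.\<close>

lemma fin_htpy_straight_line:
  assumes K: "scomplex K"
    and f: "\<And>\<sigma>. \<sigma> \<in> K \<Longrightarrow> fin_map K (closed_simplex K \<sigma>) f"
    and g: "\<And>\<sigma>. \<sigma> \<in> K \<Longrightarrow> fin_map K (closed_simplex K \<sigma>) g"
    and fg: "\<And>p. p \<in> realization K \<Longrightarrow> supp (f p) \<union> supp (g p) \<in> K"
  shows "fin_htpy K f g"
proof -
  define h where "h x = (\<lambda>v. (1 - fst x) * f (snd x) v + fst x * g (snd x) v)" for x :: "real \<times> ('a \<Rightarrow> real)"
  have "fin_map K ({0..1} \<times> closed_simplex K \<sigma>) h" if \<sigma>: "\<sigma> \<in> K" for \<sigma>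
  proof -
    let ?T = "{0..1::real} \<times> closed_simplex K \<sigma>"
    have im: "snd ` ?T \<subseteq> closed_simplex K \<sigma>" by auto
    have sn: "continuous_on ?T snd" by (rule continuous_on_fst_snd)
    obtain S where S: "finite S" "\<And>x. x \<in> ?T \<Longrightarrow> supp (f (snd x)) \<subseteq> S"
      "\<And>v. continuous_on ?T (\<lambda>x. f (snd x) v)" "\<And>x. x \<in> ?T \<Longrightarrow> f (snd x) \<in> realization K"
      using fin_mapE[OF fin_map_compose[OF f[OF \<sigma>] sn im]] by blast
    obtain S' where S': "finite S'" "\<And>x. x \<in> ?T \<Longrightarrow> supp (g (snd x)) \<subseteq> S'"
      "\<And>v. continuous_on ?T (\<lambda>x. g (snd x) v)" "\<And>x. x \<in> ?T \<Longrightarrow> g (snd x) \<in> realization K"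
      using fin_mapE[OF fin_map_compose[OF g[OF \<sigma>] sn im]] by blast
    show ?thesis
    proof (rule fin_mapI)
      show "continuous_on ?T (\<lambda>x. h x v)" for v
        unfolding h_def
        by (intro continuous_on_add continuous_on_mult continuous_on_diff continuous_on_const continuous_on_fst_snd S(3) S'(3))
      show "finite (S \<union> S')" using S S' by simp
      fix x assume x: "x \<in> ?T"
      have r: "snd x \<in> realization K" using x closed_simplex_sub_realization[of K \<sigma>] by auto
      show "h x \<in> realization K"
        unfolding h_def using x by (intro convex_combination_realization[OF K S(4)[OF x] S'(4)[OF x] fg[OF r]]) auto
      show "supp (h x) \<subseteq> S \<union> S'" using S(2)[OF x] S'(2)[OF x] unfolding h_def by fastforce
    qed
  qed
  moreover have "h (0, p) = f p \<and> h (1, p) = g p" for p by (simp add: h_def)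
  ultimately show ?thesis unfolding fin_htpy_def by blast
qed

definition normalize :: "('v \<Rightarrow> real) \<Rightarrow> 'v \<Rightarrow> real" where
  "normalize W = (\<lambda>v. W v / sum W (supp W))"

text \<open>The sum over the fixed finite set S is a continuous denominator, positive because the
  support is a simplex and so not empty.\<close>

lemma fin_map_normalize:
  assumes sK: "scomplex K" and c: "\<And>v. continuous_on T (\<lambda>t. W t v)"
    and pos: "\<And>t v. t \<in> T \<Longrightarrow> 0 \<le> W t v" and K: "\<And>t. t \<in> T \<Longrightarrow> supp (W t) \<in> K"
    and S: "finite S" "\<And>t. t \<in> T \<Longrightarrow> supp (W t) \<subseteq> S"
  shows "fin_map K T (\<lambda>t. normalize (W t))" "\<And>t. t \<in> T \<Longrightarrow> supp (normalize (W t)) = supp (W t)"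
proof -
  have eq: "sum (W t) (supp (W t)) = sum (W t) S" if "t \<in> T" for t
    using sum_supp[OF S(1) S(2)[OF that]] .
  have ne: "sum (W t) S > 0" if "t \<in> T" for t
  proof -
    have "supp (W t) \<noteq> {}" using K[OF that] sK unfolding scomplex_def by blast
    then obtain v where v: "W t v \<noteq> 0" by blast
    then have "v \<in> S" using S(2)[OF that] by blast
    then show ?thesis using v pos[OF that] S(1) by (intro sum_pos2[of S v]) (auto simp: less_le)
  qed
  have n: "normalize (W t) = (\<lambda>v. W t v / sum (W t) S)" if "t \<in> T" for t
    using eq[OF that] by (simp add: normalize_def)
  show sup: "supp (normalize (W t)) = supp (W t)" if "t \<in> T" for t
    using ne[OF that] n[OF that] by auto
  show "fin_map K T (\<lambda>t. normalize (W t))"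
  proof (rule fin_mapI)
    fix v
    have "continuous_on T (\<lambda>t. W t v / sum (W t) S)"
      using ne by (intro continuous_on_divide continuous_on_sum c) (auto simp: less_le)
    then show "continuous_on T (\<lambda>t. normalize (W t) v)"
      by (rule continuous_on_eq) (simp add: n)
  next
    fix t assume t: "t \<in> T"
    show "supp (normalize (W t)) \<subseteq> S" using sup[OF t] S(2)[OF t] by simp
    show "normalize (W t) \<in> realization K"
    proof (rule realizationI)
      show "supp (normalize (W t)) \<in> K" using sup[OF t] K[OF t] by simp
      show "supp (normalize (W t)) \<subseteq> S" by fact
      show "0 \<le> normalize (W t) v" for v using n[OF t] pos[OF t] ne[OF t] by simp
      show "sum (normalize (W t)) S = 1"
        using n[OF t] ne[OF t] by (simp add: sum_divide_distrib[symmetric])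
    qed (rule S(1))
  qed (rule S(1))
qed

text \<open>For join coordinates: the direction u is continuous only where the mass m is positive,
  but it is bounded there, so the product tends to 0 where m does.\<close>

lemma continuous_on_mult_vanishing:
  fixes m u :: "'b::topological_space \<Rightarrow> real"
  assumes m: "continuous_on T m" and m0: "\<And>x. x \<in> T \<Longrightarrow> 0 \<le> m x"
    and u: "continuous_on {x\<in>T. 0 < m x} u" and ub: "\<And>x. x \<in> T \<Longrightarrow> 0 < m x \<Longrightarrow> \<bar>u x\<bar> \<le> 1"
  shows "continuous_on T (\<lambda>x. m x * u x)"
  unfolding continuous_on_def
proof
  fix x assume x: "x \<in> T"
  have tm: "(m \<longlongrightarrow> m x) (at x within T)" using m x by (simp add: continuous_on_def)
  show "((\<lambda>x. m x * u x) \<longlongrightarrow> m x * u x) (at x within T)"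
  proof (cases "0 < m x")
    case True
    have "\<forall>\<^sub>F y in at x within T. 0 < m y" using tm True by (rule order_tendstoD)
    then obtain A where A: "open A" "x \<in> A" "\<And>y. y \<in> A \<Longrightarrow> y \<noteq> x \<Longrightarrow> y \<in> T \<Longrightarrow> 0 < m y"
      unfolding eventually_at_topological by blast
    have "at x within T = at x within {x\<in>T. 0 < m x}"
      using A True by (intro at_within_nhd[of x A]) auto
    moreover have "(u \<longlongrightarrow> u x) (at x within {x\<in>T. 0 < m x})" using u x True by (simp add: continuous_on_def)
    ultimately show ?thesis using tm by (intro tendsto_mult) auto
  next
    case False
    then have mx: "m x = 0" using m0[OF x] by simp
    have "((\<lambda>y. m y * u y) \<longlongrightarrow> 0) (at x within T)"
    proof (rule Lim_null_comparison)
      show "\<forall>\<^sub>F y in at x within T. norm (m y * u y) \<le> m y"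
        unfolding eventually_at_topological
      proof (intro exI[of _ UNIV] conjI ballI impI)
        fix y assume y: "y \<in> T"
        show "norm (m y * u y) \<le> m y"
        proof (cases "0 < m y")
          case True
          then show ?thesis using ub[OF y] by (simp add: abs_mult mult_left_le)
        next
          case False
          then show ?thesis using m0[OF y] by simp
        qed
      qed auto
      show "(m \<longlongrightarrow> 0) (at x within T)" using tm mx by simp
    qed
    then show ?thesis using mx by simp
  qed
qed

text \<open>The last hypothesis makes K the join of L with the simplices that avoid P. The
  contraction of L is run on the normalized P-coordinates, while the mass m on P and all other
  coordinates are kept. Afterwards the P-part is a multiple of the single point a, so straight lines
  to a stay in K; these also move the points with m = 0.\<close>

lemma fin_contractible_join:
  assumes K: "scomplex K" and L: "L = {\<sigma>\<in>K. \<sigma> \<subseteq> P}" and c: "fin_contractible L"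
    and join: "\<And>\<sigma> \<tau>. \<sigma> \<in> L \<Longrightarrow> \<tau> \<in> K \<Longrightarrow> \<tau> \<inter> P = {} \<Longrightarrow> \<sigma> \<union> \<tau> \<in> K"
  shows "fin_contractible K"
proof -
  have sL: "scomplex L" using K unfolding L scomplex_def by blast
  have LK: "L \<subseteq> K" using L by blast
  obtain a where a: "a \<in> realization L" and "fin_htpy L (\<lambda>p. p) (\<lambda>p. a)"
    using c unfolding fin_contractible_def by blast
  then obtain h where h: "\<And>\<sigma>. \<sigma> \<in> L \<Longrightarrow> fin_map L ({0..1::real} \<times> closed_simplex L \<sigma>) h"
    "\<And>p. p \<in> realization L \<Longrightarrow> h (0, p) = p \<and> h (1, p) = a"
    using fin_htpyE by blast
  define m where "m z = sum z (supp z \<inter> P)" for z :: "'a \<Rightarrow> real"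
  \<comment> \<open>Where m z = 0 the quotients are 0 and \<open>pr z\<close> is no point of L; the
    factor m z in \<open>H\<close> cancels whatever the contraction does there.\<close>
  define pr where "pr z = (\<lambda>v. if v \<in> P then z v / m z else 0)" for z :: "'a \<Rightarrow> real"
  define H where "H x = (\<lambda>v. if v \<in> P then m (snd x) * h (fst x, pr (snd x)) v else snd x v)"
    for x :: "real \<times> ('a \<Rightarrow> real)"
  have m_eq: "m z = sum z (S \<inter> P)" if "finite S" "supp z \<subseteq> S" for z S
    unfolding m_def using that by (intro sum.mono_neutral_left) auto
  have m0: "0 \<le> m z" if "z \<in> realization K" for z
    unfolding m_def using realizationD(1)[OF that] by (simp add: sum_nonneg)
  have zP: "z v = 0" if "z \<in> realization K" "m z = 0" "v \<in> P" for z v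
  proof (rule ccontr)
    assume "z v \<noteq> 0"
    moreover have "finite (supp z \<inter> P)" using scomplex_finite[OF K realizationD(2)[OF that(1)]] by simp
    ultimately have "0 < m z"
      unfolding m_def using realizationD(1)[OF that(1)] that(3) by (intro sum_pos2[of _ v]) (auto simp: less_le)
    then show False using that by simp
  qed
  have prL: "pr z \<in> realization L" "supp (pr z) = supp z \<inter> P" if z: "z \<in> realization K" "0 < m z" for z
  proof -
    show s: "supp (pr z) = supp z \<inter> P" using z(2) by (auto simp: pr_def)
    have fin: "finite (supp z \<inter> P)" using scomplex_finite[OF K realizationD(2)[OF z(1)]] by simp
    have ne: "supp z \<inter> P \<noteq> {}" using z(2) unfolding m_def by (metis less_irrefl sum.empty)
    show "pr z \<in> realization L"
    proof (rule realizationI)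
      show "0 \<le> pr z v" for v using realizationD(1)[OF z(1)] z(2) by (simp add: pr_def)
      have "supp z \<inter> P \<in> K" using scomplex_face[OF K realizationD(2)[OF z(1)], of "supp z \<inter> P"] ne by blast
      then show "supp (pr z) \<in> L" unfolding s L by blast
      show "finite (supp z \<inter> P)" "supp (pr z) \<subseteq> supp z \<inter> P" using fin s by auto
      have "sum (pr z) (supp z \<inter> P) = sum z (supp z \<inter> P) / m z"
        unfolding sum_divide_distrib by (rule sum.cong) (auto simp: pr_def)
      then show "sum (pr z) (supp z \<inter> P) = 1" using z(2) by (simp add: m_def)
    qed
  qed
  have hz: "h (t, pr z) \<in> realization L" if "z \<in> realization K" "0 < m z" "t \<in> {0..1}" for t z
    using h(1)[of "supp (pr z)"] realization_in_closed_simplex[OF prL(1)[OF that(1,2)]] that(3)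
    unfolding fin_map_def by blast
  have HK: "H (t, z) \<in> realization K" if z: "z \<in> realization K" and t: "t \<in> {0..1}" for t z
  proof (cases "0 < m z")
    case False
    then have "m z = 0" using m0[OF z] by simp
    then have "H (t, z) = z" using zP[OF z] by (auto simp: H_def)
    then show ?thesis using z by simp
  next
    case True
    note hL = hz[OF z True t]
    have finz: "finite (supp z)" using scomplex_finite[OF K realizationD(2)[OF z]] .
    have hsub: "supp (h (t, pr z)) \<subseteq> P" using realizationD(2)[OF hL] L by blast
    have finh: "finite (supp (h (t, pr z)))" using scomplex_finite[OF sL realizationD(2)[OF hL]] .
    have s: "supp (H (t, z)) = supp (h (t, pr z)) \<union> (supp z - P)"
      using True hsub by (auto simp: H_def)
    show ?thesis
    proof (rule realizationI)
      show "0 \<le> H (t, z) v" for v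
        using realizationD(1)[OF z] realizationD(1)[OF hL] True by (simp add: H_def)
      show "supp (H (t, z)) \<in> K"
      proof (cases "supp z - P = {}")
        case True
        show ?thesis unfolding s True Un_empty_right using realizationD(2)[OF hL] LK by blast
      next
        case False
        then have "supp z - P \<in> K" by (rule scomplex_face[OF K realizationD(2)[OF z] Diff_subset])
        then show ?thesis unfolding s by (intro join realizationD(2)[OF hL]) auto
      qed
      show "finite (supp (h (t, pr z)) \<union> (supp z - P))" using finh finz by simp
      show "supp (H (t, z)) \<subseteq> supp (h (t, pr z)) \<union> (supp z - P)" using s by simp
      have "sum (H (t, z)) (supp (h (t, pr z)) \<union> (supp z - P)) =
          sum (H (t, z)) (supp (h (t, pr z))) + sum (H (t, z)) (supp z - P)"
        using finh finz hsub by (intro sum.union_disjoint) auto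
      also have "sum (H (t, z)) (supp (h (t, pr z))) = m z * sum (h (t, pr z)) (supp (h (t, pr z)))"
        unfolding sum_distrib_left using hsub by (intro sum.cong) (auto simp: H_def)
      also have "sum (H (t, z)) (supp z - P) = sum z (supp z - P)"
        by (intro sum.cong) (auto simp: H_def)
      also have "m z * sum (h (t, pr z)) (supp (h (t, pr z))) = m z" using realizationD(3)[OF hL] by simp
      also have "m z + sum z (supp z - P) = sum z (supp z)"
        unfolding m_def using sum.Int_Diff[OF finz, of z P] by simp
      finally show "sum (H (t, z)) (supp (h (t, pr z)) \<union> (supp z - P)) = 1" using realizationD(3)[OF z] by simp
    qed
  qed
  have fin: "fin_map K ({0..1} \<times> closed_simplex K \<sigma>) H" if \<sigma>: "\<sigma> \<in> K" for \<sigma>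
  proof -
    let ?T = "{0..1::real} \<times> closed_simplex K \<sigma>"
    have fs: "finite \<sigma>" using scomplex_finite[OF K \<sigma>] .
    have sz: "snd x \<in> realization K" "supp (snd x) \<subseteq> \<sigma>" "fst x \<in> {0..1}" if "x \<in> ?T" for x
      using that by (auto simp: closed_simplex_def)
    have mx: "m (snd x) = (\<Sum>v\<in>\<sigma> \<inter> P. snd x v)" if "x \<in> ?T" for x
      using m_eq[OF fs sz(2)[OF that]] .
    have csn: "continuous_on A (\<lambda>x. snd x v)" for v and A :: "(real \<times> ('a \<Rightarrow> real)) set"
      by (rule continuous_on_compose2[OF continuous_on_coord[of UNIV]]) (auto intro!: continuous_on_fst_snd)
    have cm: "continuous_on ?T (\<lambda>x. m (snd x))"
    proof (rule continuous_on_eq)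
      show "continuous_on ?T (\<lambda>x. \<Sum>v\<in>\<sigma> \<inter> P. snd x v)" by (intro continuous_on_sum csn)
    qed (simp add: mx)
    define T' where "T' = {x\<in>?T. 0 < m (snd x)}"
    have "\<exists>S. finite S \<and> (\<forall>x\<in>T'. supp (h (fst x, pr (snd x))) \<subseteq> S) \<and> (\<forall>v. continuous_on T' (\<lambda>x. h (fst x, pr (snd x)) v))"
    proof (cases "\<sigma> \<inter> P = {}")
      case True
      then have "T' = {}" using mx by (auto simp: T'_def)
      then show ?thesis by auto
    next
      case False
      then have "\<sigma> \<inter> P \<in> L" using scomplex_face[OF K \<sigma>, of "\<sigma> \<inter> P"] unfolding L by blast
      then have hf: "fin_map L ({0..1} \<times> closed_simplex L (\<sigma> \<inter> P)) h" by (rule h(1))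
      have "continuous_on T' (\<lambda>x. (fst x, pr (snd x)))"
      proof (intro continuous_on_Pair continuous_on_coordinatewise_then_product)
        show "continuous_on T' (\<lambda>x. pr (snd x) v)" for v
        proof (cases "v \<in> P")
          case True
          have "continuous_on T' (\<lambda>x. snd x v / m (snd x))"
            using cm by (intro continuous_on_divide csn) (auto simp: T'_def intro: continuous_on_subset)
          then show ?thesis using True by (simp add: pr_def)
        qed (simp add: pr_def)
      qed (rule continuous_on_fst_snd)
      moreover have "(\<lambda>x. (fst x, pr (snd x))) ` T' \<subseteq> {0..1} \<times> closed_simplex L (\<sigma> \<inter> P)"
      proof
        fix y assume "y \<in> (\<lambda>x. (fst x, pr (snd x))) ` T'"
        then obtain x where x: "x \<in> ?T" "0 < m (snd x)" "y = (fst x, pr (snd x))" by (auto simp: T'_def)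
        then have "pr (snd x) \<in> closed_simplex L (\<sigma> \<inter> P)"
          using prL[OF sz(1)[OF x(1)] x(2)] sz(2)[OF x(1)] unfolding closed_simplex_def by blast
        then show "y \<in> {0..1} \<times> closed_simplex L (\<sigma> \<inter> P)" using x sz(3) by auto
      qed
      ultimately have fm: "fin_map L T' (\<lambda>x. h (fst x, pr (snd x)))" using fin_map_compose[OF hf] by fastforce
      from fm obtain S where "finite S" "\<forall>x\<in>T'. supp (h (fst x, pr (snd x))) \<subseteq> S"
        unfolding fin_map_def by (elim conjE exE)
      moreover have "continuous_on T' (\<lambda>x. h (fst x, pr (snd x)) v)" for v
        using fm unfolding fin_map_def by (elim conjE) (rule continuous_on_product_then_coordinatewise)
      ultimately show ?thesis by (intro exI[of _ S] conjI allI)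
    qed
    then obtain S where S: "finite S" "\<And>x. x \<in> T' \<Longrightarrow> supp (h (fst x, pr (snd x))) \<subseteq> S"
      "\<And>v. continuous_on T' (\<lambda>x. h (fst x, pr (snd x)) v)" by blast
    show ?thesis
    proof (rule fin_mapI)
      show "continuous_on ?T (\<lambda>x. H x v)" for v
      proof (cases "v \<in> P")
        case True
        have "continuous_on ?T (\<lambda>x. m (snd x) * h (fst x, pr (snd x)) v)"
        proof (rule continuous_on_mult_vanishing[OF cm])
          show "0 \<le> m (snd x)" if "x \<in> ?T" for x using m0 sz(1)[OF that] by blast
          show "continuous_on {x \<in> ?T. 0 < m (snd x)} (\<lambda>x. h (fst x, pr (snd x)) v)"
            using S(3) unfolding T'_def .
          fix x assume x: "x \<in> ?T" "0 < m (snd x)"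
          have hr: "h (fst x, pr (snd x)) \<in> realization L" using hz[OF sz(1)[OF x(1)] x(2) sz(3)[OF x(1)]] .
          show "\<bar>h (fst x, pr (snd x)) v\<bar> \<le> 1"
            using realizationD(1)[OF hr, of v]
              closed_simplex_le_1[OF realization_in_closed_simplex[OF hr, THEN conjunct2], of v] by simp
        qed
        then show ?thesis using True by (simp add: H_def)
      next
        case False
        then show ?thesis using csn[of ?T v] by (simp add: H_def)
      qed
      show "finite (S \<union> \<sigma>)" using S(1) fs by simp
      fix x assume x: "x \<in> ?T"
      show "H x \<in> realization K" using HK[OF sz(1)[OF x] sz(3)[OF x]] by simp
      show "supp (H x) \<subseteq> S \<union> \<sigma>"
      proof
        fix v assume v: "v \<in> supp (H x)"
        show "v \<in> S \<union> \<sigma>"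
        proof (cases "v \<in> P")
          case True
          then have "m (snd x) \<noteq> 0" "h (fst x, pr (snd x)) v \<noteq> 0" using v by (auto simp: H_def)
          then have "x \<in> T'" using m0[OF sz(1)[OF x]] x by (auto simp: T'_def less_le)
          then show ?thesis using S(2) \<open>h (fst x, pr (snd x)) v \<noteq> 0\<close> by blast
        next
          case False
          then show ?thesis using v sz(2)[OF x] by (auto simp: H_def)
        qed
      qed
    qed
  qed
  define g where "g z = H (1, z)" for z
  have "H (0, z) = z" if "z \<in> realization K" for z
  proof
    fix v
    show "H (0, z) v = z v"
    proof (cases "0 < m z")
      case True
      then have "h (0, pr z) = pr z" using h(2) prL(1)[OF that True] by blast
      then show ?thesis using True by (simp add: H_def pr_def)
    next
      case False
      then have "m z = 0" using m0[OF that] by simp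
      then show ?thesis using zP[OF that] by (simp add: H_def)
    qed
  qed
  then have 1: "fin_htpy K (\<lambda>p. p) g" unfolding fin_htpy_def g_def using fin by (intro exI[of _ H] conjI ballI) auto
  have aK: "a \<in> realization K" using a realization_mono[OF LK] by blast
  have 2: "fin_htpy K g (\<lambda>p. a)"
  proof (rule fin_htpy_straight_line[OF K])
    fix \<sigma> assume \<sigma>: "\<sigma> \<in> K"
    show "fin_map K (closed_simplex K \<sigma>) g"
      unfolding g_def by (rule fin_map_compose[OF fin[OF \<sigma>]]) (auto intro!: continuous_on_Pair continuous_on_const continuous_on_id)
    show "fin_map K (closed_simplex K \<sigma>) (\<lambda>p. a)"
      by (rule fin_mapI[where S = "supp a"]) (use aK scomplex_finite[OF K realizationD(2)[OF aK]] in auto)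
  next
    fix z assume z: "z \<in> realization K"
    have sub: "supp (g z) \<subseteq> supp a \<union> (supp z - P)"
    proof
      fix v assume v: "v \<in> supp (g z)"
      show "v \<in> supp a \<union> (supp z - P)"
      proof (cases "v \<in> P")
        case True
        then have "m z \<noteq> 0" "h (1, pr z) v \<noteq> 0" using v by (auto simp: H_def g_def)
        then have "h (1, pr z) = a" using h(2) prL(1)[OF z] m0[OF z] by (simp add: less_le)
        then show ?thesis using \<open>h (1, pr z) v \<noteq> 0\<close> by simp
      next
        case False
        then show ?thesis using v by (simp add: H_def g_def)
      qed
    qed
    have "supp a \<union> (supp z - P) \<in> K"
    proof (cases "supp z - P = {}")
      case True
      then show ?thesis using realizationD(2)[OF aK] by (metis Un_empty_right)
    next
      case False
      then have "supp z - P \<in> K" by (rule scomplex_face[OF K realizationD(2)[OF z] Diff_subset])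
      then show ?thesis by (intro join realizationD(2)[OF a]) auto
    qed
    moreover have "supp a \<noteq> {}" using realizationD(2)[OF aK] K unfolding scomplex_def by blast
    ultimately show "supp (g z) \<union> supp a \<in> K"
      using sub scomplex_face[OF K, of "supp a \<union> (supp z - P)" "supp (g z) \<union> supp a"] by blast
  qed
  show ?thesis unfolding fin_contractible_def using aK fin_htpy_trans[OF 1 2] by blast
qed

subsection \<open>The nerve of a cover by balls\<close>

lemma continuous_on_Max_image:
  fixes g :: "'i \<Rightarrow> 'b::topological_space \<Rightarrow> real"
  assumes "finite A" "A \<noteq> {}" "\<And>a. a \<in> A \<Longrightarrow> continuous_on S (g a)"
  shows "continuous_on S (\<lambda>x. Max ((\<lambda>a. g a x) ` A))"
  using assms
proof (induction A rule: finite_ne_induct)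
  case (insert a A)
  have "Max ((\<lambda>a. g a x) ` insert a A) = max (g a x) (Max ((\<lambda>a. g a x) ` A))" for x
    using insert.hyps by simp
  then show ?case using insert.IH insert.prems by (simp add: continuous_on_max)
qed simp

text \<open>Centres may lie outside Y, since an invariant ball need not come with a fixed centre.
  Indices are abstract so that the vertices of a join can serve as indices and the complex becomes a
  subcomplex of that join.\<close>

locale ball_cover = hadamard w for w :: "'a::metric_space \<Rightarrow> 'a \<Rightarrow> real \<Rightarrow> 'a" +
  fixes Y :: "'a set" and I :: "'v set" and cen :: "'v \<Rightarrow> 'a" and rad :: "'v \<Rightarrow> real"
  assumes clY: "closed Y" and coY: "cconvex Y" and neY: "Y \<noteq> {}"
    and rad_pos: "\<And>v. v \<in> I \<Longrightarrow> 0 < rad v"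
    and cover: "\<And>y. y \<in> Y \<Longrightarrow> \<exists>v\<in>I. dist (cen v) y < rad v"
begin

text \<open>A simplex requires a common point inside Y. For invariant balls this agrees with a
  common point anywhere, because their intersections contain fixed points or invariant
  lines.\<close>

definition ncomplex :: "'v set set" where
  "ncomplex = {\<sigma>. \<sigma> \<subseteq> I \<and> finite \<sigma> \<and> \<sigma> \<noteq> {} \<and> (\<exists>y\<in>Y. \<forall>v\<in>\<sigma>. dist (cen v) y < rad v)}"

lemma scomplex_ncomplex: "scomplex ncomplex"
  unfolding scomplex_def
proof (intro conjI ballI allI impI)
  fix \<sigma> assume "\<sigma> \<in> ncomplex"
  then show "finite \<sigma>" "\<sigma> \<noteq> {}" by (auto simp: ncomplex_def)
next
  fix \<sigma> \<tau> assume "\<sigma> \<in> ncomplex" "\<tau> \<subseteq> \<sigma>" "\<tau> \<noteq> {}"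
  then show "\<tau> \<in> ncomplex" unfolding ncomplex_def using finite_subset by blast
qed

lemma supp_finite: "p \<in> realization ncomplex \<Longrightarrow> finite (supp p)"
  and supp_nonempty: "p \<in> realization ncomplex \<Longrightarrow> supp p \<noteq> {}"
  using realizationD(2)[of p ncomplex] by (auto simp: ncomplex_def)

definition kap :: "('v \<Rightarrow> real) \<Rightarrow> 'v \<Rightarrow> real" where
  "kap p v = max 0 ((\<Sum>u\<in>supp p. (p u)\<^sup>2) / p v - 1)"

definition cost :: "('v \<Rightarrow> real) \<Rightarrow> 'v \<Rightarrow> 'a \<Rightarrow> real" where
  "cost p v x = (dist (cen v) x)\<^sup>2 - (rad v)\<^sup>2 - kap p v"

definition total :: "('v \<Rightarrow> real) \<Rightarrow> 'a \<Rightarrow> real" where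
  "total p x = Max ((\<lambda>v. cost p v x) ` supp p)"

text \<open>The map from the nerve to \<open>Y\<close>. The penalty \<open>kap p v\<close> vanishes at the largest barycentric
  coordinate, which keeps \<open>F p\<close> inside that ball, and tends to infinity as \<open>p v \<rightarrow> 0\<close>, which
  makes \<open>F\<close> continuous where vertices disappear.\<close>

definition F :: "('v \<Rightarrow> real) \<Rightarrow> 'a" where
  "F p = (SOME z. z \<in> Y \<and> (\<forall>x\<in>Y. total p z + (dist x z)\<^sup>2 / 2 \<le> total p x))"

lemma kap_nonneg: "0 \<le> kap p v"
  by (simp add: kap_def)

lemma cost_le_total: "p \<in> realization ncomplex \<Longrightarrow> v \<in> supp p \<Longrightarrow> cost p v x \<le> total p x"
  unfolding total_def using supp_finite by (intro Max_ge) auto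

lemma total_le:
  assumes "p \<in> realization ncomplex" "\<And>v. v \<in> supp p \<Longrightarrow> cost p v x \<le> b"
  shows "total p x \<le> b"
  unfolding total_def using supp_finite[OF assms(1)] supp_nonempty[OF assms(1)] assms(2)
  by (subst Max_le_iff) auto

text \<open>Each cost is a squared distance plus a constant, so the maximum over the finite support
  inherits the modulus of \<open>midpoint\<close>; a single vertex bounds it from below.\<close>

lemma F_minimum:
  assumes p: "p \<in> realization ncomplex"
  shows "F p \<in> Y" "\<And>x. x \<in> Y \<Longrightarrow> total p (F p) + (dist x (F p))\<^sup>2 / 2 \<le> total p x"
proof -
  have "continuous_on Y (total p)"
    unfolding total_def cost_def
    by (intro continuous_on_Max_image supp_finite[OF p] supp_nonempty[OF p] continuous_intros)
  moreover have "strongly_convex_on Y (total p)"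
    unfolding strongly_convex_on_def
  proof (intro ballI)
    fix x y
    show "total p (w x y (1 / 2)) \<le> (total p x + total p y) / 2 - (dist x y)\<^sup>2 / 4"
    proof (rule total_le[OF p])
      fix v assume v: "v \<in> supp p"
      show "cost p v (w x y (1 / 2)) \<le> (total p x + total p y) / 2 - (dist x y)\<^sup>2 / 4"
        using midpoint[of "cen v" x y] cost_le_total[OF p v, of x] cost_le_total[OF p v, of y]
        unfolding cost_def by argo
    qed
  qed
  moreover obtain v0 where v0: "v0 \<in> supp p" using supp_nonempty[OF p] by blast
  have "- (rad v0)\<^sup>2 - kap p v0 \<le> total p x" for x
    using cost_le_total[OF p v0, of x] zero_le_power2[of "dist (cen v0) x"] unfolding cost_def by linarith
  ultimately obtain z where "z \<in> Y" "\<And>x. x \<in> Y \<Longrightarrow> total p z + (dist x z)\<^sup>2 / 2 \<le> total p x"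
    using strongly_convex_minimum[OF clY coY neY] by metis
  then have "\<exists>z. z \<in> Y \<and> (\<forall>x\<in>Y. total p z + (dist x z)\<^sup>2 / 2 \<le> total p x)" by blast
  then have "F p \<in> Y \<and> (\<forall>x\<in>Y. total p (F p) + (dist x (F p))\<^sup>2 / 2 \<le> total p x)"
    unfolding F_def by (rule someI_ex)
  then show "F p \<in> Y" "\<And>x. x \<in> Y \<Longrightarrow> total p (F p) + (dist x (F p))\<^sup>2 / 2 \<le> total p x" by auto
qed

text \<open>At a common point of the balls in the carrier all costs are negative, so the minimal
  total is negative too. The sum of the squared coordinates is at most the largest coordinate; the
  vertex attaining it thus has penalty 0, and its negative cost means membership in its
  ball.\<close>

lemma F_in_ball:
  assumes p: "p \<in> realization ncomplex"
  obtains v where "v \<in> supp p" "dist (cen v) (F p) < rad v"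
proof -
  have fin: "finite (supp p)" and ne: "supp p \<noteq> {}" using supp_finite[OF p] supp_nonempty[OF p] .
  have "Max (p ` supp p) \<in> p ` supp p" using fin ne by (intro Max_in) auto
  then obtain v where v: "v \<in> supp p" and max: "p v = Max (p ` supp p)" by auto
  have pv: "p u \<le> p v" if "u \<in> supp p" for u unfolding max using fin that by (intro Max_ge) auto
  have pos: "0 < p v" using v realizationD(1)[OF p, of v] by simp
  have "(\<Sum>u\<in>supp p. (p u)\<^sup>2) \<le> (\<Sum>u\<in>supp p. p v * p u)"
    unfolding power2_eq_square using pv realizationD(1)[OF p] by (intro sum_mono mult_right_mono) auto
  also have "\<dots> = p v" using realizationD(3)[OF p] by (simp add: sum_distrib_left[symmetric])
  finally have k0: "kap p v = 0" using pos by (simp add: kap_def)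
  obtain y where y: "y \<in> Y" "\<And>v. v \<in> supp p \<Longrightarrow> dist (cen v) y < rad v"
    using realizationD(2)[OF p] unfolding ncomplex_def by blast
  have "total p y < 0"
  proof -
    have "Max ((\<lambda>v. cost p v y) ` supp p) \<in> (\<lambda>v. cost p v y) ` supp p" using fin ne by (intro Max_in) auto
    then obtain u where u: "u \<in> supp p" "total p y = cost p u y" unfolding total_def by blast
    have "(dist (cen u) y)\<^sup>2 < (rad u)\<^sup>2" using y(2)[OF u(1)] by (intro power_strict_mono) auto
    then show ?thesis using u(2) kap_nonneg[of p u] by (simp add: cost_def)
  qed
  moreover have "total p (F p) \<le> total p y"
    using F_minimum(2)[OF p y(1)] zero_le_power2[of "dist y (F p)"] by linarith
  ultimately have "cost p v (F p) < 0" using cost_le_total[OF p v, of "F p"] by linarith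
  then have "(dist (cen v) (F p))\<^sup>2 < (rad v)\<^sup>2" by (simp add: cost_def k0)
  moreover have "0 < rad v" using rad_pos v realizationD(2)[OF p] unfolding ncomplex_def by blast
  ultimately have "dist (cen v) (F p) < rad v" by (meson less_imp_le power_less_imp_less_base)
  then show ?thesis using that v by blast
qed

text \<open>For q near p, each total exceeds the other by at most \<eta> at the other's minimizer,
  and the quadratic gap turns this into closeness of the minimizers. The danger lies in vertices of
  the simplex that are absent from p; their penalty grows beyond all bounds as q tends to p.\<close>

lemma continuous_on_F:
  assumes \<sigma>: "\<sigma> \<in> ncomplex"
  shows "continuous_on (closed_simplex ncomplex \<sigma>) F"
  unfolding continuous_on_def
proof
  let ?C = "closed_simplex ncomplex \<sigma>"
  have fs: "finite \<sigma>" using scomplex_finite[OF scomplex_ncomplex \<sigma>] .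
  have C: "q \<in> realization ncomplex" "supp q \<subseteq> \<sigma>" if "q \<in> ?C" for q
    using that by (auto simp: closed_simplex_def)
  fix p assume pC: "p \<in> ?C"
  note p = C(1)[OF pC]
  define sq where "sq q = (\<Sum>u\<in>\<sigma>. (q u)\<^sup>2)" for q :: "'v \<Rightarrow> real"
  have kap_eq: "kap q v = max 0 (sq q / q v - 1)" if "q \<in> ?C" for q v
  proof -
    have "(\<Sum>u\<in>supp q. (q u)\<^sup>2) = sq q"
      unfolding sq_def using fs C(2)[OF that] by (intro sum.mono_neutral_left) auto
    then show ?thesis by (simp add: kap_def)
  qed
  have tc: "((\<lambda>q. q v) \<longlongrightarrow> p v) (at p within ?C)" for v
    using continuous_on_coord[of ?C v] pC by (simp add: continuous_on_def)
  have tsq: "(sq \<longlongrightarrow> sq p) (at p within ?C)"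
    unfolding sq_def by (intro tendsto_sum tendsto_power tc)
  have sqp: "0 < sq p"
  proof -
    obtain v where v: "v \<in> supp p" using supp_nonempty[OF p] by blast
    then have "v \<in> \<sigma>" using C(2)[OF pC] by blast
    then show ?thesis unfolding sq_def using v fs by (intro sum_pos2[of \<sigma> v]) auto
  qed
  show "(F \<longlongrightarrow> F p) (at p within ?C)"
    unfolding tendsto_iff
  proof (intro allI impI)
    fix e :: real assume e: "0 < e"
    \<comment> \<open>The comparison below ends with a squared distance of at most 4 \<eta> = e^2 /
      2.\<close>
    define \<eta> where "\<eta> = e\<^sup>2 / 8"
    have \<eta>: "0 < \<eta>" using e by (simp add: \<eta>_def)
    \<comment> \<open>A penalty of at least M v keeps the cost of v at \<open>F p\<close> at or
      below the minimum for p, so a newly appearing vertex does not raise the total there.\<close>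
    define M where "M v = \<bar>(dist (cen v) (F p))\<^sup>2 - (rad v)\<^sup>2 - total p (F p)\<bar>" for v
    have ev1: "\<forall>\<^sub>F q in at p within ?C. 0 < q v \<and> dist (max 0 (sq q / q v - 1)) (max 0 (sq p / p v - 1)) < \<eta>"
      if "v \<in> supp p" for v
    proof -
      have pv: "0 < p v" using that realizationD(1)[OF p, of v] by simp
      have "((\<lambda>q. max 0 (sq q / q v - 1)) \<longlongrightarrow> max 0 (sq p / p v - 1)) (at p within ?C)"
        using pv by (intro tendsto_max tendsto_const tendsto_diff tendsto_divide tsq tc) auto
      then have "\<forall>\<^sub>F q in at p within ?C. dist (max 0 (sq q / q v - 1)) (max 0 (sq p / p v - 1)) < \<eta>"
        using \<eta> unfolding tendsto_iff by blast
      moreover have "\<forall>\<^sub>F q in at p within ?C. 0 < q v" using tc[of v] pv by (rule order_tendstoD)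
      ultimately show ?thesis by eventually_elim simp
    qed
    \<comment> \<open>Here p v = 0 while sq p > 0. The inequality is the division-free form of M v <
      sq q / q v - 1 when q v > 0.\<close>
    have ev2: "\<forall>\<^sub>F q in at p within ?C. (M v + 1) * q v < sq q" if "v \<in> \<sigma> - supp p" for v
    proof -
      have "((\<lambda>q. sq q - (M v + 1) * q v) \<longlongrightarrow> sq p - (M v + 1) * p v) (at p within ?C)"
        by (intro tendsto_diff tendsto_mult tendsto_const tsq tc)
      moreover have "0 < sq p - (M v + 1) * p v" using that sqp by simp
      ultimately have "\<forall>\<^sub>F q in at p within ?C. 0 < sq q - (M v + 1) * q v" by (rule order_tendstoD)
      then show ?thesis by eventually_elim simp
    qed
    have "\<forall>\<^sub>F q in at p within ?C. \<forall>v\<in>supp p. 0 < q v \<and> dist (max 0 (sq q / q v - 1)) (max 0 (sq p / p v - 1)) < \<eta>"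
      by (intro eventually_ball_finite[OF supp_finite[OF p]] ballI ev1)
    moreover have "\<forall>\<^sub>F q in at p within ?C. \<forall>v\<in>\<sigma> - supp p. (M v + 1) * q v < sq q"
      by (intro eventually_ball_finite[OF finite_Diff[OF fs]] ballI ev2)
    moreover have "\<forall>\<^sub>F q in at p within ?C. q \<in> ?C"
      unfolding eventually_at_topological by blast
    ultimately show "\<forall>\<^sub>F q in at p within ?C. dist (F q) (F p) < e"
    proof eventually_elim
      case (elim q)
      note q = C(1)[OF elim(3)]
      have k: "\<bar>kap q v - kap p v\<bar> < \<eta>" "v \<in> supp q" if "v \<in> supp p" for v
        using elim(1) that unfolding kap_eq[OF elim(3)] kap_eq[OF pC] by (auto simp: dist_real_def)
      have "total q (F p) \<le> total p (F p) + \<eta>"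
      proof (rule total_le[OF q])
        fix v assume v: "v \<in> supp q"
        show "cost q v (F p) \<le> total p (F p) + \<eta>"
        proof (cases "v \<in> supp p")
          case True
          then show ?thesis using k(1)[OF True] cost_le_total[OF p True, of "F p"] by (simp add: cost_def)
        next
          case False
          then have lt: "(M v + 1) * q v < sq q" using elim(2) v C(2)[OF elim(3)] by blast
          have "0 < q v" using v realizationD(1)[OF q, of v] by simp
          then have "M v \<le> sq q / q v - 1" using lt by (simp add: field_simps)
          then have "M v \<le> kap q v" unfolding kap_eq[OF elim(3)] by simp
          then show ?thesis using \<eta> unfolding M_def cost_def by linarith
        qed
      qed
      moreover have "total p (F q) \<le> total q (F q) + \<eta>"
      proof (rule total_le[OF p])
        fix v assume v: "v \<in> supp p"
        show "cost p v (F q) \<le> total q (F q) + \<eta>"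
          using k[OF v] cost_le_total[OF q k(2)[OF v], of "F q"] by (simp add: cost_def)
      qed
      moreover have "total p (F p) + (dist (F q) (F p))\<^sup>2 / 2 \<le> total p (F q)"
        using F_minimum(2)[OF p F_minimum(1)[OF q]] .
      moreover have "total q (F q) \<le> total q (F p)"
        using F_minimum(2)[OF q F_minimum(1)[OF p]] zero_le_power2[of "dist (F p) (F q)"] by linarith
      ultimately have "(dist (F q) (F p))\<^sup>2 \<le> 4 * \<eta>" by linarith
      also have "\<dots> < e\<^sup>2" using e by (simp add: \<eta>_def)
      finally show "dist (F q) (F p) < e" using e by (meson less_imp_le power_less_imp_less_base)
    qed
  qed
qed

text \<open>The index set may be uncountable, but the partition of unity needs an enumeration.
  Properness makes Y a countable union of compact sets.\<close>

lemma countable_subcover: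
  obtains C where "countable C" "C \<subseteq> I" "\<And>y. y \<in> Y \<Longrightarrow> \<exists>v\<in>C. dist (cen v) y < rad v"
proof -
  obtain y0 where "y0 \<in> Y" using neY by blast
  have "\<exists>D. D \<subseteq> I \<and> finite D \<and> Y \<inter> cball y0 (real n) \<subseteq> (\<Union>v\<in>D. ball (cen v) (rad v))" for n :: nat
  proof -
    have "compact (Y \<inter> cball y0 (real n))" using clY by (intro compact_closed_bounded) auto
    moreover have "Y \<inter> cball y0 (real n) \<subseteq> (\<Union>v\<in>I. ball (cen v) (rad v))" using cover by auto
    ultimately obtain D where "D \<subseteq> I" "finite D" "Y \<inter> cball y0 (real n) \<subseteq> (\<Union>v\<in>D. ball (cen v) (rad v))"
      using compactE_image[of "Y \<inter> cball y0 (real n)" I "\<lambda>v. ball (cen v) (rad v)"] by auto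
    then show ?thesis by blast
  qed
  then obtain D where D: "\<And>n :: nat. D n \<subseteq> I" "\<And>n. finite (D n)"
    "\<And>n. Y \<inter> cball y0 (real n) \<subseteq> (\<Union>v\<in>D n. ball (cen v) (rad v))" by metis
  show ?thesis
  proof (rule that[of "\<Union>n. D n"])
    show "countable (\<Union>n. D n)" using D(2) by (simp add: countable_finite)
    show "(\<Union>n. D n) \<subseteq> I" using D(1) by blast
    fix y assume y: "y \<in> Y"
    obtain n :: nat where "dist y0 y \<le> real n" using real_arch_simple by blast
    then have "y \<in> (\<Union>v\<in>D n. ball (cen v) (rad v))" using D(3)[of n] y by (intro subsetD[OF D(3)]) simp
    then show "\<exists>v\<in>\<Union>n. D n. dist (cen v) y < rad v" by auto
  qed
qed

text \<open>The truncation at 1 bounds all hats uniformly, so that n times an earlier hat, once it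
  reaches 1, suppresses the weight with number n.\<close>

definition hat :: "'v \<Rightarrow> 'a \<Rightarrow> real" where
  "hat v y = min 1 (max 0 (rad v - dist (cen v) y))"

lemma hat_bounds: "0 \<le> hat v y" "hat v y \<le> 1" and hat_pos_iff: "0 < hat v y \<longleftrightarrow> dist (cen v) y < rad v"
  by (auto simp: hat_def)

lemma continuous_on_hat: "continuous_on A (hat v)"
  unfolding hat_def by (intro continuous_intros)

text \<open>Weights of a locally finite partition of unity for a countable cover: with hat functions
  \<open>g\<^sub>0, g\<^sub>1, \<dots>\<close> take \<open>max 0 (g\<^sub>n - n (g\<^sub>0 + \<dots> + g\<^sub>n\<^sub>-\<^sub>1))\<close>.\<close>

lemma partition_weights:
  obtains W :: "'a \<Rightarrow> 'v \<Rightarrow> real"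
  where "\<And>v A. continuous_on A (\<lambda>y. W y v)" "\<And>y v. 0 \<le> W y v"
    "\<And>y. y \<in> Y \<Longrightarrow> supp (W y) \<in> ncomplex" "\<And>y v. W y v \<noteq> 0 \<Longrightarrow> v \<in> I \<and> dist (cen v) y < rad v"
    "\<And>D. D \<subseteq> Y \<Longrightarrow> compact D \<Longrightarrow> \<exists>S. finite S \<and> (\<forall>y\<in>D. supp (W y) \<subseteq> S)"
proof -
  obtain C where C: "countable C" "C \<subseteq> I" "\<And>y. y \<in> Y \<Longrightarrow> \<exists>v\<in>C. dist (cen v) y < rad v"
    using countable_subcover by blast
  define num where "num = to_nat_on C"
  have inj: "inj_on num C" unfolding num_def using C(1) by (rule inj_on_to_nat_on)
  have finlt: "finite {u\<in>C. num u \<le> n}" for n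
  proof (rule finite_imageD)
    show "finite (num ` {u\<in>C. num u \<le> n})" by (rule finite_subset[of _ "{..n}"]) auto
    show "inj_on num {u\<in>C. num u \<le> n}" using inj by (rule inj_on_subset) auto
  qed
  have finless: "finite {u\<in>C. num u < n}" for n by (rule finite_subset[OF _ finlt[of n]]) auto
  define W where "W y v = (if v \<in> C then max 0 (hat v y - real (num v) * (\<Sum>u\<in>{u\<in>C. num u < num v}. hat u y)) else 0)"
    for y v
  have Wpos: "0 \<le> W y v" for y v by (simp add: W_def)
  have sum0: "0 \<le> (\<Sum>u\<in>{u\<in>C. num u < n}. hat u y)" for n y by (intro sum_nonneg hat_bounds)
  have Wne: "v \<in> C \<and> 0 < hat v y" if "W y v \<noteq> 0" for y v
  proof -
    have "0 \<le> real (num v) * (\<Sum>u\<in>{u\<in>C. num u < num v}. hat u y)" using sum0 by simp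
    then show ?thesis using that hat_bounds(1)[of v y] unfolding W_def by (auto split: if_splits simp: max_def)
  qed
  have Wzero: "W y v = 0" if N: "N \<in> C" "num N < num v" and d: "1 \<le> real (num v) * hat N y" for y v N
  proof (cases "v \<in> C")
    case True
    have "hat N y \<le> (\<Sum>u\<in>{u\<in>C. num u < num v}. hat u y)"
      using N finless by (intro member_le_sum hat_bounds) auto
    then have "real (num v) * hat N y \<le> real (num v) * (\<Sum>u\<in>{u\<in>C. num u < num v}. hat u y)"
      by (intro mult_left_mono) auto
    then show ?thesis using d hat_bounds(2)[of v y] by (simp add: W_def)
  qed (simp add: W_def)
  have locfin: "\<exists>S. finite S \<and> (\<forall>y\<in>D. supp (W y) \<subseteq> S)" if D: "D \<subseteq> Y" "compact D" for D
  proof -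
    have "\<exists>N. N \<in> C \<and> 0 < hat N y" if "y \<in> D" for y using C(3) D(1) that hat_pos_iff by blast
    then obtain N where N: "\<And>y. y \<in> D \<Longrightarrow> N y \<in> C" "\<And>y. y \<in> D \<Longrightarrow> 0 < hat (N y) y" by metis
    define O' where "O' y = {z. hat (N y) y / 2 < hat (N y) z}" for y
    have op: "open (O' y)" for y
      unfolding O'_def by (intro open_Collect_less continuous_on_const continuous_on_hat)
    have "D \<subseteq> (\<Union>y\<in>D. O' y)" using N(2) by (auto simp: O'_def)
    then obtain E where E: "E \<subseteq> D" "finite E" "D \<subseteq> (\<Union>y\<in>E. O' y)"
      using compactE_image[OF D(2), of D O'] op by blast
    \<comment> \<open>Near y the hat of N y exceeds half of its value at y. For numbers beyond 2
      divided by that value, the subtracted multiple reaches 1 and the weights vanish.\<close>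
    define S where "S y = {u\<in>C. num u \<le> num (N y) + nat \<lceil>2 / hat (N y) y\<rceil>}" for y
    have sub: "supp (W z) \<subseteq> S y" if y: "y \<in> E" and z: "z \<in> O' y" for y z
    proof
      fix v assume v: "v \<in> supp (W z)"
      have yD: "y \<in> D" using y E(1) by blast
      show "v \<in> S y"
      proof (rule ccontr)
        assume "v \<notin> S y"
        then have big: "num (N y) + nat \<lceil>2 / hat (N y) y\<rceil> < num v" using Wne[of z v] v by (auto simp: S_def)
        have h: "0 < hat (N y) y" using N(2)[OF yD] .
        have "2 / hat (N y) y \<le> real (nat \<lceil>2 / hat (N y) y\<rceil>)" by (rule real_nat_ceiling_ge)
        also have "\<dots> \<le> real (num v)" by (rule of_nat_mono) (use big in linarith)
        finally have "2 \<le> real (num v) * hat (N y) y" using h by (simp add: pos_divide_le_eq)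
        also have "\<dots> \<le> real (num v) * (2 * hat (N y) z)" using z by (intro mult_left_mono) (auto simp: O'_def)
        finally have "1 \<le> real (num v) * hat (N y) z" by simp
        then have "W z v = 0" using Wzero[OF N(1)[OF yD]] big by simp
        then show False using v by simp
      qed
    qed
    have "\<forall>z\<in>D. supp (W z) \<subseteq> (\<Union>y\<in>E. S y)"
    proof
      fix z assume "z \<in> D"
      then obtain y where y: "y \<in> E" "z \<in> O' y" using E(3) by auto
      show "supp (W z) \<subseteq> (\<Union>y\<in>E. S y)" using sub[OF y] UN_upper[OF y(1), of S] by (rule order_trans)
    qed
    moreover have "finite (\<Union>y\<in>E. S y)" unfolding S_def using E(2) finlt by blast
    ultimately show ?thesis by blast
  qed
  show ?thesis
  proof (rule that[of W])
    show "continuous_on A (\<lambda>y. W y v)" for v A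
    proof (cases "v \<in> C")
      case True
      then show ?thesis unfolding W_def
        by (simp, intro continuous_on_max continuous_on_const continuous_on_diff continuous_on_mult
            continuous_on_sum continuous_on_hat)
    qed (simp add: W_def)
    show "0 \<le> W y v" for y v by (rule Wpos)
    show in_ball: "v \<in> I \<and> dist (cen v) y < rad v" if "W y v \<noteq> 0" for y v
      using Wne[OF that] C(2) hat_pos_iff by blast
    show "\<exists>S. finite S \<and> (\<forall>y\<in>D. supp (W y) \<subseteq> S)" if "D \<subseteq> Y" "compact D" for D
      by (rule locfin[OF that])
    fix y assume y: "y \<in> Y"
    have "finite (supp (W y))" using locfin[of "{y}"] y finite_subset by auto
    moreover have "supp (W y) \<noteq> {}"
    proof -
      \<comment> \<open>Among the vertices with positive hat at y, the one with least number has
        nothing subtracted, so its weight is positive.\<close>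
      define V where "V = {v\<in>C. 0 < hat v y}"
      have "V \<noteq> {}" using C(3)[OF y] hat_pos_iff by (auto simp: V_def)
      then obtain v where v: "v \<in> V" "\<And>u. u \<in> V \<Longrightarrow> num v \<le> num u"
        using ex_has_least_nat[of "\<lambda>v. v \<in> V" _ num] by blast
      have "hat u y = 0" if "u \<in> C" "num u < num v" for u
      proof (rule ccontr)
        assume "hat u y \<noteq> 0"
        then have "u \<in> V" using that(1) hat_bounds(1)[of u y] by (simp add: V_def less_le)
        then show False using v(2)[of u] that(2) by simp
      qed
      then have "(\<Sum>u\<in>{u\<in>C. num u < num v}. hat u y) = 0" by (intro sum.neutral) auto
      then have "W y v = hat v y" using v(1) by (simp add: W_def V_def)
      moreover have "0 < hat v y" using v(1) by (simp add: V_def)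
      ultimately have "v \<in> supp (W y)" by simp
      then show ?thesis by blast
    qed
    moreover have "\<forall>v\<in>supp (W y). v \<in> I \<and> dist (cen v) y < rad v" using in_ball by simp
    ultimately show "supp (W y) \<in> ncomplex" unfolding ncomplex_def using y by blast
  qed
qed

lemma supp_union_in_ncomplex:
  assumes "y \<in> Y" "\<sigma> \<in> ncomplex" "\<tau> \<in> ncomplex" "\<And>v. v \<in> \<sigma> \<union> \<tau> \<Longrightarrow> dist (cen v) y < rad v"
  shows "\<sigma> \<union> \<tau> \<in> ncomplex"
  using assms unfolding ncomplex_def by blast

text \<open>The carrier of p and the support of the partition of unity at F p need not span a
  simplex together, so the identity is not directly contiguous to G. The intermediate map q keeps
  only those balls of the carrier that contain F p: its support is a face of the carrier, and its
  balls share the point F p with those of G.\<close>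

theorem fin_contractible_ncomplex: "fin_contractible ncomplex"
proof -
  note K = scomplex_ncomplex
  obtain W :: "'a \<Rightarrow> 'v \<Rightarrow> real"
    where W: "\<And>v A. continuous_on A (\<lambda>y. W y v)" "\<And>y v. 0 \<le> W y v"
      "\<And>y. y \<in> Y \<Longrightarrow> supp (W y) \<in> ncomplex" "\<And>y v. W y v \<noteq> 0 \<Longrightarrow> v \<in> I \<and> dist (cen v) y < rad v"
      "\<And>D. D \<subseteq> Y \<Longrightarrow> compact D \<Longrightarrow> \<exists>S. finite S \<and> (\<forall>y\<in>D. supp (W y) \<subseteq> S)"
    using partition_weights by blast
  obtain y0 where y0: "y0 \<in> Y" using neY by blast
  have Wmap: "fin_map ncomplex T (\<lambda>t. normalize (W (g t)))" "\<And>t. t \<in> T \<Longrightarrow> supp (normalize (W (g t))) = supp (W (g t))"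
    if g: "continuous_on T g" "g ` T \<subseteq> Y" "bounded (g ` T)" for T :: "'b::topological_space set" and g
  proof -
    have "compact (closure (g ` T))" using g(3) by (intro compact_closed_bounded) auto
    moreover have "closure (g ` T) \<subseteq> Y" using g(2) clY by (rule closure_minimal)
    ultimately obtain S where S: "finite S" "\<And>y. y \<in> closure (g ` T) \<Longrightarrow> supp (W y) \<subseteq> S" using W(5) by meson
    have S': "supp (W (g t)) \<subseteq> S" if "t \<in> T" for t
      using S(2)[OF subsetD[OF closure_subset imageI[OF that]]] .
    have c: "continuous_on T (\<lambda>t. W (g t) v)" for v
      using W(1)[where A = UNIV] g(1) by (rule continuous_on_compose2) auto
    have k: "supp (W (g t)) \<in> ncomplex" if "t \<in> T" for t using W(3) g(2) that by blast
    show "fin_map ncomplex T (\<lambda>t. normalize (W (g t)))"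
      by (rule fin_map_normalize(1)[OF K c W(2) k S(1) S'])
    show "supp (normalize (W (g t))) = supp (W (g t))" if "t \<in> T" for t
      using fin_map_normalize(2)[OF K c W(2) k S(1) S' that] .
  qed
  \<comment> \<open>On one simplex F stays within finitely many balls. Its image has compact closure
    in Y, where the partition of unity uses finitely many indices.\<close>
  have Fbdd: "\<exists>R. \<forall>p\<in>closed_simplex ncomplex \<sigma>. dist y0 (F p) \<le> R" if \<sigma>: "\<sigma> \<in> ncomplex" for \<sigma>
  proof -
    have "finite \<sigma>" using scomplex_finite[OF K \<sigma>] .
    then have "bounded (\<Union>v\<in>\<sigma>. ball (cen v) (rad v))" by (intro bounded_UN) auto
    then have "\<exists>R. \<forall>x\<in>(\<Union>v\<in>\<sigma>. ball (cen v) (rad v)). dist y0 x \<le> R"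
      by (simp only: bounded_any_center[of _ y0])
    then obtain R where R: "\<And>x. x \<in> (\<Union>v\<in>\<sigma>. ball (cen v) (rad v)) \<Longrightarrow> dist y0 x \<le> R" by blast
    have "dist y0 (F p) \<le> R" if p: "p \<in> closed_simplex ncomplex \<sigma>" for p
    proof -
      have pr: "p \<in> realization ncomplex" "supp p \<subseteq> \<sigma>" using p by (auto simp: closed_simplex_def)
      obtain v where "v \<in> supp p" "dist (cen v) (F p) < rad v" using F_in_ball[OF pr(1)] .
      then show ?thesis using pr(2) by (intro R) auto
    qed
    then show ?thesis by blast
  qed
  have FY: "F p \<in> Y" if "p \<in> closed_simplex ncomplex \<sigma>" for p \<sigma>
    using F_minimum(1) closed_simplex_sub_realization that by blast
  define w1 where "w1 p v = p v * max 0 ((rad v)\<^sup>2 - (dist (cen v) (F p))\<^sup>2)" for p :: "'v \<Rightarrow> real" and v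
  define q where "q p = normalize (w1 p)" for p
  define G where "G p = normalize (W (F p))" for p
  have w1sub: "supp (w1 p) \<subseteq> supp p" for p by (auto simp: w1_def)
  have w1K: "supp (w1 p) \<in> ncomplex" if p: "p \<in> realization ncomplex" for p
  proof -
    obtain v where v: "v \<in> supp p" "dist (cen v) (F p) < rad v" using F_in_ball[OF p] .
    then have "(dist (cen v) (F p))\<^sup>2 < (rad v)\<^sup>2" by (intro power_strict_mono) auto
    then have "v \<in> supp (w1 p)" using v(1) by (simp add: w1_def)
    then show ?thesis using scomplex_face[OF K realizationD(2)[OF p] w1sub] by blast
  qed
  have w1pos: "0 \<le> w1 p v" if "p \<in> closed_simplex ncomplex \<sigma>" for p v \<sigma>
    using realizationD(1)[OF subsetD[OF closed_simplex_sub_realization that], of v]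
    unfolding w1_def by simp
  have w1cont: "continuous_on (closed_simplex ncomplex \<sigma>) (\<lambda>p. w1 p v)" if "\<sigma> \<in> ncomplex" for v \<sigma>
    unfolding w1_def
    by (intro continuous_on_mult continuous_on_coord continuous_on_max continuous_on_diff
        continuous_on_const continuous_on_power continuous_on_dist continuous_on_F[OF that])
  have qmap: "fin_map ncomplex (closed_simplex ncomplex \<sigma>) q"
    "\<And>p. p \<in> closed_simplex ncomplex \<sigma> \<Longrightarrow> supp (q p) = supp (w1 p)" if \<sigma>: "\<sigma> \<in> ncomplex" for \<sigma>
  proof -
    have a: "supp (w1 p) \<in> ncomplex" "supp (w1 p) \<subseteq> \<sigma>" if "p \<in> closed_simplex ncomplex \<sigma>" for p
      using that w1K[of p] w1sub[of p] unfolding closed_simplex_def by blast+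
    show "fin_map ncomplex (closed_simplex ncomplex \<sigma>) q"
      unfolding q_def
      by (rule fin_map_normalize(1)[OF K w1cont[OF \<sigma>] w1pos a(1) scomplex_finite[OF K \<sigma>] a(2)])
    show "supp (q p) = supp (w1 p)" if "p \<in> closed_simplex ncomplex \<sigma>" for p
      unfolding q_def
      by (rule fin_map_normalize(2)[OF K w1cont[OF \<sigma>] w1pos a(1) scomplex_finite[OF K \<sigma>] a(2) that])
  qed
  have qsupp: "supp (q p) = supp (w1 p)" if "p \<in> realization ncomplex" for p
    using qmap(2) realization_in_closed_simplex[OF that] by blast
  have Gmap: "fin_map ncomplex (closed_simplex ncomplex \<sigma>) G"
    "\<And>p. p \<in> closed_simplex ncomplex \<sigma> \<Longrightarrow> supp (G p) = supp (W (F p))" if \<sigma>: "\<sigma> \<in> ncomplex" for \<sigma>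
  proof -
    have b: "bounded (F ` closed_simplex ncomplex \<sigma>)" using Fbdd[OF \<sigma>] unfolding bounded_def by blast
    have i: "F ` closed_simplex ncomplex \<sigma> \<subseteq> Y" using FY by blast
    show "fin_map ncomplex (closed_simplex ncomplex \<sigma>) G"
      unfolding G_def by (rule Wmap(1)[OF continuous_on_F[OF \<sigma>] i b])
    show "supp (G p) = supp (W (F p))" if "p \<in> closed_simplex ncomplex \<sigma>" for p
      unfolding G_def by (rule Wmap(2)[OF continuous_on_F[OF \<sigma>] i b that])
  qed
  have Gsupp: "supp (G p) = supp (W (F p))" if "p \<in> realization ncomplex" for p
    using Gmap(2) realization_in_closed_simplex[OF that] by blast
  have 1: "fin_htpy ncomplex (\<lambda>p. p) q"
  proof (rule fin_htpy_straight_line[OF K])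
    fix \<sigma> assume \<sigma>: "\<sigma> \<in> ncomplex"
    show "fin_map ncomplex (closed_simplex ncomplex \<sigma>) (\<lambda>p. p)"
      by (rule fin_mapI[OF continuous_on_coord _ scomplex_finite[OF K \<sigma>]]) (auto simp: closed_simplex_def)
    show "fin_map ncomplex (closed_simplex ncomplex \<sigma>) q" by (rule qmap(1)[OF \<sigma>])
  next
    fix p assume p: "p \<in> realization ncomplex"
    have "supp p \<union> supp (q p) = supp p" unfolding qsupp[OF p] using w1sub[of p] by blast
    then show "supp p \<union> supp (q p) \<in> ncomplex" using realizationD(2)[OF p] by simp
  qed
  have 2: "fin_htpy ncomplex q G"
  proof (rule fin_htpy_straight_line[OF K qmap(1) Gmap(1)])
    fix p assume p: "p \<in> realization ncomplex"
    have FpY: "F p \<in> Y" using F_minimum(1)[OF p] .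
    show "supp (q p) \<union> supp (G p) \<in> ncomplex"
      unfolding qsupp[OF p] Gsupp[OF p]
    proof (rule supp_union_in_ncomplex[OF FpY w1K[OF p] W(3)[OF FpY]])
      fix v assume "v \<in> supp (w1 p) \<union> supp (W (F p))"
      then consider "w1 p v \<noteq> 0" | "W (F p) v \<noteq> 0" by blast
      then show "dist (cen v) (F p) < rad v"
      proof cases
        case 1
        then have lt: "(dist (cen v) (F p))\<^sup>2 < (rad v)\<^sup>2" and v: "v \<in> supp p"
          by (auto simp: w1_def max_def split: if_splits)
        have "0 < rad v" using rad_pos v realizationD(2)[OF p] unfolding ncomplex_def by blast
        then show ?thesis using lt by (meson less_imp_le power_less_imp_less_base)
      qed (use W(4) in blast)
    qed
  qed
  have 3: "fin_htpy ncomplex G (\<lambda>p. normalize (W y0))"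
  proof -
    \<comment> \<open>Geodesic contraction of F p to y0. It does not leave a ball about y0
      containing the image of the simplex, so supports stay within a finite set.\<close>
    define g where "g = (\<lambda>x. w (F (snd x)) y0 (fst x))"
    have "fin_map ncomplex ({0..1} \<times> closed_simplex ncomplex \<sigma>) (\<lambda>x. normalize (W (g x)))" if \<sigma>: "\<sigma> \<in> ncomplex" for \<sigma>
    proof (rule Wmap(1))
      let ?T = "{0..1::real} \<times> closed_simplex ncomplex \<sigma>"
      have "continuous_on ?T (\<lambda>x. F (snd x))"
        by (rule continuous_on_compose2[OF continuous_on_F[OF \<sigma>] continuous_on_fst_snd(2)]) auto
      then have "continuous_on ?T (\<lambda>x. (fst x, F (snd x)))"
        by (intro continuous_on_Pair continuous_on_fst_snd)
      then have "continuous_on ?T (\<lambda>x. (\<lambda>(t, x). w x y0 t) (fst x, F (snd x)))"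
        by (rule continuous_on_compose2[OF continuous_on_w]) auto
      then show "continuous_on ?T g" by (simp add: g_def)
      show "g ` ?T \<subseteq> Y" using cconvexD[OF coY FY y0] by (auto simp: g_def)
      obtain R where R: "\<And>p. p \<in> closed_simplex ncomplex \<sigma> \<Longrightarrow> dist y0 (F p) \<le> R" using Fbdd[OF \<sigma>] by blast
      have "dist y0 (g x) \<le> R" if "x \<in> ?T" for x
      proof -
        have t: "0 \<le> fst x" "fst x \<le> 1" and s: "snd x \<in> closed_simplex ncomplex \<sigma>" using that by auto
        have "dist y0 (g x) = (1 - fst x) * dist (F (snd x)) y0" unfolding g_def by (rule dist_w_right[OF t])
        also have "\<dots> \<le> dist (F (snd x)) y0" using t by (simp add: mult_left_le_one_le)
        finally show ?thesis using R[OF s] by (simp add: dist_commute)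
      qed
      then show "bounded (g ` ?T)" unfolding bounded_def by blast
    qed
    then show ?thesis
      unfolding fin_htpy_def
      by (intro exI[of _ "\<lambda>x. normalize (W (g x))"]) (auto simp: g_def G_def)
  qed
  have "fin_map ncomplex {y0} (\<lambda>y. normalize (W y))"
    by (rule Wmap(1)) (use y0 in auto)
  then have "normalize (W y0) \<in> realization ncomplex" by (simp add: fin_map_def)
  then show ?thesis
    unfolding fin_contractible_def using fin_htpy_trans[OF fin_htpy_trans[OF 1 2] 3] by blast
qed

end

subsection \<open>Group actions\<close>

lemma finite_positive_lower_bound:
  assumes "finite (D :: real set)" "\<And>d. d \<in> D \<Longrightarrow> 0 < d"
  obtains \<delta> where "0 < \<delta>" "\<And>d. d \<in> D \<Longrightarrow> \<delta> \<le> d"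
proof
  \<comment> \<open>The added 1 covers the case of empty D.\<close>
  show "0 < Min (insert 1 D)" using assms by simp
  show "Min (insert 1 D) \<le> d" if "d \<in> D" for d using assms that by simp
qed

text \<open>The witness is the family of all good balls, invariant because goodness is.\<close>

lemma (in group) good_cover_exists:
  assumes one: "\<And>y. y \<in> Y \<Longrightarrow> act \<one> y = y"
    and mult: "\<And>g h y. g \<in> carrier G \<Longrightarrow> h \<in> carrier G \<Longrightarrow> y \<in> Y \<Longrightarrow> act (g \<otimes> h) y = act g (act h y)"
    and actY: "\<And>g y. g \<in> carrier G \<Longrightarrow> y \<in> Y \<Longrightarrow> act g y \<in> Y"
    and ballsY: "\<And>y r. y \<in> Y \<Longrightarrow> balls y r \<subseteq> Y"
    and img: "\<And>g y r. g \<in> carrier G \<Longrightarrow> y \<in> Y \<Longrightarrow> act g ` balls y r = balls (act g y) r"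
    and self: "\<And>y r. y \<in> Y \<Longrightarrow> 0 < r \<Longrightarrow> y \<in> balls y r"
    and small: "\<And>y. y \<in> Y \<Longrightarrow> \<exists>r>0. \<forall>g\<in>carrier G. act g ` balls y r \<inter> balls y r \<noteq> {} \<longrightarrow> act g ` balls y r = balls y r"
  shows "\<exists>U. good_cover G act Y balls U"
proof -
  define good where "good B \<longleftrightarrow> (\<forall>g\<in>carrier G. act g ` B \<inter> B \<noteq> {} \<longrightarrow> act g ` B = B)" for B
  define U where "U = {balls y r | y r. y \<in> Y \<and> 0 < r \<and> good (balls y r)}"
  have UY: "B \<subseteq> Y" if "B \<in> U" for B using that ballsY by (auto simp: U_def)
  have inU: "act g ` B \<in> U" if g: "g \<in> carrier G" and B: "B \<in> U" for g B
  proof -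
    obtain y r where y: "B = balls y r" "y \<in> Y" "0 < r" "good B" using B by (auto simp: U_def)
    have BY: "b \<in> Y" if "b \<in> B" for b using UY[OF B] that by blast
    have "good (act g ` B)"
      unfolding good_def
    proof (intro ballI impI)
      fix k assume k: "k \<in> carrier G" and ne: "act k ` act g ` B \<inter> act g ` B \<noteq> {}"
      \<comment> \<open>Goodness of the translate of B, tested with k, is goodness of B tested with
        the conjugate k'.\<close>
      define k' where "k' = inv g \<otimes> k \<otimes> g"
      have k': "k' \<in> carrier G" using g k by (simp add: k'_def)
      have "g \<otimes> k' = k \<otimes> g"
        using g k by (simp add: k'_def m_assoc[symmetric])
      then have conj: "act k (act g b) = act g (act k' b)" if "b \<in> B" for b
        using mult[OF g k' BY[OF that]] mult[OF k g BY[OF that]] by simp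
      obtain b b' where b: "b \<in> B" "b' \<in> B" "act k (act g b) = act g b'" using ne by blast
      have "act k' b = act (inv g) (act g (act k' b))"
        using mult[of "inv g" g "act k' b"] one[of "act k' b"] g k' actY BY b(1) by simp
      also have "\<dots> = act (inv g) (act g b')" using b(3) conj[OF b(1)] by simp
      also have "\<dots> = b'" using mult[of "inv g" g b'] one[of b'] g BY b(2) by simp
      finally have "act k' ` B \<inter> B \<noteq> {}" using b by blast
      then have "act k' ` B = B" using y(4) k' unfolding good_def by blast
      then have "act g ` act k' ` B = act g ` B" by simp
      moreover have "act k ` act g ` B = act g ` act k' ` B"
        unfolding image_image using conj by (rule image_cong[OF refl])
      ultimately show "act k ` act g ` B = act g ` B" by simp
    qed
    moreover have "act g ` B = balls (act g y) r" using img[OF g y(2), of r] y(1) by simp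
    ultimately show ?thesis unfolding U_def using y(3) actY[OF g y(2)]
      by (intro CollectI exI[of _ "act g y"] exI[of _ r]) simp
  qed
  have "good_cover G act Y balls U"
    unfolding good_cover_def
  proof (intro conjI ballI impI)
    show "U \<subseteq> {balls y r | y r. y \<in> Y \<and> 0 < r}" by (auto simp: U_def)
    show "\<Union> U = Y"
    proof
      show "\<Union> U \<subseteq> Y" using UY by blast
      show "Y \<subseteq> \<Union> U"
      proof
        fix y assume y: "y \<in> Y"
        obtain r where "r > 0" "good (balls y r)" using small[OF y] unfolding good_def by blast
        then have "balls y r \<in> U" using y by (auto simp: U_def)
        then show "y \<in> \<Union> U" using self[OF y \<open>r > 0\<close>] by blast
      qed
    qed
    fix g assume g: "g \<in> carrier G"
    show "(\<lambda>B. act g ` B) ` U = U"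
    proof
      show "(\<lambda>B. act g ` B) ` U \<subseteq> U" using inU[OF g] by blast
      show "U \<subseteq> (\<lambda>B. act g ` B) ` U"
      proof
        fix B assume B: "B \<in> U"
        have "act g (act (inv g) b) = b" if "b \<in> B" for b
          using mult[of g "inv g" b] one[of b] g UY[OF B] that by auto
        then have "act g ` act (inv g) ` B = B" by (auto simp: image_image)
        moreover have "act (inv g) ` B \<in> U" using inU[OF inv_closed[OF g] B] .
        ultimately show "B \<in> (\<lambda>B. act g ` B) ` U" by (metis image_eqI)
      qed
    qed
    fix B assume "B \<in> U" "act g ` B \<inter> B \<noteq> {}"
    then show "act g ` B = B" using g unfolding U_def good_def by blast
  qed
  then show ?thesis by blast
qed

locale cat0_action = hadamard w
  for w :: "'a::metric_space \<Rightarrow> 'a \<Rightarrow> real \<Rightarrow> 'a" +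
  fixes G :: "('g, 'm) monoid_scheme" (structure) and \<phi> :: "'g \<Rightarrow> 'a \<Rightarrow> 'a" and \<A> :: "'a set set"
  assumes ga: "group_action G (UNIV :: 'a set) \<phi>" and iso: "isometric_action G \<phi>"
    and proper_act: "proper_action G \<phi>" and semisimple: "semisimple_action G \<phi>"
    and well_behaved: "well_behaved_axes G \<phi> \<A>"

sublocale cat0_action \<subseteq> group G
  using ga unfolding group_action_def group_hom_def by blast

context cat0_action
begin

section \<open>The action on points and lines, and its discreteness\<close>

lemma act_mult: "g \<in> carrier G \<Longrightarrow> h \<in> carrier G \<Longrightarrow> \<phi> (g \<otimes> h) x = \<phi> g (\<phi> h x)"
  using group_action.composition_rule[OF ga, of x g h] by simp

lemma act_one: "\<phi> \<one> x = x"
  using group_action.id_eq_one[OF ga] by (metis restrict_apply' UNIV_I)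

lemma act_inv: "g \<in> carrier G \<Longrightarrow> \<phi> (inv g) (\<phi> g x) = x" "g \<in> carrier G \<Longrightarrow> \<phi> g (\<phi> (inv g) x) = x"
  using act_mult[of "inv g" g x] act_mult[of g "inv g" x] act_one by simp_all

lemma act_dist: "g \<in> carrier G \<Longrightarrow> dist (\<phi> g x) (\<phi> g y) = dist x y"
  using iso by (simp add: isometric_action_def)

lemma act_ball: "g \<in> carrier G \<Longrightarrow> \<phi> g ` ball x r = ball (\<phi> g x) r"
proof -
  assume g: "g \<in> carrier G"
  have "y \<in> \<phi> g ` ball x r" if "dist (\<phi> g x) y < r" for y
    using that act_dist[OF g, of x "\<phi> (inv g) y"] act_inv[OF g] by (intro image_eqI[of _ _ "\<phi> (inv g) y"]) auto
  then show ?thesis using act_dist[OF g] by auto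
qed

lemma act_image_mult: "g \<in> carrier G \<Longrightarrow> h \<in> carrier G \<Longrightarrow> \<phi> (g \<otimes> h) ` l = \<phi> g ` \<phi> h ` l"
  by (simp add: image_image act_mult)

lemma act_image_one: "\<phi> \<one> ` l = l"
  by (simp add: act_one)

lemma act_image_inv: "g \<in> carrier G \<Longrightarrow> \<phi> (inv g) ` \<phi> g ` l = l" "g \<in> carrier G \<Longrightarrow> \<phi> g ` \<phi> (inv g) ` l = l"
  by (simp_all add: image_image act_inv)

lemma act_geodesic_line: "g \<in> carrier G \<Longrightarrow> geodesic_line c \<Longrightarrow> geodesic_line (\<lambda>t. \<phi> g (c t))"
  by (simp add: geodesic_line_def act_dist)

lemma act_range: "\<phi> g ` range c = range (\<lambda>t. \<phi> g (c t))"
  by auto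

lemma act_lines:
  assumes "g \<in> carrier G" "l \<in> lines" shows "\<phi> g ` l \<in> lines"
proof -
  obtain c where c: "geodesic_line c" "l = range c" using assms(2) by (auto simp: lines_def)
  show ?thesis
    unfolding lines_def c(2) act_range using act_geodesic_line[OF assms(1) c(1)] by blast
qed

lemma line_dist_act:
  assumes "g \<in> carrier G" "l \<in> lines"
  shows "line_dist (\<phi> g ` l) (\<phi> g ` l') = line_dist l l'"
proof (rule order_antisym)
  show "line_dist (\<phi> g ` l) (\<phi> g ` l') \<le> line_dist l l'"
    using act_dist[OF assms(1)] assms(2) by (rule line_dist_isometry_le)
  have "line_dist (\<phi> (inv g) ` \<phi> g ` l) (\<phi> (inv g) ` \<phi> g ` l') \<le> line_dist (\<phi> g ` l) (\<phi> g ` l')"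
    using act_dist[OF inv_closed[OF assms(1)]] act_lines[OF assms] by (rule line_dist_isometry_le)
  then show "line_dist l l' \<le> line_dist (\<phi> g ` l) (\<phi> g ` l')" unfolding act_image_inv(1)[OF assms(1)] .
qed

text \<open>Properness of the action speaks about some small ball at each point. Elements carrying x
  into such a ball differ from one of them, g0, by elements that make the ball meet itself, so they
  are finitely many; compactness of closed balls extends this to every radius.\<close>

lemma finite_displacement: "finite {g \<in> carrier G. dist (\<phi> g x) y \<le> R}"
proof -
  have "\<exists>r>0. finite {g \<in> carrier G. \<phi> g x \<in> ball z r}" for z
  proof -
    obtain r where r: "r > 0" "finite {g\<in>carrier G. \<phi> g ` ball z r \<inter> ball z r \<noteq> {}}"
      using proper_act unfolding proper_action_def by blast
    have "finite {g \<in> carrier G. \<phi> g x \<in> ball z r}"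
    proof (cases "{g \<in> carrier G. \<phi> g x \<in> ball z r} = {}")
      case False
      then obtain g0 where g0: "g0 \<in> carrier G" "\<phi> g0 x \<in> ball z r" by blast
      have "{g \<in> carrier G. \<phi> g x \<in> ball z r} \<subseteq>
          (\<lambda>k. k \<otimes> g0) ` {g\<in>carrier G. \<phi> g ` ball z r \<inter> ball z r \<noteq> {}}"
      proof
        fix g assume "g \<in> {g \<in> carrier G. \<phi> g x \<in> ball z r}"
        then have g: "g \<in> carrier G" "\<phi> g x \<in> ball z r" by auto
        have k: "g \<otimes> inv g0 \<in> carrier G" using g g0 by simp
        have "\<phi> (g \<otimes> inv g0) (\<phi> g0 x) = \<phi> g x" using g g0 by (simp add: act_mult act_inv)
        then have "\<phi> g x \<in> \<phi> (g \<otimes> inv g0) ` ball z r \<inter> ball z r" using g(2) g0(2) by (metis IntI imageI)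
        moreover have "g = (g \<otimes> inv g0) \<otimes> g0" using g g0 by (simp add: m_assoc)
        ultimately show "g \<in> (\<lambda>k. k \<otimes> g0) ` {g\<in>carrier G. \<phi> g ` ball z r \<inter> ball z r \<noteq> {}}"
          using k by blast
      qed
      then show ?thesis using r(2) finite_surj by blast
    next
      case True
      show ?thesis unfolding True by simp
    qed
    then show ?thesis using r(1) by blast
  qed
  then obtain \<rho> where \<rho>: "\<And>z. \<rho> z > 0" "\<And>z. finite {g \<in> carrier G. \<phi> g x \<in> ball z (\<rho> z)}" by metis
  have "z \<in> (\<Union>z\<in>UNIV. ball z (\<rho> z))" for z by (rule UN_I[of z]) (simp_all add: \<rho>(1))
  then have "cball y R \<subseteq> (\<Union>z\<in>UNIV. ball z (\<rho> z))" by blast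
  then obtain E where E: "finite E" "cball y R \<subseteq> (\<Union>z\<in>E. ball z (\<rho> z))"
    using compactE_image[OF proper[of y R], of UNIV "\<lambda>z. ball z (\<rho> z)"] by auto
  have "{g \<in> carrier G. dist (\<phi> g x) y \<le> R} \<subseteq> (\<Union>z\<in>E. {g \<in> carrier G. \<phi> g x \<in> ball z (\<rho> z)})"
  proof
    fix g assume "g \<in> {g \<in> carrier G. dist (\<phi> g x) y \<le> R}"
    then have g: "g \<in> carrier G" "\<phi> g x \<in> cball y R" by (auto simp: dist_commute)
    then obtain z where "z \<in> E" "\<phi> g x \<in> ball z (\<rho> z)" using E(2) by blast
    then show "g \<in> (\<Union>z\<in>E. {g \<in> carrier G. \<phi> g x \<in> ball z (\<rho> z)})" using g(1) by blast
  qed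
  moreover have "finite (\<Union>z\<in>E. {g \<in> carrier G. \<phi> g x \<in> ball z (\<rho> z)})" using E(1) \<rho>(2) by (intro finite_UN_I)
  ultimately show ?thesis by (rule finite_subset)
qed

lemma A_axes: "l \<in> \<A> \<Longrightarrow> l \<in> axes G \<phi>" and A_closed: "lines_closed \<A>"
  and A_convex: "componentwise_convex \<A>"
  and A_meets: "l \<in> axes G \<phi> \<Longrightarrow> \<exists>l'\<in>\<A>. line_dist l l' < \<infinity>"
  using well_behaved unfolding well_behaved_axes_def by auto

lemma A_lines: "l \<in> \<A> \<Longrightarrow> l \<in> lines"
  using A_closed unfolding lines_closed_def by blast

lemma A_act: "g \<in> carrier G \<Longrightarrow> l \<in> \<A> \<Longrightarrow> \<phi> g ` l \<in> \<A>"
  using well_behaved unfolding well_behaved_axes_def by blast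

lemma shift_int_pow:
  fixes c :: "real \<Rightarrow> 'a" and a :: real
  assumes \<gamma>: "\<gamma> \<in> carrier G" and sh: "\<And>t. \<phi> \<gamma> (c t) = c (t + a)"
  shows "\<phi> (\<gamma> [^] (n::int)) (c t) = c (t + of_int n * a)"
proof -
  have nat: "\<phi> (\<gamma> [^] (k::nat)) (c t) = c (t + real k * a)" for k t
  proof (induction k arbitrary: t)
    case (Suc k)
    have "\<phi> (\<gamma> [^] Suc k) (c t) = \<phi> (\<gamma> [^] k) (\<phi> \<gamma> (c t))"
      using \<gamma> by (simp add: act_mult)
    also have "\<dots> = c (t + a + real k * a)" using sh Suc by simp
    finally show ?case by (simp add: algebra_simps)
  qed (simp add: act_one)
  show ?thesis
  proof (cases n)
    case (nonneg k)
    then show ?thesis using nat[of k t] by (simp add: int_pow_int)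
  next
    case (neg k)
    have n: "n = - int (Suc k)" using neg by simp
    have "\<gamma> [^] n = inv (\<gamma> [^] Suc k)" unfolding n using \<gamma> by (simp only: int_pow_neg int_pow_int)
    moreover have "\<phi> (\<gamma> [^] Suc k) (c (t - real (Suc k) * a)) = c t" using nat[of "Suc k"] by simp
    ultimately have "\<phi> (\<gamma> [^] n) (c t) = c (t - real (Suc k) * a)"
      using act_inv(1)[of "\<gamma> [^] Suc k" "c (t - real (Suc k) * a)"] \<gamma> by simp
    moreover have "t - real (Suc k) * a = t + of_int n * a" unfolding n by (simp add: algebra_simps)
    ultimately show ?thesis by (simp only:)
  qed
qed

lemma axisE:
  assumes "l \<in> axes G \<phi>"
  obtains c \<gamma> a where "geodesic_line c" "range c = l" "\<gamma> \<in> carrier G" "0 < a"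
    "\<And>(n::int) t. \<phi> (\<gamma> [^] n) (c t) = c (t + of_int n * a)" "\<And>n::int. \<phi> (\<gamma> [^] n) ` l = l"
proof -
  obtain \<gamma> c a where c: "\<gamma> \<in> carrier G" "geodesic_line c" "range c = l" "0 < a" "\<And>t. \<phi> \<gamma> (c t) = c (t + a)"
    using assms unfolding axes_def by blast
  have s: "\<phi> (\<gamma> [^] (n::int)) (c t) = c (t + of_int n * a)" for n t by (rule shift_int_pow[OF c(1), where c = c and a = a, OF c(5)])
  have "\<phi> (\<gamma> [^] (n::int)) ` l = l" for n
  proof -
    have "\<phi> (\<gamma> [^] n) ` l = range (\<lambda>t. c (1 * t + of_int n * a))" unfolding c(3)[symmetric] act_range s by simp
    also have "\<dots> = l" using range_affine[of 1 c] c(3) by simp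
    finally show ?thesis .
  qed
  then show ?thesis using that c s by blast
qed

lemma shift_into_period:
  assumes "0 < (a::real)"
  obtains n :: int where "0 \<le> s + of_int n * a" "s + of_int n * a \<le> a"
proof (rule that[of "- \<lfloor>s / a\<rfloor>"])
  have "of_int \<lfloor>s / a\<rfloor> \<le> s / a" "s / a \<le> of_int \<lfloor>s / a\<rfloor> + 1" by linarith+
  then have "of_int \<lfloor>s / a\<rfloor> * a \<le> s / a * a" "s / a * a \<le> (of_int \<lfloor>s / a\<rfloor> + 1) * a"
    using assms by (intro mult_right_mono; simp)+
  moreover have "s / a * a = s" using assms by simp
  ultimately have "of_int \<lfloor>s / a\<rfloor> * a \<le> s" "s \<le> (of_int \<lfloor>s / a\<rfloor> + 1) * a" by simp_all
  then show "0 \<le> s + of_int (- \<lfloor>s / a\<rfloor>) * a" "s + of_int (- \<lfloor>s / a\<rfloor>) * a \<le> a"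
    by (simp_all add: algebra_simps)
qed

text \<open>Translating along the axis \<open>l\<close> brings a point of \<open>h l'\<close> into a fixed ball without
  changing the distance from \<open>l\<close>, so properness leaves only finitely many distances.\<close>

lemma finite_line_dist_values:
  assumes l: "l \<in> axes G \<phi>" and l': "l' \<in> lines"
  shows "finite {line_dist l (\<phi> h ` l') | h. h \<in> carrier G \<and> line_dist l (\<phi> h ` l') \<le> ereal R}"
proof -
  obtain c \<gamma> a where c: "geodesic_line c" "range c = l" "\<gamma> \<in> carrier G" "0 < a"
    "\<And>(n::int) t. \<phi> (\<gamma> [^] n) (c t) = c (t + of_int n * a)" "\<And>n::int. \<phi> (\<gamma> [^] n) ` l = l"
    using axisE[OF l] by metis
  obtain x where x: "x \<in> l'" using l' by (auto simp: lines_def)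
  have llines: "l \<in> lines" using c by (auto simp: lines_def)
  have "{line_dist l (\<phi> h ` l') | h. h \<in> carrier G \<and> line_dist l (\<phi> h ` l') \<le> ereal R} \<subseteq>
      (\<lambda>h. line_dist l (\<phi> h ` l')) ` {h \<in> carrier G. dist (\<phi> h x) (c 0) \<le> R + a}"
  proof
    fix d assume "d \<in> {line_dist l (\<phi> h ` l') | h. h \<in> carrier G \<and> line_dist l (\<phi> h ` l') \<le> ereal R}"
    then obtain h where h: "h \<in> carrier G" "d = line_dist l (\<phi> h ` l')" "line_dist l (\<phi> h ` l') \<le> ereal R" by blast
    have "line_dist (range c) (\<phi> h ` l') < \<infinity>" using h(3) unfolding c(2) by (rule le_less_trans) simp
    then obtain c' where c': "sync c c'" "range c' = \<phi> h ` l'" using line_dist_finiteE c(1) by blast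
    have dR: "dist (c 0) (c' 0) \<le> R" using line_dist_sync[OF c'(1)] h(3) c(2) c'(2) by simp
    have "\<phi> h x \<in> range c'" using c'(2) x by blast
    then obtain s where s: "\<phi> h x = c' s" by blast
    obtain n :: int where n: "0 \<le> s + of_int n * a" "s + of_int n * a \<le> a" using shift_into_period[OF c(4)] .
    have gn: "\<gamma> [^] n \<in> carrier G" using c(3) by simp
    define k where "k = \<gamma> [^] n \<otimes> h"
    have k: "k \<in> carrier G" using gn h(1) by (simp add: k_def)
    have "dist (\<phi> k x) (\<phi> (\<gamma> [^] n) (c s)) = dist (c' s) (c s)"
      unfolding k_def act_mult[OF gn h(1)] act_dist[OF gn] s ..
    also have "\<dots> \<le> R" using dR sync_dist_eq[OF c'(1), of s] by (simp add: dist_commute)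
    finally have "dist (\<phi> k x) (c (s + of_int n * a)) \<le> R" unfolding c(5) .
    moreover have "dist (c (s + of_int n * a)) (c 0) \<le> a" using geodesic_line_dist[OF c(1)] n by simp
    ultimately have "dist (\<phi> k x) (c 0) \<le> R + a"
      using dist_triangle[of "\<phi> k x" "c 0" "c (s + of_int n * a)"] by linarith
    moreover have "line_dist l (\<phi> k ` l') = d"
    proof -
      have "line_dist (\<phi> (\<gamma> [^] n) ` l) (\<phi> (\<gamma> [^] n) ` \<phi> h ` l') = line_dist l (\<phi> h ` l')"
        by (rule line_dist_act[OF gn llines])
      then show ?thesis unfolding k_def act_image_mult[OF gn h(1)] c(6) h(2) .
    qed
    ultimately show "d \<in> (\<lambda>h. line_dist l (\<phi> h ` l')) ` {h \<in> carrier G. dist (\<phi> h x) (c 0) \<le> R + a}"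
      using k by blast
  qed
  then show ?thesis using finite_displacement[of x "c 0" "R + a"] finite_surj by blast
qed

text \<open>The positive displacements of x up to 1 are finitely many and so have a lower bound
  \<delta> > 0. If a ball of radius r with 2 r <= min 1 \<delta> meets its translate, the centre
  moves by less than \<delta> and is therefore fixed.\<close>

lemma good_cover_points: "\<exists>\<U>. good_cover G \<phi> UNIV ball \<U>"
proof (rule good_cover_exists)
  fix x :: 'a
  define D where "D = (\<lambda>g. dist (\<phi> g x) x) ` {g \<in> carrier G. dist (\<phi> g x) x \<le> 1 \<and> \<phi> g x \<noteq> x}"
  have "finite D" unfolding D_def
    by (intro finite_imageI finite_subset[OF _ finite_displacement[of x x 1]]) auto
  moreover have "0 < d" if "d \<in> D" for d using that by (auto simp: D_def)
  ultimately obtain \<delta> where \<delta>: "0 < \<delta>" "\<And>d. d \<in> D \<Longrightarrow> \<delta> \<le> d" using finite_positive_lower_bound by blast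
  define r where "r = min 1 \<delta> / 2"
  have r: "0 < r" "2 * r \<le> 1" "2 * r \<le> \<delta>" using \<delta>(1) by (auto simp: r_def)
  have "\<phi> g ` ball x r = ball x r" if g: "g \<in> carrier G" and ne: "\<phi> g ` ball x r \<inter> ball x r \<noteq> {}" for g
  proof -
    obtain z where "dist (\<phi> g x) z < r" "dist x z < r" using ne unfolding act_ball[OF g] by auto
    then have lt: "dist (\<phi> g x) x < 2 * r" using dist_triangle2[of "\<phi> g x" x z] by linarith
    have "\<phi> g x = x"
    proof (rule ccontr)
      assume "\<phi> g x \<noteq> x"
      then have "dist (\<phi> g x) x \<in> D" unfolding D_def using g lt r(2) by auto
      then show False using \<delta>(2) lt r(3) by fastforce
    qed
    then show ?thesis unfolding act_ball[OF g] by simp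
  qed
  then show "\<exists>r>0. \<forall>g\<in>carrier G. \<phi> g ` ball x r \<inter> ball x r \<noteq> {} \<longrightarrow> \<phi> g ` ball x r = ball x r"
    using r(1) by blast
qed (simp_all add: act_one act_mult act_ball)

lemma act_line_ball:
  assumes g: "g \<in> carrier G" and l: "l \<in> \<A>"
  shows "(\<lambda>l. \<phi> g ` l) ` line_ball \<A> l r = line_ball \<A> (\<phi> g ` l) r"
proof
  show "(\<lambda>l. \<phi> g ` l) ` line_ball \<A> l r \<subseteq> line_ball \<A> (\<phi> g ` l) r"
    using A_act[OF g] line_dist_act[OF g A_lines[OF l]] by (auto simp: line_ball_def)
  show "line_ball \<A> (\<phi> g ` l) r \<subseteq> (\<lambda>l. \<phi> g ` l) ` line_ball \<A> l r"
  proof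
    fix m assume "m \<in> line_ball \<A> (\<phi> g ` l) r"
    then have m: "m \<in> \<A>" "line_dist (\<phi> g ` l) m < ereal r" by (auto simp: line_ball_def)
    have m': "m = \<phi> g ` \<phi> (inv g) ` m" using act_image_inv(2)[OF g] by simp
    have "line_dist l (\<phi> (inv g) ` m) = line_dist (\<phi> g ` l) m"
      using line_dist_act[OF g A_lines[OF l], of "\<phi> (inv g) ` m"] unfolding m'[symmetric] by simp
    then have "\<phi> (inv g) ` m \<in> line_ball \<A> l r" using m A_act[OF inv_closed[OF g]] by (simp add: line_ball_def)
    then show "m \<in> (\<lambda>l. \<phi> g ` l) ` line_ball \<A> l r" using m' by blast
  qed
qed

text \<open>Infinitely many elements may slide l along itself, so the action on lines is not proper.
  Sliding does not show in the distance of lines, however, and discreteness of the distances from l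
  to its translates suffices.\<close>

lemma good_cover_lines: "\<exists>\<V>. good_cover G (\<lambda>g l. \<phi> g ` l) \<A> (line_ball \<A>) \<V>"
proof (rule good_cover_exists)
  fix l assume l: "l \<in> \<A>"
  \<comment> \<open>The value 0 belongs to elements preserving l and is removed; distances up to 1
    are finite, so passing to reals loses nothing.\<close>
  define D where "D = real_of_ereal ` ({line_dist l (\<phi> h ` l) | h. h \<in> carrier G \<and> line_dist l (\<phi> h ` l) \<le> ereal 1} - {0})"
  have "finite D" unfolding D_def
    using finite_line_dist_values[OF A_axes[OF l] A_lines[OF l], of 1] by blast
  moreover have "0 < d" if "d \<in> D" for d
  proof -
    obtain e where e: "d = real_of_ereal e" "e \<noteq> 0" "e \<le> ereal 1" "\<exists>h. e = line_dist l (\<phi> h ` l)"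
      using \<open>d \<in> D\<close> unfolding D_def by auto
    have "0 \<le> e" using e(4) unfolding line_dist_def
      by (elim exE) (simp only:, rule Inf_greatest, auto simp: flat_strip_def)
    then show ?thesis using e(1-3) by (cases e) auto
  qed
  ultimately obtain \<delta> where \<delta>: "0 < \<delta>" "\<And>d. d \<in> D \<Longrightarrow> \<delta> \<le> d" using finite_positive_lower_bound by blast
  define r where "r = min 1 \<delta> / 2"
  have r: "0 < r" "2 * r \<le> 1" "2 * r \<le> \<delta>" using \<delta>(1) by (auto simp: r_def)
  have "(\<lambda>l. \<phi> g ` l) ` line_ball \<A> l r = line_ball \<A> l r"
    if g: "g \<in> carrier G" and ne: "(\<lambda>l. \<phi> g ` l) ` line_ball \<A> l r \<inter> line_ball \<A> l r \<noteq> {}" for g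
  proof -
    have gl: "\<phi> g ` l \<in> lines" using act_lines[OF g A_lines[OF l]] .
    obtain m where m: "m \<in> \<A>" "line_dist (\<phi> g ` l) m < ereal r" "line_dist l m < ereal r"
      using ne unfolding act_line_ball[OF g l] by (auto simp: line_ball_def)
    have "line_dist l (\<phi> g ` l) \<le> line_dist l m + line_dist m (\<phi> g ` l)"
      by (rule line_dist_triangle[OF A_lines[OF l]])
    also have "line_dist m (\<phi> g ` l) = line_dist (\<phi> g ` l) m"
      by (rule line_dist_commute[OF gl A_lines[OF m(1)]])
    also have "line_dist l m + line_dist (\<phi> g ` l) m < ereal r + ereal r"
      by (rule ereal_add_strict_mono2[OF m(3,2)])
    finally have lt: "line_dist l (\<phi> g ` l) < ereal (2 * r)" by simp
    have "line_dist l (\<phi> g ` l) = 0"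
    proof (rule ccontr)
      assume n0: "line_dist l (\<phi> g ` l) \<noteq> 0"
      have "line_dist l (\<phi> g ` l) \<le> ereal 1"
        using lt r(2) by (meson ereal_less_eq(3) less_imp_le order_trans)
      then have "real_of_ereal (line_dist l (\<phi> g ` l)) \<in> D" unfolding D_def using n0 g by blast
      then have "\<delta> \<le> real_of_ereal (line_dist l (\<phi> g ` l))" by (rule \<delta>(2))
      moreover have "0 \<le> line_dist l (\<phi> g ` l)"
        unfolding line_dist_def by (rule Inf_greatest) (auto simp: flat_strip_def)
      ultimately show False using lt r(3) by (cases "line_dist l (\<phi> g ` l)") auto
    qed
    then have "l = \<phi> g ` l" using line_dist_zeroD A_lines[OF l] by blast
    then show ?thesis using act_line_ball[OF g l, of r] by simp
  qed
  then show "\<exists>r>0. \<forall>g\<in>carrier G. (\<lambda>l. \<phi> g ` l) ` line_ball \<A> l r \<inter> line_ball \<A> l r \<noteq> {} \<longrightarrow>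
      (\<lambda>l. \<phi> g ` l) ` line_ball \<A> l r = line_ball \<A> l r"
    using r(1) by blast
next
  show "l \<in> line_ball \<A> l r" if "l \<in> \<A>" "0 < r" for l r
    using that line_dist_self[OF A_lines[OF that(1)]] by (simp add: line_ball_def zero_ereal_def)
  show "line_ball \<A> l r \<subseteq> \<A>" for l r by (auto simp: line_ball_def)
qed (simp_all add: act_image_one act_image_mult A_act act_line_ball)

end

lemma finite_image_factor:
  assumes "finite (g ` H)" "\<And>h k. h \<in> H \<Longrightarrow> k \<in> H \<Longrightarrow> g h = g k \<Longrightarrow> f h = f k"
  shows "finite (f ` H)"
proof -
  have eq: "f h = f (SOME k. k \<in> H \<and> g k = g h)" if "h \<in> H" for h
  proof -
    have "(SOME k. k \<in> H \<and> g k = g h) \<in> H \<and> g (SOME k. k \<in> H \<and> g k = g h) = g h"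
      by (rule someI[of "\<lambda>k. k \<in> H \<and> g k = g h" h]) (simp add: that)
    then show ?thesis by (intro assms(2)[OF that]) simp_all
  qed
  have "f ` H \<subseteq> (\<lambda>C. f (SOME k. k \<in> H \<and> g k = C)) ` g ` H"
  proof
    fix y assume "y \<in> f ` H"
    then obtain h where h: "h \<in> H" "y = f h" by blast
    show "y \<in> (\<lambda>C. f (SOME k. k \<in> H \<and> g k = C)) ` g ` H"
      unfolding h(2) by (rule image_eqI[of _ _ "g h"]) (use eq[OF h(1)] h(1) in auto)
  qed
  then show ?thesis using assms(1) finite_surj by blast
qed

lemma finite_ereal_bound:
  assumes "finite V" "\<And>v. v \<in> V \<Longrightarrow> v < (\<infinity>::ereal)"
  obtains R where "\<And>v. v \<in> V \<Longrightarrow> v \<le> ereal R"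
proof -
  have "v \<le> ereal (Max (insert 0 (real_of_ereal ` V)))" if "v \<in> V" for v
  proof -
    have "real_of_ereal v \<le> Max (insert 0 (real_of_ereal ` V))" using assms(1) that by (intro Max_ge) auto
    then show ?thesis using assms(2)[OF that] by (cases v) auto
  qed
  then show ?thesis using that by blast
qed

context hadamard
begin

lemma line_dist_finite_trans:
  assumes "l1 \<in> (lines :: 'a set set)" "line_dist l1 l2 < \<infinity>" "line_dist l2 l3 < \<infinity>"
  shows "line_dist l1 l3 < \<infinity>"
proof -
  obtain c1 where c1: "geodesic_line c1" "l1 = range c1" using assms(1) by (auto simp: lines_def)
  obtain c2 where c2: "sync c1 c2" "range c2 = l2" using line_dist_finiteE[of c1 l2] assms(2) c1 by blast
  obtain c3 where c3: "sync c2 c3" "range c3 = l3"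
    using line_dist_finiteE[of c2 l3] assms(3) c2 sync_lines(2) by blast
  show ?thesis using line_dist_sync[OF sync_trans[OF c2(1) c3(1)]] c1 c3 by simp
qed

lemma bounded_lines_line_dist_finite:
  fixes c c' :: "real \<Rightarrow> 'a"
  assumes "geodesic_line c" "geodesic_line c'" "\<And>t. dist (c t) (c' t) \<le> M"
  shows "line_dist (range c) (range c') < \<infinity>"
proof -
  obtain a where a: "sync c (\<lambda>t. c' (t + a))" using bounded_lines_imp_sync[OF assms] .
  have "range (\<lambda>t. c' (t + a)) = range c'" using range_affine[of 1 c' a] by simp
  then show ?thesis using line_dist_sync[OF a] by simp
qed

end

context cat0_action
begin

section \<open>Fixed points and invariant lines of subgroups\<close>

lemma subgroup_carrier: "subgroup H G \<Longrightarrow> h \<in> H \<Longrightarrow> h \<in> carrier G"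
  using subgroup.subset by blast

text \<open>An invariant ball contains the orbits of its points, so displacements are bounded and
  properness applies. An infinite subgroup thus preserves no vertex of the first nerve.\<close>

lemma finite_if_invariant_ball:
  assumes H: "subgroup H G" and z: "z \<in> ball x r" and inv: "\<And>h. h \<in> H \<Longrightarrow> \<phi> h ` ball x r = ball x r"
  shows "finite H"
proof -
  have "H \<subseteq> {g \<in> carrier G. dist (\<phi> g z) x \<le> r}"
  proof
    fix h assume h: "h \<in> H"
    have "\<phi> h z \<in> ball x r" using inv[OF h] z by blast
    then show "h \<in> {g \<in> carrier G. dist (\<phi> g z) x \<le> r}"
      using subgroup_carrier[OF H h] by (simp add: dist_commute)
  qed
  then show ?thesis using finite_displacement finite_subset by blast
qed

text \<open>The point is the circumcenter of the orbit of z. A finite orbit inside an open ball lies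
  in a closed ball of smaller radius about the same centre, and this secures membership of the
  circumcenter in the open one.\<close>

lemma fixed_point_in_balls:
  assumes H: "subgroup H G" and finH: "finite H" and z: "\<And>B. B \<in> \<sigma> \<Longrightarrow> z \<in> B"
    and inv: "\<And>B h. B \<in> \<sigma> \<Longrightarrow> h \<in> H \<Longrightarrow> \<phi> h ` B = B"
    and balls: "\<And>B. B \<in> \<sigma> \<Longrightarrow> \<exists>x r. B = ball x r"
  obtains y where "\<And>h. h \<in> H \<Longrightarrow> \<phi> h y = y" "\<And>B. B \<in> \<sigma> \<Longrightarrow> y \<in> B"
proof -
  note Hc = subgroup_carrier[OF H]
  define S where "S = (\<lambda>h. \<phi> h z) ` H"
  have SB: "S \<subseteq> B" if "B \<in> \<sigma>" for B
    unfolding S_def using inv[OF that] z[OF that] by blast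
  have finS: "finite S" using finH by (simp add: S_def)
  have neS: "S \<noteq> {}" using subgroup.one_closed[OF H] by (auto simp: S_def)
  have cv: "cconvex (UNIV :: 'a set)" by (simp add: cconvex_def)
  show ?thesis
  proof (rule circumcenter[OF closed_UNIV cv subset_UNIV neS finite_imp_bounded[OF finS]])
    fix y
    assume y: "\<And>k r. k \<in> UNIV \<Longrightarrow> S \<subseteq> cball k r \<Longrightarrow> dist k y \<le> r"
      "\<And>f. f ` UNIV = UNIV \<Longrightarrow> f ` S = S \<Longrightarrow> (\<And>x y. x \<in> UNIV \<Longrightarrow> y \<in> UNIV \<Longrightarrow> dist (f x) (f y) = dist x y) \<Longrightarrow> f y = y"
    show ?thesis
    proof (rule that)
      fix h assume h: "h \<in> H"
      have "\<phi> h ` UNIV = UNIV" using act_inv(2)[OF Hc[OF h]] by (metis surj_def)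
      moreover have "\<phi> h ` S = S"
      proof
        show "\<phi> h ` S \<subseteq> S"
        proof
          fix x assume "x \<in> \<phi> h ` S"
          then obtain k where k: "k \<in> H" "x = \<phi> h (\<phi> k z)" by (auto simp: S_def)
          then have "x = \<phi> (h \<otimes> k) z" using act_mult Hc h by simp
          then show "x \<in> S" using subgroup.m_closed[OF H h k(1)] by (auto simp: S_def)
        qed
        show "S \<subseteq> \<phi> h ` S"
        proof
          fix x assume "x \<in> S"
          then obtain k where k: "k \<in> H" "x = \<phi> k z" by (auto simp: S_def)
          have ih: "inv h \<in> H" using subgroup.m_inv_closed[OF H h] .
          have "\<phi> (inv h \<otimes> k) z \<in> S" using subgroup.m_closed[OF H ih k(1)] by (auto simp: S_def)
          moreover have "x = \<phi> h (\<phi> (inv h \<otimes> k) z)"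
            using act_mult[OF Hc[OF ih] Hc[OF k(1)]] act_inv(2)[OF Hc[OF h]] k(2) by simp
          ultimately show "x \<in> \<phi> h ` S" by blast
        qed
      qed
      ultimately show "\<phi> h y = y" by (rule y(2)) (rule act_dist[OF Hc[OF h]])
    next
      fix B assume B: "B \<in> \<sigma>"
      obtain x r where xr: "B = ball x r" using balls[OF B] by blast
      define r' where "r' = Max (dist x ` S)"
      have "r' \<in> dist x ` S" unfolding r'_def using finS neS by (intro Max_in) auto
      then have "r' < r" using SB[OF B] xr by auto
      moreover have "S \<subseteq> cball x r'" unfolding r'_def using finS by auto
      then have "dist x y \<le> r'" by (rule y(1)[OF UNIV_I])
      ultimately show "y \<in> B" using xr by simp
    qed
  qed
qed

text \<open>The circumcenter argument in a cross-section. The map f induced by h sends the base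
  point of a line to the base point of its image, parametrized in sync with c0; in general it is not
  \<phi> h. It is an isometry since distances of base points are distances of lines. Invariance of S
  keeps h in the component of l0.\<close>

lemma fixed_line:
  assumes H: "subgroup H G" and S: "S \<subseteq> \<A>" "S \<noteq> {}" "\<And>h l. h \<in> H \<Longrightarrow> l \<in> S \<Longrightarrow> \<phi> h ` l \<in> S"
    and l0: "l0 \<in> lines" and R: "\<And>l. l \<in> S \<Longrightarrow> line_dist l0 l \<le> ereal R"
  obtains m where "m \<in> \<A>" "\<And>h. h \<in> H \<Longrightarrow> \<phi> h ` m = m"
    "\<And>k \<rho>. k \<in> \<A> \<Longrightarrow> (\<And>l. l \<in> S \<Longrightarrow> line_dist k l \<le> ereal \<rho>) \<Longrightarrow> line_dist k m \<le> ereal \<rho>"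
proof -
  note Hc = subgroup_carrier[OF H]
  obtain c0 where c0: "geodesic_line c0" "l0 = range c0" using l0 by (auto simp: lines_def)
  have par: "\<exists>c. sync c0 c \<and> range c = l" if "line_dist l0 l < \<infinity>" for l
    using line_dist_finiteE[of c0 l] that c0 by blast
  have fin: "line_dist l0 (range c) < \<infinity>" if "sync c0 c" for c
    using line_dist_sync[OF that] c0(2) by simp
  have Sfin: "line_dist l0 l < \<infinity>" if "l \<in> S" for l using R[OF that] by (rule le_less_trans) simp
  obtain s0 where s0: "s0 \<in> S" using S(2) by blast
  have s0l: "s0 \<in> lines" using s0 S(1) A_lines by blast
  have comp: "line_dist l0 (\<phi> h ` l) < \<infinity>" if h: "h \<in> H" and l: "line_dist l0 l < \<infinity>" for h l
  proof -
    have "line_dist s0 l0 < \<infinity>" using line_dist_finite_sym[OF Sfin[OF s0] l0] Sfin[OF s0] by simp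
    then have "line_dist s0 l < \<infinity>" using line_dist_finite_trans[OF s0l] l by blast
    then have "line_dist (\<phi> h ` s0) (\<phi> h ` l) < \<infinity>" using line_dist_act[OF Hc[OF h] s0l] by simp
    moreover have "line_dist l0 (\<phi> h ` s0) < \<infinity>" using Sfin[OF S(3)[OF h s0]] .
    ultimately show ?thesis using line_dist_finite_trans[OF l0] by blast
  qed
  define Y where "Y = cross_section c0 \<A>"
  define S' where "S' = cross_section c0 S"
  have "closed Y" "cconvex Y"
    unfolding Y_def using closed_cross_section[OF A_closed] cconvex_cross_section[OF A_convex] .
  moreover have "S' \<subseteq> Y" unfolding S'_def Y_def cross_section_def using S(1) by blast
  moreover have "S' \<noteq> {}" unfolding S'_def cross_section_def using par[OF Sfin[OF s0]] s0 by blast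
  moreover have "bounded S'"
  proof -
    have "dist (c0 0) x \<le> R" if x: "x \<in> S'" for x
    proof -
      obtain c where c: "x = c 0" "sync c0 c" "range c \<in> S" using x unfolding S'_def cross_section_def by blast
      then show ?thesis using line_dist_sync[OF c(2)] R[OF c(3)] c0(2) by simp
    qed
    then show ?thesis unfolding bounded_def by blast
  qed
  ultimately obtain z where z: "z \<in> Y" "\<And>k r. k \<in> Y \<Longrightarrow> S' \<subseteq> cball k r \<Longrightarrow> dist k z \<le> r"
    "\<And>f. f ` Y = Y \<Longrightarrow> f ` S' = S' \<Longrightarrow> (\<And>x y. x \<in> Y \<Longrightarrow> y \<in> Y \<Longrightarrow> dist (f x) (f y) = dist x y) \<Longrightarrow> f z = z"
    using circumcenter[of Y S'] by blast
  obtain cz where cz: "z = cz 0" "sync c0 cz" "range cz \<in> \<A>" using z(1) unfolding Y_def cross_section_def by blast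
  show ?thesis
  proof (rule that[OF cz(3)])
    fix h assume h: "h \<in> H"
    have ih: "inv h \<in> H" using subgroup.m_inv_closed[OF H h] .
    have push: "\<exists>c'. sync c0 c' \<and> range c' = \<phi> k ` range c" if "sync c0 c" "k \<in> H" for c k
      using par[OF comp[OF that(2) fin[OF that(1)]]] .
    have "\<forall>x\<in>Y. \<exists>y. \<exists>c c'. x = c 0 \<and> y = c' 0 \<and> sync c0 c \<and> sync c0 c' \<and> range c' = \<phi> h ` range c"
    proof
      fix x assume "x \<in> Y"
      then obtain c where c: "x = c 0" "sync c0 c" unfolding Y_def cross_section_def by blast
      obtain c' where "sync c0 c'" "range c' = \<phi> h ` range c" using push[OF c(2) h] by blast
      then show "\<exists>y. \<exists>c c'. x = c 0 \<and> y = c' 0 \<and> sync c0 c \<and> sync c0 c' \<and> range c' = \<phi> h ` range c"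
        using c by blast
    qed
    from bchoice[OF this] obtain f where
      f: "\<forall>x\<in>Y. \<exists>c c'. x = c 0 \<and> f x = c' 0 \<and> sync c0 c \<and> sync c0 c' \<and> range c' = \<phi> h ` range c" ..
    have feq: "f (c 0) = c' 0" if c: "sync c0 c" "range c \<in> \<A>" "sync c0 c'" "range c' = \<phi> h ` range c" for c c'
    proof -
      have "c 0 \<in> Y" unfolding Y_def cross_section_def using c by blast
      then obtain d d' where d: "c 0 = d 0" "f (c 0) = d' 0" "sync c0 d" "sync c0 d'" "range d' = \<phi> h ` range d"
        using f by blast
      have "c = d" using cross_section_inj[OF c(1) d(3) d(1)] .
      then have "range d' = range c'" using d(5) c(4) by simp
      then have "d' = c'" using cross_section_inj_range[OF d(4) c(3)] by blast
      then show ?thesis using d(2) by simp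
    qed
    have img: "f ` cross_section c0 T = cross_section c0 T"
      if T: "T \<subseteq> \<A>" "\<And>k l. k \<in> H \<Longrightarrow> l \<in> T \<Longrightarrow> \<phi> k ` l \<in> T" for T
    proof
      show "f ` cross_section c0 T \<subseteq> cross_section c0 T"
      proof
        fix y assume "y \<in> f ` cross_section c0 T"
        then obtain c where c: "y = f (c 0)" "sync c0 c" "range c \<in> T" unfolding cross_section_def by blast
        obtain c' where c': "sync c0 c'" "range c' = \<phi> h ` range c" using push[OF c(2) h] by blast
        have "y = c' 0" using feq[OF c(2) _ c'] c(1,3) T(1) by blast
        moreover have "range c' \<in> T" using c'(2) T(2)[OF h c(3)] by simp
        ultimately show "y \<in> cross_section c0 T" unfolding cross_section_def using c'(1) by blast
      qed
      show "cross_section c0 T \<subseteq> f ` cross_section c0 T"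
      proof
        fix y assume "y \<in> cross_section c0 T"
        then obtain d where d: "y = d 0" "sync c0 d" "range d \<in> T" unfolding cross_section_def by blast
        obtain c where c: "sync c0 c" "range c = \<phi> (inv h) ` range d" using push[OF d(2) ih] by blast
        have cT: "range c \<in> T" using c(2) T(2)[OF ih d(3)] by simp
        have "range d = \<phi> h ` range c" unfolding c(2) using act_image_inv(2)[OF Hc[OF h]] by simp
        then have "f (c 0) = y" using feq[OF c(1) _ d(2)] cT T(1) d(1) by blast
        moreover have "c 0 \<in> cross_section c0 T" unfolding cross_section_def using c(1) cT by blast
        ultimately show "y \<in> f ` cross_section c0 T" by blast
      qed
    qed
    have "dist (f x) (f y) = dist x y" if xy: "x \<in> Y" "y \<in> Y" for x y
    proof -
      obtain c c' where c: "x = c 0" "f x = c' 0" "sync c0 c" "sync c0 c'" "range c' = \<phi> h ` range c" using f xy(1) by blast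
      obtain d d' where d: "y = d 0" "f y = d' 0" "sync c0 d" "sync c0 d'" "range d' = \<phi> h ` range d" using f xy(2) by blast
      have "range c \<in> lines" using sync_lines(2)[OF c(3)] by (auto simp: lines_def)
      then have "line_dist (range c') (range d') = line_dist (range c) (range d)"
        unfolding c(5) d(5) by (rule line_dist_act[OF Hc[OF h]])
      then show ?thesis
        unfolding cross_section_line_dist[OF c(4) d(4)] cross_section_line_dist[OF c(3) d(3)] c(2) d(2) by (simp add: c(1) d(1))
    qed
    moreover have "f ` Y = Y" unfolding Y_def using img[of \<A>] A_act Hc by blast
    moreover have "f ` S' = S'" unfolding S'_def using img[OF S(1,3)] by blast
    ultimately have fz: "f z = z" using z(3) by blast
    obtain c' where c': "sync c0 c'" "range c' = \<phi> h ` range cz" using push[OF cz(2) h] by blast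
    have "c' 0 = cz 0" using feq[OF cz(2,3) c'] fz cz(1) by simp
    then have "c' = cz" using cross_section_inj[OF c'(1) cz(2)] by blast
    then show "\<phi> h ` range cz = range cz" using c'(2) by simp
  next
    fix k \<rho> assume k: "k \<in> \<A>" and b: "\<And>l. l \<in> S \<Longrightarrow> line_dist k l \<le> ereal \<rho>"
    have kl: "k \<in> lines" using A_lines[OF k] .
    have "line_dist k s0 < \<infinity>" using b[OF s0] by (rule le_less_trans) simp
    then have "line_dist s0 k < \<infinity>" using line_dist_finite_sym[OF _ kl] by simp
    then have "line_dist l0 k < \<infinity>" using line_dist_finite_trans[OF l0 Sfin[OF s0]] by blast
    then obtain ck where ck: "sync c0 ck" "range ck = k" using par by blast
    have "ck 0 \<in> Y" unfolding Y_def cross_section_def using ck k by blast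
    moreover have "S' \<subseteq> cball (ck 0) \<rho>"
    proof
      fix x assume "x \<in> S'"
      then obtain c where c: "x = c 0" "sync c0 c" "range c \<in> S" unfolding S'_def cross_section_def by blast
      then show "x \<in> cball (ck 0) \<rho>"
        using cross_section_line_dist[OF ck(1) c(2)] b[OF c(3)] ck(2) by simp
    qed
    ultimately have "dist (ck 0) z \<le> \<rho>" by (rule z(2))
    then show "line_dist k (range cz) \<le> ereal \<rho>"
      using cross_section_line_dist[OF ck(1) cz(2)] ck(2) cz(1) by simp
  qed
qed

section \<open>Translations, stabilizers of lines and virtually cyclic subgroups\<close>

lemma reverse_shift:
  assumes "geodesic_line c" "\<And>t. \<phi> \<gamma> (c t) = c (t + a)" "a \<noteq> 0"
  obtains d where "geodesic_line d" "range d = range c" "\<And>t. \<phi> \<gamma> (d t) = d (t + \<bar>a\<bar>)"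
proof (cases "a > 0")
  case True
  then show ?thesis using that[of c] assms by simp
next
  case False
  show ?thesis
  proof (rule that[of "\<lambda>t. c (- 1 * t + 0)"])
    show "geodesic_line (\<lambda>t. c (- 1 * t + 0))" using geodesic_line_affine[OF assms(1), of "-1" 0] by simp
    show "range (\<lambda>t. c (- 1 * t + 0)) = range c" using range_affine[of "-1" c 0] by simp
    fix t
    have "- 1 * t + 0 + a = - 1 * (t + \<bar>a\<bar>) + 0" using False by simp
    then show "\<phi> \<gamma> (c (- 1 * t + 0)) = c (- 1 * (t + \<bar>a\<bar>) + 0)" unfolding assms(2) by (simp only:)
  qed
qed

text \<open>Orient both lines along \<gamma>. After n steps the images of d 0 and d' 0 are still at
  distance D, so n |a| and n |b| differ by at most 2 D for every n, and the translation lengths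
  agree. The distance at equal times is then periodic, hence bounded.\<close>

lemma translations_parallel:
  assumes \<gamma>: "\<gamma> \<in> carrier G" and c: "geodesic_line c" "\<And>t. \<phi> \<gamma> (c t) = c (t + a)" "a \<noteq> 0"
    and c': "geodesic_line c'" "\<And>t. \<phi> \<gamma> (c' t) = c' (t + b)" "b \<noteq> 0"
  shows "line_dist (range c) (range c') < \<infinity>"
proof -
  obtain d where d: "geodesic_line d" "range d = range c" "\<And>t. \<phi> \<gamma> (d t) = d (t + \<bar>a\<bar>)"
    using reverse_shift[OF c] by blast
  obtain d' where d': "geodesic_line d'" "range d' = range c'" "\<And>t. \<phi> \<gamma> (d' t) = d' (t + \<bar>b\<bar>)"
    using reverse_shift[OF c'] by blast
  define D where "D = dist (d 0) (d' 0)"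
  have pd: "\<phi> (\<gamma> [^] (n::int)) (d t) = d (t + of_int n * \<bar>a\<bar>)" for n t
    by (rule shift_int_pow[OF \<gamma>, where c = d and a = "\<bar>a\<bar>", OF d(3)])
  have pd': "\<phi> (\<gamma> [^] (n::int)) (d' t) = d' (t + of_int n * \<bar>b\<bar>)" for n t
    by (rule shift_int_pow[OF \<gamma>, where c = d' and a = "\<bar>b\<bar>", OF d'(3)])
  have gn: "\<gamma> [^] (n::int) \<in> carrier G" for n using \<gamma> by simp
  have ab: "\<bar>a\<bar> = \<bar>b\<bar>"
  proof (rule ccontr)
    assume ne: "\<bar>a\<bar> \<noteq> \<bar>b\<bar>"
    obtain n :: nat where n: "2 * D / \<bar>\<bar>a\<bar> - \<bar>b\<bar>\<bar> < real n" using reals_Archimedean2 by blast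
    have "dist (d (real n * \<bar>a\<bar>)) (d' (real n * \<bar>b\<bar>)) = D"
      using act_dist[OF gn[of "int n"], of "d 0" "d' 0"] unfolding pd pd' D_def by simp
    moreover have "dist (d 0) (d (real n * \<bar>a\<bar>)) = real n * \<bar>a\<bar>" "dist (d' 0) (d' (real n * \<bar>b\<bar>)) = real n * \<bar>b\<bar>"
      using geodesic_line_dist[OF d(1)] geodesic_line_dist[OF d'(1)] by (simp_all add: abs_mult)
    moreover have "dist (d 0) (d (real n * \<bar>a\<bar>)) \<le> dist (d 0) (d' 0) + dist (d' 0) (d' (real n * \<bar>b\<bar>)) + dist (d' (real n * \<bar>b\<bar>)) (d (real n * \<bar>a\<bar>))"
      by (meson add_right_mono dist_triangle order_trans)
    moreover have "dist (d' 0) (d' (real n * \<bar>b\<bar>)) \<le> dist (d' 0) (d 0) + dist (d 0) (d (real n * \<bar>a\<bar>)) + dist (d (real n * \<bar>a\<bar>)) (d' (real n * \<bar>b\<bar>))"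
      by (meson add_right_mono dist_triangle order_trans)
    ultimately have "\<bar>real n * \<bar>a\<bar> - real n * \<bar>b\<bar>\<bar> \<le> 2 * D"
      unfolding D_def by (simp add: dist_commute abs_le_iff)
    moreover have "real n * \<bar>a\<bar> - real n * \<bar>b\<bar> = real n * (\<bar>a\<bar> - \<bar>b\<bar>)" by (simp add: algebra_simps)
    ultimately have "real n * \<bar>\<bar>a\<bar> - \<bar>b\<bar>\<bar> \<le> 2 * D" by (simp add: abs_mult)
    moreover have "2 * D < real n * \<bar>\<bar>a\<bar> - \<bar>b\<bar>\<bar>" using n ne by (simp add: pos_divide_less_eq)
    ultimately show False by simp
  qed
  have "dist (d t) (d' t) \<le> D + 2 * \<bar>a\<bar>" for t
  proof -
    obtain n :: int where n: "0 \<le> t + of_int n * \<bar>a\<bar>" "t + of_int n * \<bar>a\<bar> \<le> \<bar>a\<bar>"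
      using shift_into_period[of "\<bar>a\<bar>" t] c(3) by auto
    define s where "s = t + of_int n * \<bar>a\<bar>"
    have "dist (d t) (d' t) = dist (d s) (d' s)"
      using act_dist[OF gn[of n], of "d t" "d' t"] unfolding pd pd' ab[symmetric] s_def by simp
    also have "\<dots> \<le> dist (d s) (d 0) + dist (d 0) (d' 0) + dist (d' 0) (d' s)"
      by (meson add_right_mono dist_triangle order_trans)
    also have "dist (d s) (d 0) \<le> \<bar>a\<bar>" using geodesic_line_dist[OF d(1), of s 0] n by (simp add: s_def)
    also have "dist (d' 0) (d' s) \<le> \<bar>a\<bar>" using geodesic_line_dist[OF d'(1), of 0 s] n by (simp add: s_def)
    finally show ?thesis by (simp add: D_def)
  qed
  then have "line_dist (range d) (range d') < \<infinity>" by (rule bounded_lines_line_dist_finite[OF d(1) d'(1)])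
  then show ?thesis unfolding d(2) d'(2) .
qed

lemma line_stabilizerE:
  assumes g: "g \<in> carrier G" and c: "geodesic_line c" "\<phi> g ` range c = range c"
  obtains e b where "\<bar>e\<bar> = 1" "\<And>t. \<phi> g (c t) = c (e * t + b)"
proof -
  have "range (\<lambda>t. \<phi> g (c t)) \<subseteq> range c" using c(2) unfolding act_range by simp
  then show ?thesis using geodesic_line_reparam[OF c(1) act_geodesic_line[OF g c(1)]] that by blast
qed

text \<open>A reflection of the line would fix c (b / 2), and a shift by 0 would fix c 0.\<close>

lemma line_stabilizer_translation:
  assumes g: "g \<in> carrier G" and c: "geodesic_line c" "\<phi> g ` range c = range c" and nf: "\<And>y. \<phi> g y \<noteq> y"
  obtains b where "b \<noteq> 0" "\<And>t. \<phi> g (c t) = c (t + b)"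
proof -
  obtain e b where eb: "\<bar>e\<bar> = 1" "\<And>t. \<phi> g (c t) = c (e * t + b)" using line_stabilizerE[OF g c] by blast
  have "e \<noteq> -1"
  proof
    assume "e = -1"
    then have "\<phi> g (c (b / 2)) = c (b / 2)" using eb(2)[of "b / 2"] by simp
    then show False using nf by blast
  qed
  then have e: "e = 1" using eb(1) by linarith
  have "b \<noteq> 0"
  proof
    assume "b = 0"
    then have "\<phi> g (c 0) = c 0" using eb(2)[of 0] by simp
    then show False using nf by blast
  qed
  then show ?thesis using that eb(2) e by simp
qed

lemma generate_pow_mem: "x \<in> carrier G \<Longrightarrow> x [^] (n::int) \<in> generate G {x}"
  using generate_pow[of x] by blast

lemma virtually_cyclic_finite:
  assumes "subgroup H G" "finite H" shows "virtually_cyclic G H"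
  unfolding virtually_cyclic_def using assms subgroup.one_closed by blast

text \<open>If some x in H translates the line by b, every coset of the group it generates has a
  representative moving c 0 by at most |b|, and these are finitely many. Otherwise H moves the line
  only by reflections; the product of two is a translation by twice the distance of their centres,
  so all centres agree, c 0 has bounded orbit and H is finite.\<close>

lemma virtually_cyclic_if_fixes_line:
  assumes H: "subgroup H G" and c: "geodesic_line c" and stab: "\<And>h. h \<in> H \<Longrightarrow> \<phi> h ` range c = range c"
  shows "virtually_cyclic G H"
proof (cases "\<exists>x\<in>H. \<exists>b. b \<noteq> 0 \<and> (\<forall>t. \<phi> x (c t) = c (t + b))")
  case True
  note Hc = subgroup_carrier[OF H]
  obtain x b where x: "x \<in> H" "b \<noteq> 0" "\<And>t. \<phi> x (c t) = c (t + b)" using True by blast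
  have xc: "x \<in> carrier G" using Hc[OF x(1)] .
  have sg: "subgroup (generate G {x}) G" using xc by (intro generate_is_subgroup) simp
  have "(\<lambda>h. generate G {x} #> h) ` H \<subseteq> (\<lambda>h. generate G {x} #> h) ` {k \<in> carrier G. dist (\<phi> k (c 0)) (c 0) \<le> \<bar>b\<bar>}"
  proof
    fix C assume "C \<in> (\<lambda>h. generate G {x} #> h) ` H"
    then obtain h where h: "h \<in> H" "C = generate G {x} #> h" by blast
    have "\<phi> h (c 0) \<in> range c" using stab[OF h(1)] by blast
    then obtain s where s: "\<phi> h (c 0) = c s" by blast
    obtain n :: int where n: "0 \<le> s + of_int n * \<bar>b\<bar>" "s + of_int n * \<bar>b\<bar> \<le> \<bar>b\<bar>"
      using shift_into_period[of "\<bar>b\<bar>" s] x(2) by auto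
    \<comment> \<open>The sign adapts the exponent to the direction in which x translates.\<close>
    define n' where "n' = (if b > 0 then n else - n)"
    have n': "of_int n' * b = of_int n * \<bar>b\<bar>" using x(2) by (simp add: n'_def)
    define k where "k = x [^] n' \<otimes> h"
    have xn: "x [^] n' \<in> carrier G" using xc by simp
    have k: "k \<in> carrier G" using xn Hc[OF h(1)] by (simp add: k_def)
    have "\<phi> k (c 0) = c (s + of_int n * \<bar>b\<bar>)"
      unfolding k_def act_mult[OF xn Hc[OF h(1)]] s n'[symmetric]
      by (rule shift_int_pow[OF xc, where c = c and a = b, OF x(3)])
    then have "dist (\<phi> k (c 0)) (c 0) \<le> \<bar>b\<bar>" using geodesic_line_dist[OF c] n by simp
    moreover have "k \<in> generate G {x} #> h" unfolding k_def r_coset_def using generate_pow_mem[OF xc] by blast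
    then have "generate G {x} #> h = generate G {x} #> k" using repr_independence Hc[OF h(1)] sg by blast
    ultimately show "C \<in> (\<lambda>h. generate G {x} #> h) ` {k \<in> carrier G. dist (\<phi> k (c 0)) (c 0) \<le> \<bar>b\<bar>}"
      using h(2) k by blast
  qed
  then have "finite ((\<lambda>h. generate G {x} #> h) ` H)"
    using finite_displacement[of "c 0" "c 0" "\<bar>b\<bar>"] finite_subset by blast
  then show ?thesis unfolding virtually_cyclic_def using H x(1) by blast
next
  case False
  note Hc = subgroup_carrier[OF H]
  define refl where "refl h b \<longleftrightarrow> (\<forall>t. \<phi> h (c t) = c (- t + b))" for h b
  have cinj: "s = t" if "c s = c t" for s t using geodesic_line_dist[OF c, of s t] that by simp
  have cases: "\<phi> h (c 0) = c 0 \<or> (\<exists>b. refl h b)" if h: "h \<in> H" for h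
  proof -
    obtain e b where eb: "\<bar>e\<bar> = 1" "\<And>t. \<phi> h (c t) = c (e * t + b)" using line_stabilizerE[OF Hc[OF h] c stab[OF h]] by blast
    consider "e = 1" | "e = -1" using eb(1) by linarith
    then show ?thesis
    proof cases
      case 1
      then have "\<forall>t. \<phi> h (c t) = c (t + b)" using eb(2) by simp
      then have "b = 0" using False h by blast
      then show ?thesis using eb(2)[of 0] by simp
    next
      case 2
      then have "refl h b" using eb(2) by (simp add: refl_def)
      then show ?thesis by blast
    qed
  qed
  have same: "b = b'" if h: "h \<in> H" "refl h b" and h': "h' \<in> H" "refl h' b'" for h h' b b'
  proof -
    have "\<phi> (h \<otimes> h') (c t) = c (t + (b - b'))" for t
      using h(2) h'(2) unfolding act_mult[OF Hc[OF h(1)] Hc[OF h'(1)]] refl_def by (simp add: algebra_simps)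
    moreover have "h \<otimes> h' \<in> H" using subgroup.m_closed[OF H h(1) h'(1)] .
    ultimately have "\<not> b - b' \<noteq> 0" using False by blast
    then show ?thesis by simp
  qed
  \<comment> \<open>The common parameter of all reflections in H; 0 is the default when there are
    none.\<close>
  obtain \<beta> where \<beta>: "\<And>h b. h \<in> H \<Longrightarrow> refl h b \<Longrightarrow> b = \<beta>"
  proof (cases "\<exists>h b. h \<in> H \<and> refl h b")
    case True
    then obtain h0 b0 where "h0 \<in> H" "refl h0 b0" by blast
    then show ?thesis using that[of b0] same by blast
  next
    case False
    then show ?thesis using that[of 0] by blast
  qed
  have "H \<subseteq> {g \<in> carrier G. dist (\<phi> g (c 0)) (c 0) \<le> \<bar>\<beta>\<bar>}"
  proof
    fix h assume h: "h \<in> H"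
    have "dist (\<phi> h (c 0)) (c 0) \<le> \<bar>\<beta>\<bar>"
    proof (cases "\<phi> h (c 0) = c 0")
      case True
      then show ?thesis by simp
    next
      case False
      then obtain b where "refl h b" using cases[OF h] by blast
      then have "\<phi> h (c 0) = c \<beta>" using \<beta>[OF h] unfolding refl_def by (metis add_0 minus_zero)
      then show ?thesis using geodesic_line_dist[OF c, of \<beta> 0] by simp
    qed
    then show "h \<in> {g \<in> carrier G. dist (\<phi> g (c 0)) (c 0) \<le> \<bar>\<beta>\<bar>}" using Hc[OF h] by simp
  qed
  then have "finite H" using finite_displacement finite_subset by blast
  then show ?thesis using virtually_cyclic_finite[OF H] by blast
qed

text \<open>An x with a fixed point generates a finite group by properness, and finitely many cosets
  of it would make H finite.\<close>

lemma infinite_virtually_cyclic_generator: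
  assumes H: "subgroup H G" "infinite H" and x: "x \<in> H" "finite ((\<lambda>h. generate G {x} #> h) ` H)"
  shows "\<phi> x y \<noteq> y"
proof
  assume fixy: "\<phi> x y = y"
  note Hc = subgroup_carrier[OF H(1)]
  have xc: "x \<in> carrier G" using Hc[OF x(1)] .
  have gc: "generate G {x} \<subseteq> carrier G" using xc by (intro generate_incl) simp
  have "\<phi> g y = y" if "g \<in> generate G {x}" for g
    using that
  proof (induction rule: generate.induct)
    case one then show ?case by (rule act_one)
  next
    case (incl h) then show ?case using fixy by simp
  next
    case (inv h) then show ?case using act_inv(1)[OF xc, of y] fixy by simp
  next
    case (eng h1 h2)
    have "h1 \<in> carrier G" "h2 \<in> carrier G" using eng.hyps gc by blast+
    then show ?case using eng.IH by (simp add: act_mult)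
  qed
  then have "generate G {x} \<subseteq> {g \<in> carrier G. dist (\<phi> g y) y \<le> 0}" using gc by auto
  then have fin: "finite (generate G {x})" using finite_displacement finite_subset by blast
  have "H \<subseteq> \<Union>((\<lambda>h. generate G {x} #> h) ` H)"
  proof
    fix h assume h: "h \<in> H"
    have "\<one> \<otimes> h \<in> generate G {x} #> h" unfolding r_coset_def using generate.one[of G "{x}"] by blast
    then show "h \<in> \<Union>((\<lambda>h. generate G {x} #> h) ` H)" using h Hc[OF h] by auto
  qed
  moreover have "finite (\<Union>((\<lambda>h. generate G {x} #> h) ` H))"
  proof (rule finite_Union[OF x(2)])
    fix C assume "C \<in> (\<lambda>h. generate G {x} #> h) ` H"
    then obtain h where "C = generate G {x} #> h" by blast
    then show "finite C" using fin unfolding r_coset_def by simp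
  qed
  ultimately show False using H(2) finite_subset by blast
qed

text \<open>The generator x of a finite-index subgroup has no fixed point, so by semisimplicity it
  translates an axis l. Every h in H moves l to a parallel line. The distances from l to the
  H-translates of a parallel line l' in \<open>\<A>\<close> depend only on cosets, so the orbit of
  l' is bounded and has an invariant circumcenter. Invariant lines are parallel because x translates
  each of them.\<close>

lemma infinite_virtually_cyclic_fixed_lines:
  assumes vc: "virtually_cyclic G H" and inf: "infinite H"
  shows "\<exists>m\<in>\<A>. \<forall>h\<in>H. \<phi> h ` m = m"
    "\<And>m m'. \<lbrakk>m \<in> lines; m' \<in> lines; \<forall>h\<in>H. \<phi> h ` m = m; \<forall>h\<in>H. \<phi> h ` m' = m'\<rbrakk> \<Longrightarrow> line_dist m m' < \<infinity>"
proof -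
  have H: "subgroup H G" using vc by (simp add: virtually_cyclic_def)
  note Hc = subgroup_carrier[OF H]
  obtain x where x: "x \<in> H" "finite ((\<lambda>h. generate G {x} #> h) ` H)" using vc unfolding virtually_cyclic_def by blast
  have xc: "x \<in> carrier G" using Hc[OF x(1)] .
  have nf: "\<phi> x y \<noteq> y" for y by (rule infinite_virtually_cyclic_generator[OF H inf x])
  show "line_dist m m' < \<infinity>" if m: "m \<in> lines" "m' \<in> lines" "\<forall>h\<in>H. \<phi> h ` m = m" "\<forall>h\<in>H. \<phi> h ` m' = m'" for m m'
  proof -
    obtain c where c: "geodesic_line c" "m = range c" using m(1) by (auto simp: lines_def)
    obtain c' where c': "geodesic_line c'" "m' = range c'" using m(2) by (auto simp: lines_def)
    have "\<phi> x ` range c = range c" "\<phi> x ` range c' = range c'" using m(3,4) x(1) c c' by auto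
    then obtain a b where a: "a \<noteq> 0" "\<And>t. \<phi> x (c t) = c (t + a)" and b: "b \<noteq> 0" "\<And>t. \<phi> x (c' t) = c' (t + b)"
      using line_stabilizer_translation[OF xc c(1) _ nf] line_stabilizer_translation[OF xc c'(1) _ nf] by metis
    show ?thesis unfolding c(2) c'(2) by (rule translations_parallel[OF xc c(1) a(2,1) c'(1) b(2,1)])
  qed
  obtain c1 a1 where "geodesic_line c1" "\<And>t. \<phi> x (c1 t) = c1 (t + a1)"
    using semisimple xc nf unfolding semisimple_action_def by blast
  moreover have "a1 \<noteq> 0" using calculation(2)[of 0] nf[of "c1 0"] by auto
  ultimately obtain c a where c: "geodesic_line c" "\<And>t. \<phi> x (c t) = c (t + a)" and a: "0 < a"
    using reverse_shift by (metis zero_less_abs_iff)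
  define l where "l = range c"
  have "l \<in> axes G \<phi>" unfolding axes_def l_def lines_def using c a xc by blast
  then obtain l' where l': "l' \<in> \<A>" "line_dist l l' < \<infinity>" using A_meets by blast
  have ll: "l \<in> lines" unfolding l_def lines_def using c(1) by blast
  have l'l: "l' \<in> lines" using A_lines[OF l'(1)] .
  have pow: "\<phi> (x [^] (n::int)) (c t) = c (t + of_int n * a)" for n t
    by (rule shift_int_pow[OF xc, where c = c and a = a, OF c(2)])
  have powl: "\<phi> (x [^] (n::int)) ` l = l" for n
  proof -
    have "\<phi> (x [^] n) ` l = range (\<lambda>t. c (1 * t + of_int n * a))" unfolding l_def act_range pow by simp
    also have "\<dots> = l" unfolding l_def by (rule range_affine) simp
    finally show ?thesis .
  qed
  have xpow: "x [^] (n::int) \<in> carrier G" for n using xc by simp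
  have gen: "generate G {x} = {x [^] (k::int) | k. k \<in> UNIV}" using generate_pow[OF xc] .
  have sg: "subgroup (generate G {x}) G" using xc by (intro generate_is_subgroup) simp
  have comp: "line_dist l (\<phi> h ` l) < \<infinity>" if h: "h \<in> H" for h
  proof -
    have hc: "h \<in> carrier G" using Hc[OF h] .
    \<comment> \<open>Pigeonhole on the cosets of h x^i: two of them coincide, so h x^j = x^k h x^i.
      Hence x^k translates the image of c under h by (j - i) a; it also translates c, and the two
      lines are parallel.\<close>
    define f where "f i = generate G {x} #> (h \<otimes> x [^] int i)" for i :: nat
    have xH: "x [^] (n::int) \<in> H" for n
      using subgroup_int_pow_closed[OF H x(1)] .
    have "range f \<subseteq> (\<lambda>h. generate G {x} #> h) ` H"
      unfolding f_def using subgroup.m_closed[OF H h xH] by blast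
    then have "finite (range f)" using x(2) finite_subset by blast
    then have "\<not> inj f" using finite_imageD infinite_UNIV_nat by blast
    then obtain i j where ij: "i \<noteq> j" "f i = f j" by (auto simp: inj_def)
    have "h \<otimes> x [^] int j \<in> f j"
      using rcos_self[OF _ sg, of "h \<otimes> x [^] int j"] hc xpow unfolding f_def by simp
    then have "h \<otimes> x [^] int j \<in> generate G {x} #> (h \<otimes> x [^] int i)" using ij(2) unfolding f_def by simp
    then obtain k :: int where k: "h \<otimes> x [^] int j = x [^] k \<otimes> (h \<otimes> x [^] int i)"
      unfolding r_coset_def gen by blast
    define d where "d t = \<phi> h (c t)" for t
    have dg: "geodesic_line d" unfolding d_def by (rule act_geodesic_line[OF hc c(1)])
    define b where "b = (real j - real i) * a"
    have b0: "b \<noteq> 0" using ij(1) a by (simp add: b_def)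
    have dsh: "\<phi> (x [^] k) (d t) = d (t + b)" for t
    proof -
      have "\<phi> (x [^] k \<otimes> (h \<otimes> x [^] int i)) (c (t - real i * a)) = \<phi> (x [^] k) (d t)"
        using hc xpow pow[of "int i" "t - real i * a"] by (simp add: act_mult d_def)
      moreover have "\<phi> (h \<otimes> x [^] int j) (c (t - real i * a)) = d (t - real i * a + real j * a)"
        using hc xpow pow[of "int j" "t - real i * a"] by (simp add: act_mult d_def)
      moreover have "t - real i * a + real j * a = t + b" by (simp add: b_def algebra_simps)
      ultimately show ?thesis unfolding k by simp
    qed
    have "k \<noteq> 0"
    proof
      assume "k = 0"
      then have "d 0 = d b" using dsh[of 0] by (simp add: act_one)
      then show False using geodesic_line_dist[OF dg, of 0 b] b0 by simp
    qed
    then have "of_int k * a \<noteq> 0" using a by simp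
    then have "line_dist (range c) (range d) < \<infinity>"
      using translations_parallel[OF xpow[of k] c(1) pow _ dg dsh b0] by blast
    moreover have "range d = \<phi> h ` l" unfolding l_def act_range d_def ..
    ultimately show ?thesis unfolding l_def by simp
  qed
  \<comment> \<open>Multiplying h from the left by a power of x, which preserves l, does not change
    this value; it is constant on cosets.\<close>
  define f where "f h = line_dist l (\<phi> h ` l')" for h
  have "finite (f ` H)"
  proof (rule finite_image_factor[OF x(2)])
    fix h k assume h: "h \<in> H" and k: "k \<in> H" and eq: "generate G {x} #> h = generate G {x} #> k"
    have "k \<in> generate G {x} #> h" unfolding eq by (rule rcos_self[OF Hc[OF k] sg])
    then obtain n :: int where n: "k = x [^] n \<otimes> h" unfolding r_coset_def gen by blast
    have "f k = line_dist (\<phi> (x [^] n) ` l) (\<phi> (x [^] n) ` \<phi> h ` l')"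
      unfolding f_def n act_image_mult[OF xpow Hc[OF h]] powl ..
    also have "\<dots> = f h" unfolding f_def by (rule line_dist_act[OF xpow ll])
    finally show "f h = f k" by simp
  qed
  moreover have "v < \<infinity>" if v: "v \<in> f ` H" for v
  proof -
    obtain h where h: "h \<in> H" "v = line_dist l (\<phi> h ` l')" using v unfolding f_def by blast
    have "line_dist (\<phi> h ` l) (\<phi> h ` l') < \<infinity>" using line_dist_act[OF Hc[OF h(1)] ll] l'(2) by simp
    then show ?thesis unfolding h(2) by (rule line_dist_finite_trans[OF ll comp[OF h(1)]])
  qed
  ultimately obtain R where R: "\<And>v. v \<in> f ` H \<Longrightarrow> v \<le> ereal R" using finite_ereal_bound by blast
  define S where "S = (\<lambda>h. \<phi> h ` l') ` H"
  have "S \<subseteq> \<A>" unfolding S_def using A_act[OF Hc l'(1)] by blast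
  moreover have "S \<noteq> {}" unfolding S_def using x(1) by blast
  moreover have "\<phi> h ` m \<in> S" if hm: "h \<in> H" "m \<in> S" for h m
  proof -
    obtain k where k: "k \<in> H" "m = \<phi> k ` l'" using hm(2) unfolding S_def by blast
    then have "\<phi> h ` m = \<phi> (h \<otimes> k) ` l'" using act_image_mult[OF Hc[OF hm(1)] Hc[OF k(1)]] by simp
    then show ?thesis unfolding S_def using subgroup.m_closed[OF H hm(1) k(1)] by blast
  qed
  moreover have "line_dist l m \<le> ereal R" if m: "m \<in> S" for m
  proof -
    obtain h where "h \<in> H" "m = \<phi> h ` l'" using m unfolding S_def by blast
    then show ?thesis using R[of "f h"] unfolding f_def by blast
  qed
  ultimately obtain m where "m \<in> \<A>" "\<And>h. h \<in> H \<Longrightarrow> \<phi> h ` m = m" using fixed_line[OF H _ _ _ ll] by metis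
  then show "\<exists>m\<in>\<A>. \<forall>h\<in>H. \<phi> h ` m = m" by blast
qed

end

subsection \<open>The join of the nerves\<close>

lemma sum_set_split: "\<sigma> = Inl ` (Inl -` \<sigma>) \<union> Inr ` (Inr -` \<sigma>)"
proof (intro equalityI subsetI)
  fix v assume "v \<in> \<sigma>"
  then show "v \<in> Inl ` (Inl -` \<sigma>) \<union> Inr ` (Inr -` \<sigma>)" by (cases v) auto
qed auto

lemma sjoin_iff:
  "\<sigma> \<in> sjoin K L \<longleftrightarrow> (Inl -` \<sigma> \<in> K \<or> Inl -` \<sigma> = {}) \<and> (Inr -` \<sigma> \<in> L \<or> Inr -` \<sigma> = {}) \<and> \<sigma> \<noteq> {}"
proof
  assume "\<sigma> \<in> sjoin K L"
  then obtain s t where st: "\<sigma> = Inl ` s \<union> Inr ` t" "s \<in> K \<or> s = {}" "t \<in> L \<or> t = {}" "s \<noteq> {} \<or> t \<noteq> {}"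
    unfolding sjoin_def by blast
  moreover have "Inl -` \<sigma> = s" "Inr -` \<sigma> = t" using st(1) by auto
  ultimately show "(Inl -` \<sigma> \<in> K \<or> Inl -` \<sigma> = {}) \<and> (Inr -` \<sigma> \<in> L \<or> Inr -` \<sigma> = {}) \<and> \<sigma> \<noteq> {}" by auto
next
  assume a: "(Inl -` \<sigma> \<in> K \<or> Inl -` \<sigma> = {}) \<and> (Inr -` \<sigma> \<in> L \<or> Inr -` \<sigma> = {}) \<and> \<sigma> \<noteq> {}"
  note eq = sum_set_split[of \<sigma>]
  have ne: "Inl -` \<sigma> \<noteq> {} \<or> Inr -` \<sigma> \<noteq> {}" using a eq by (metis Un_empty image_empty)
  show "\<sigma> \<in> sjoin K L"
    unfolding sjoin_def by (intro CollectI exI[of _ "Inl -` \<sigma>"] exI[of _ "Inr -` \<sigma>"] conjI eq ne) (use a in blast)+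
qed

lemma scomplex_nerve: "scomplex (nerve U)"
  unfolding scomplex_def
proof (intro conjI ballI allI impI)
  fix \<sigma> assume "\<sigma> \<in> nerve U"
  then show "finite \<sigma>" "\<sigma> \<noteq> {}" by (auto simp: nerve_def)
next
  fix \<sigma> \<tau> assume \<sigma>: "\<sigma> \<in> nerve U" and sub: "\<tau> \<subseteq> \<sigma>" "\<tau> \<noteq> {}"
  have "\<Inter>\<sigma> \<subseteq> \<Inter>\<tau>" using sub(1) by (rule Inter_anti_mono)
  then show "\<tau> \<in> nerve U" using \<sigma> sub finite_subset[OF sub(1)] unfolding nerve_def by blast
qed

lemma scomplex_sjoin:
  assumes "scomplex K" "scomplex L" shows "scomplex (sjoin K L)"
  unfolding scomplex_def
proof (intro conjI ballI allI impI)
  fix \<sigma> assume "\<sigma> \<in> sjoin K L"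
  then have s: "Inl -` \<sigma> \<in> K \<or> Inl -` \<sigma> = {}" "Inr -` \<sigma> \<in> L \<or> Inr -` \<sigma> = {}" "\<sigma> \<noteq> {}" unfolding sjoin_iff by auto
  have "finite (Inl -` \<sigma>)" "finite (Inr -` \<sigma>)"
    using s scomplex_finite[OF assms(1)] scomplex_finite[OF assms(2)] by (auto simp del: finite_vimage_iff)
  then show "finite \<sigma>" using sum_set_split[of \<sigma>] by (metis finite_UnI finite_imageI)
  show "\<sigma> \<noteq> {}" by (rule s(3))
next
  fix \<sigma> \<tau> assume \<sigma>: "\<sigma> \<in> sjoin K L" and sub: "\<tau> \<subseteq> \<sigma>" "\<tau> \<noteq> {}"
  have v: "Inl -` \<tau> \<subseteq> Inl -` \<sigma>" "Inr -` \<tau> \<subseteq> Inr -` \<sigma>" using sub(1) by auto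
  have "Inl -` \<tau> \<in> K \<or> Inl -` \<tau> = {}" using scomplex_face[OF assms(1) _ v(1)] v(1) \<sigma> unfolding sjoin_iff by blast
  moreover have "Inr -` \<tau> \<in> L \<or> Inr -` \<tau> = {}" using scomplex_face[OF assms(2) _ v(2)] v(2) \<sigma> unfolding sjoin_iff by blast
  ultimately show "\<tau> \<in> sjoin K L" unfolding sjoin_iff using sub(2) by blast
qed

section \<open>Rigidity of the action on the nerve of a good cover\<close>

lemma good_coverD:
  assumes "good_cover G act Y balls U"
  shows "U \<subseteq> {balls y r | y r. y \<in> Y \<and> 0 < r}" "\<Union>U = Y"
    "g \<in> carrier G \<Longrightarrow> (\<lambda>B. act g ` B) ` U = U"
    "g \<in> carrier G \<Longrightarrow> B \<in> U \<Longrightarrow> act g ` B \<inter> B \<noteq> {} \<Longrightarrow> act g ` B = B"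
proof -
  note d = assms[unfolded good_cover_def]
  show "U \<subseteq> {balls y r | y r. y \<in> Y \<and> 0 < r}" using d by (elim conjE)
  show "\<Union>U = Y" using d by (elim conjE)
  show "g \<in> carrier G \<Longrightarrow> (\<lambda>B. act g ` B) ` U = U" using d by (elim conjE) (erule (1) bspec)
  show "g \<in> carrier G \<Longrightarrow> B \<in> U \<Longrightarrow> act g ` B \<inter> B \<noteq> {} \<Longrightarrow> act g ` B = B" using d by simp
qed

lemma good_cover_nerve_image:
  assumes U: "good_cover G act Y balls U" and g: "g \<in> carrier G" and s: "s \<in> nerve U"
  shows "(\<lambda>B. act g ` B) ` s \<in> nerve U"
proof -
  have eq: "(\<lambda>B. act g ` B) ` U = U" by (rule good_coverD(3)[OF U g])
  have s': "s \<subseteq> U" "finite s" "s \<noteq> {}" "\<Inter>s \<noteq> {}" using s by (auto simp: nerve_def)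
  obtain z where z: "\<And>B. B \<in> s \<Longrightarrow> z \<in> B" using s'(4) by blast
  have "(\<lambda>B. act g ` B) ` s \<subseteq> U" using s'(1) eq by blast
  moreover have "act g z \<in> \<Inter>((\<lambda>B. act g ` B) ` s)" using z by blast
  ultimately show ?thesis unfolding nerve_def using s'(2,3) by blast
qed

text \<open>B and its translate are both members of s, whose members share a point; so they meet,
  and goodness makes them equal.\<close>

lemma good_cover_nerve_rigid:
  assumes U: "good_cover G act Y balls U" and g: "g \<in> carrier G" and s: "s \<in> nerve U"
    and eq: "(\<lambda>B. act g ` B) ` s = s" and B: "B \<in> s"
  shows "act g ` B = B"
proof -
  have s': "s \<subseteq> U" "\<Inter>s \<noteq> {}" using s by (auto simp: nerve_def)
  have "act g ` B \<in> s" using eq B by blast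
  then have "\<Inter>s \<subseteq> act g ` B \<inter> B" using B by (intro Int_greatest Inter_lower)
  then have ne: "act g ` B \<inter> B \<noteq> {}" using s'(2) by (metis subset_empty)
  have "B \<in> U" using s'(1) B by blast
  then show ?thesis using ne by (rule good_coverD(4)[OF U g])
qed

lemma good_cover_fixed:
  assumes "good_cover G act Y balls U" "B \<in> U" "g \<in> carrier G" "y \<in> B" "act g y = y"
  shows "act g ` B = B"
proof -
  have "y \<in> act g ` B \<inter> B" using assms(4,5) by (metis IntI imageI)
  then have "act g ` B \<inter> B \<noteq> {}" by auto
  then show ?thesis by (rule good_coverD(4)[OF assms(1,3,2)])
qed

locale cat0_covers = cat0_action w G \<phi> \<A>
  for w :: "'a::metric_space \<Rightarrow> 'a \<Rightarrow> real \<Rightarrow> 'a" and G :: "('g, 'm) monoid_scheme" (structure)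
    and \<phi> :: "'g \<Rightarrow> 'a \<Rightarrow> 'a" and \<A> :: "'a set set" +
  fixes \<U> :: "'a set set" and \<V> :: "'a set set set"
  assumes U: "good_cover G \<phi> UNIV ball \<U>" and V: "good_cover G (\<lambda>g l. \<phi> g ` l) \<A> (line_ball \<A>) \<V>"
begin

section \<open>Fixed sets as subcomplexes of the join\<close>

definition J :: "('a set + 'a set set) set set" where
  "J = sjoin (nerve \<U>) (nerve \<V>)"

definition JH :: "'g set \<Rightarrow> ('a set + 'a set set) set set" where
  "JH H = {\<sigma> \<in> J. \<forall>h\<in>H. \<forall>v\<in>\<sigma>. join_act \<phi> h v = v}"

lemma U_ball: "B \<in> \<U> \<Longrightarrow> \<exists>x r. 0 < r \<and> B = ball x r"
  using good_coverD(1)[OF U] by blast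

lemma V_ball: "B \<in> \<V> \<Longrightarrow> \<exists>k r. k \<in> \<A> \<and> 0 < r \<and> B = line_ball \<A> k r"
  using good_coverD(1)[OF V] by blast

lemma join_act_simps [simp]:
  "join_act \<phi> g (Inl B) = Inl (\<phi> g ` B)" "join_act \<phi> g (Inr C) = Inr ((\<lambda>l. \<phi> g ` l) ` C)"
  by (simp_all add: join_act_def)

lemma join_act_mult:
  assumes "g \<in> carrier G" "h \<in> carrier G"
  shows "join_act \<phi> (g \<otimes> h) v = join_act \<phi> g (join_act \<phi> h v)"
  by (cases v) (simp_all add: act_image_mult[OF assms] image_image act_mult[OF assms])

lemma join_act_one: "join_act \<phi> \<one> v = v"
  by (cases v) (simp_all add: act_one)

lemma vimage_join_act:
  "Inl -` (join_act \<phi> g ` \<sigma>) = (\<lambda>B. \<phi> g ` B) ` (Inl -` \<sigma>)"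
  "Inr -` (join_act \<phi> g ` \<sigma>) = (\<lambda>C. (\<lambda>l. \<phi> g ` l) ` C) ` (Inr -` \<sigma>)"
proof -
  show "Inl -` (join_act \<phi> g ` \<sigma>) = (\<lambda>B. \<phi> g ` B) ` (Inl -` \<sigma>)"
  proof (intro equalityI subsetI)
    fix B assume "B \<in> Inl -` (join_act \<phi> g ` \<sigma>)"
    then obtain v where v: "v \<in> \<sigma>" "Inl B = join_act \<phi> g v" by auto
    then show "B \<in> (\<lambda>B. \<phi> g ` B) ` (Inl -` \<sigma>)" by (cases v) auto
  next
    fix B assume "B \<in> (\<lambda>B. \<phi> g ` B) ` (Inl -` \<sigma>)"
    then obtain B' where B': "Inl B' \<in> \<sigma>" "B = \<phi> g ` B'" by auto
    then have "Inl B = join_act \<phi> g (Inl B')" by simp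
    then show "B \<in> Inl -` (join_act \<phi> g ` \<sigma>)" using B'(1) by (metis imageI vimageI2)
  qed
  show "Inr -` (join_act \<phi> g ` \<sigma>) = (\<lambda>C. (\<lambda>l. \<phi> g ` l) ` C) ` (Inr -` \<sigma>)"
  proof (intro equalityI subsetI)
    fix B assume "B \<in> Inr -` (join_act \<phi> g ` \<sigma>)"
    then obtain v where v: "v \<in> \<sigma>" "Inr B = join_act \<phi> g v" by auto
    then show "B \<in> (\<lambda>C. (\<lambda>l. \<phi> g ` l) ` C) ` (Inr -` \<sigma>)" by (cases v) auto
  next
    fix B assume "B \<in> (\<lambda>C. (\<lambda>l. \<phi> g ` l) ` C) ` (Inr -` \<sigma>)"
    then obtain B' where B': "Inr B' \<in> \<sigma>" "B = (\<lambda>l. \<phi> g ` l) ` B'" by auto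
    then have "Inr B = join_act \<phi> g (Inr B')" by simp
    then show "B \<in> Inr -` (join_act \<phi> g ` \<sigma>)" using B'(1) by (metis imageI vimageI2)
  qed
qed

lemma scomplex_J: "scomplex J"
  unfolding J_def by (intro scomplex_sjoin scomplex_nerve)

lemma scomplex_JH: "scomplex (JH H)"
  unfolding scomplex_def
proof (intro conjI ballI allI impI)
  fix \<sigma> assume "\<sigma> \<in> JH H"
  then show "finite \<sigma>" "\<sigma> \<noteq> {}" using scomplex_J unfolding JH_def scomplex_def by auto
next
  fix \<sigma> \<tau> assume "\<sigma> \<in> JH H" "\<tau> \<subseteq> \<sigma>" "\<tau> \<noteq> {}"
  then show "\<tau> \<in> JH H" using scomplex_face[OF scomplex_J, of \<sigma> \<tau>] unfolding JH_def by blast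
qed

lemma J_act:
  assumes g: "g \<in> carrier G" and \<sigma>: "\<sigma> \<in> J"
  shows "join_act \<phi> g ` \<sigma> \<in> J"
proof -
  have s: "Inl -` \<sigma> \<in> nerve \<U> \<or> Inl -` \<sigma> = {}" "Inr -` \<sigma> \<in> nerve \<V> \<or> Inr -` \<sigma> = {}" "\<sigma> \<noteq> {}"
    using \<sigma> unfolding J_def sjoin_iff by auto
  have "Inl -` (join_act \<phi> g ` \<sigma>) \<in> nerve \<U> \<or> Inl -` (join_act \<phi> g ` \<sigma>) = {}"
    unfolding vimage_join_act using s(1) good_cover_nerve_image[OF U g] by blast
  moreover have "Inr -` (join_act \<phi> g ` \<sigma>) \<in> nerve \<V> \<or> Inr -` (join_act \<phi> g ` \<sigma>) = {}"
    unfolding vimage_join_act using s(2) good_cover_nerve_image[OF V g] by blast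
  ultimately show ?thesis unfolding J_def sjoin_iff using s(3) by blast
qed

lemma J_rigid:
  assumes g: "g \<in> carrier G" and \<sigma>: "\<sigma> \<in> J" and eq: "join_act \<phi> g ` \<sigma> = \<sigma>" and v: "v \<in> \<sigma>"
  shows "join_act \<phi> g v = v"
proof (cases v)
  case (Inl B)
  then have B: "B \<in> Inl -` \<sigma>" using v by simp
  then have "Inl -` \<sigma> \<in> nerve \<U>" using \<sigma> unfolding J_def sjoin_iff by blast
  moreover have "(\<lambda>B. \<phi> g ` B) ` (Inl -` \<sigma>) = Inl -` \<sigma>" using vimage_join_act(1)[of g \<sigma>] eq by simp
  ultimately show ?thesis using good_cover_nerve_rigid[OF U g _ _ B] Inl by simp
next
  case (Inr B)
  then have B: "B \<in> Inr -` \<sigma>" using v by simp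
  then have "Inr -` \<sigma> \<in> nerve \<V>" using \<sigma> unfolding J_def sjoin_iff by blast
  moreover have "(\<lambda>C. (\<lambda>l. \<phi> g ` l) ` C) ` (Inr -` \<sigma>) = Inr -` \<sigma>" using vimage_join_act(2)[of g \<sigma>] eq by simp
  ultimately show ?thesis using good_cover_nerve_rigid[OF V g _ _ B] Inr by simp
qed

text \<open>The support of a fixed point is finite and mapped injectively into itself, hence onto;
  by rigidity each of its vertices is fixed. The fixed set is therefore a subcomplex without any
  subdivision.\<close>

lemma fixed_set_eq:
  assumes H: "subgroup H G"
  shows "fixed_set G (join_act \<phi>) J H = realization (JH H)"
proof (intro equalityI subsetI)
  note Hc = subgroup_carrier[OF H]
  fix p assume "p \<in> fixed_set G (join_act \<phi>) J H"
  then have p: "p \<in> realization J" and inv: "\<And>h. h \<in> H \<Longrightarrow> (\<lambda>v. p (join_act \<phi> (inv h) v)) = p"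
    by (auto simp: fixed_set_def realization_act_def)
  have pJ: "supp p \<in> J" using realizationD(2)[OF p] .
  have "join_act \<phi> h v = v" if h: "h \<in> H" and v: "v \<in> supp p" for h v
  proof -
    have ih: "inv h \<in> H" using subgroup.m_inv_closed[OF H h] .
    have hh: "inv (inv h) = h" using Hc[OF h] by simp
    have "p (join_act \<phi> h u) = p u" for u using fun_cong[OF inv[OF ih], of u] unfolding hh .
    then have sub: "join_act \<phi> h ` supp p \<subseteq> supp p" by auto
    have "inj (join_act \<phi> h)"
    proof (rule inj_on_inverseI)
      show "join_act \<phi> (inv h) (join_act \<phi> h u) = u" for u
        using join_act_mult[of "inv h" h u] join_act_one[of u] Hc[OF h] by simp
    qed
    then have "inj_on (join_act \<phi> h) (supp p)" by (rule inj_on_subset) simp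
    then have "join_act \<phi> h ` supp p = supp p"
      by (rule endo_inj_surj[OF scomplex_finite[OF scomplex_J pJ] sub])
    then show ?thesis using J_rigid[OF Hc[OF h] pJ _ v] by blast
  qed
  then have "supp p \<in> JH H" unfolding JH_def using pJ by blast
  then show "p \<in> realization (JH H)" using p unfolding realization_def by blast
next
  note Hc = subgroup_carrier[OF H]
  fix p assume p: "p \<in> realization (JH H)"
  have "JH H \<subseteq> J" by (auto simp: JH_def)
  then have pJ: "p \<in> realization J" using p realization_mono by blast
  have fixed: "join_act \<phi> h v = v" if "h \<in> H" "v \<in> supp p" for h v
    using realizationD(2)[OF p] that unfolding JH_def by blast
  have "(\<lambda>v. p (join_act \<phi> (inv h) v)) = p" if h: "h \<in> H" for h
  proof
    fix v
    have ih: "inv h \<in> H" using subgroup.m_inv_closed[OF H h] .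
    show "p (join_act \<phi> (inv h) v) = p v"
    proof (cases "v \<in> supp p \<or> join_act \<phi> (inv h) v \<in> supp p")
      case True
      then have "join_act \<phi> (inv h) v = v"
      proof
        assume "join_act \<phi> (inv h) v \<in> supp p"
        then have "join_act \<phi> h (join_act \<phi> (inv h) v) = join_act \<phi> (inv h) v" by (rule fixed[OF h])
        moreover have "join_act \<phi> h (join_act \<phi> (inv h) v) = v"
          using join_act_mult[of h "inv h" v] join_act_one[of v] Hc[OF h] by simp
        ultimately show ?thesis by simp
      qed (rule fixed[OF ih])
      then show ?thesis by simp
    next
      case False
      then show ?thesis by simp
    qed
  qed
  then show "p \<in> fixed_set G (join_act \<phi>) J H"
    using pJ by (simp add: fixed_set_def realization_act_def)
qed

lemma JH_Inl_finite:
  assumes H: "subgroup H G" and \<sigma>: "\<sigma> \<in> JH H" and v: "Inl B \<in> \<sigma>"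
  shows "finite H" "B \<in> \<U>" "\<And>h. h \<in> H \<Longrightarrow> \<phi> h ` B = B"
proof -
  show inv: "\<phi> h ` B = B" if "h \<in> H" for h
  proof -
    have "join_act \<phi> h (Inl B) = Inl B" using \<sigma> v that unfolding JH_def by blast
    then show ?thesis by simp
  qed
  have "B \<in> Inl -` \<sigma>" using v by simp
  then show "B \<in> \<U>" using \<sigma> unfolding JH_def J_def sjoin_iff nerve_def by blast
  then obtain x r where xr: "0 < r" "B = ball x r" using U_ball by blast
  show "finite H" by (rule finite_if_invariant_ball[OF H, of x x r]) (use xr inv in auto)
qed

lemma JH_Inr:
  assumes \<sigma>: "\<sigma> \<in> JH H" and v: "Inr B \<in> \<sigma>"
  shows "B \<in> \<V>" "\<And>h. h \<in> H \<Longrightarrow> (\<lambda>l. \<phi> h ` l) ` B = B"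
proof -
  show inv: "(\<lambda>l. \<phi> h ` l) ` B = B" if "h \<in> H" for h
  proof -
    have "join_act \<phi> h (Inr B) = Inr B" using \<sigma> v that unfolding JH_def by blast
    then show ?thesis by simp
  qed
  have "B \<in> Inr -` \<sigma>" using v by simp
  then show "B \<in> \<V>" using \<sigma> unfolding JH_def J_def sjoin_iff nerve_def by blast
qed

text \<open>H may be infinite, so finiteness of the orbit cannot supply the strict inequality for
  open balls. Discreteness does: the distances from the centre k to the orbit of l, all below r,
  take finitely many values, and the largest is still below r.\<close>

lemma fixed_line_in_line_balls:
  assumes H: "subgroup H G" and s: "s \<subseteq> \<V>" "s \<noteq> {}" and l: "\<And>B. B \<in> s \<Longrightarrow> l \<in> B"
    and inv: "\<And>B h. B \<in> s \<Longrightarrow> h \<in> H \<Longrightarrow> (\<lambda>l. \<phi> h ` l) ` B = B"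
  obtains m where "m \<in> \<A>" "\<And>h. h \<in> H \<Longrightarrow> \<phi> h ` m = m" "\<And>B. B \<in> s \<Longrightarrow> m \<in> B"
proof -
  note Hc = subgroup_carrier[OF H]
  define S where "S = (\<lambda>h. \<phi> h ` l) ` H"
  obtain B0 where B0: "B0 \<in> s" using s(2) by blast
  then obtain k0 r0 where k0: "k0 \<in> \<A>" "B0 = line_ball \<A> k0 r0" using V_ball s(1) by blast
  have lA: "l \<in> \<A>" using l[OF B0] unfolding k0(2) line_ball_def by blast
  have SB: "\<phi> h ` l \<in> B" if "B \<in> s" "h \<in> H" for B h using inv[OF that] l[OF that(1)] by blast
  have "S \<subseteq> \<A>" unfolding S_def using A_act[OF Hc lA] by blast
  moreover have "S \<noteq> {}" unfolding S_def using subgroup.one_closed[OF H] by blast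
  moreover have "\<phi> h ` m \<in> S" if hm: "h \<in> H" "m \<in> S" for h m
  proof -
    obtain k where k: "k \<in> H" "m = \<phi> k ` l" using hm(2) unfolding S_def by blast
    then have "\<phi> h ` m = \<phi> (h \<otimes> k) ` l" using act_image_mult[OF Hc[OF hm(1)] Hc[OF k(1)]] by simp
    then show ?thesis unfolding S_def using subgroup.m_closed[OF H hm(1) k(1)] by blast
  qed
  moreover have "line_dist k0 m \<le> ereal r0" if m: "m \<in> S" for m
  proof -
    obtain h where h: "h \<in> H" "m = \<phi> h ` l" using m unfolding S_def by blast
    then have "m \<in> line_ball \<A> k0 r0" using SB[OF B0 h(1)] k0(2) by simp
    then have "line_dist k0 m < ereal r0" unfolding line_ball_def by blast
    then show ?thesis by (rule less_imp_le)
  qed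
  ultimately obtain m where m: "m \<in> \<A>" "\<And>h. h \<in> H \<Longrightarrow> \<phi> h ` m = m"
    "\<And>k \<rho>. k \<in> \<A> \<Longrightarrow> (\<And>l. l \<in> S \<Longrightarrow> line_dist k l \<le> ereal \<rho>) \<Longrightarrow> line_dist k m \<le> ereal \<rho>"
    using fixed_line[OF H _ _ _ A_lines[OF k0(1)]] by metis
  have "m \<in> B" if B: "B \<in> s" for B
  proof -
    obtain k r where k: "k \<in> \<A>" "B = line_ball \<A> k r" using V_ball s(1) B by blast
    define D where "D = line_dist k ` S"
    have lt: "d < ereal r" if d: "d \<in> D" for d
    proof -
      obtain h where h: "h \<in> H" "d = line_dist k (\<phi> h ` l)" using d unfolding D_def S_def by blast
      show ?thesis using SB[OF B h(1)] unfolding h(2) k(2) line_ball_def by simp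
    qed
    have "D \<subseteq> {line_dist k (\<phi> h ` l) | h. h \<in> carrier G \<and> line_dist k (\<phi> h ` l) \<le> ereal r}"
    proof
      fix d assume d: "d \<in> D"
      obtain h where h: "h \<in> H" "d = line_dist k (\<phi> h ` l)" using d unfolding D_def S_def by blast
      then show "d \<in> {line_dist k (\<phi> h ` l) | h. h \<in> carrier G \<and> line_dist k (\<phi> h ` l) \<le> ereal r}"
        using Hc[OF h(1)] lt[OF d] less_imp_le by blast
    qed
    then have fin: "finite D"
      using finite_line_dist_values[OF A_axes[OF k(1)] A_lines[OF lA], of r] finite_subset by blast
    have ne: "D \<noteq> {}" using \<open>S \<noteq> {}\<close> by (simp add: D_def)
    define d0 where "d0 = Max D"
    have d0: "d0 \<in> D" unfolding d0_def using fin ne by (rule Max_in)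
    have "0 \<le> d0" using d0 unfolding D_def line_dist_def
      by (elim imageE) (simp only:, rule Inf_greatest, auto simp: flat_strip_def)
    moreover have "d0 < ereal r" using lt[OF d0] .
    ultimately obtain \<rho> where \<rho>: "d0 = ereal \<rho>" by (cases d0) auto
    have "line_dist k m \<le> ereal \<rho>"
    proof (rule m(3)[OF k(1)])
      fix l' assume "l' \<in> S"
      then have "line_dist k l' \<in> D" by (simp add: D_def)
      then show "line_dist k l' \<le> ereal \<rho>" unfolding \<rho>[symmetric] d0_def by (rule Max_ge[OF fin])
    qed
    also have "\<dots> < ereal r" using lt[OF d0] \<rho> by simp
    finally show ?thesis unfolding k(2) line_ball_def using m(1) by simp
  qed
  then show ?thesis using that m(1,2) by blast
qed

text \<open>The vertices \<open>P = range Inl\<close> span the nerve of the invariant balls, seen as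
  a cover of the convex fixed set Y; whatever the second factor is, the join absorbs it.\<close>

lemma fin_contractible_JH_finite:
  assumes H: "subgroup H G" and fin: "finite H"
  shows "fin_contractible (JH H)"
proof -
  note Hc = subgroup_carrier[OF H]
  define UH where "UH = {B \<in> \<U>. \<forall>h\<in>H. \<phi> h ` B = B}"
  define Y where "Y = {y. \<forall>h\<in>H. \<phi> h y = y}"
  have "\<forall>B\<in>\<U>. \<exists>p. 0 < snd p \<and> B = ball (fst p) (snd p)" using U_ball by fastforce
  from bchoice[OF this] obtain q where q: "\<forall>B\<in>\<U>. 0 < snd (q B) \<and> B = ball (fst (q B)) (snd (q B))" ..
  define cen :: "'a set + 'a set set \<Rightarrow> 'a" where "cen v = fst (q (projl v))" for v
  define rad :: "'a set + 'a set set \<Rightarrow> real" where "rad v = snd (q (projl v))" for v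
  have ball: "y \<in> B \<longleftrightarrow> dist (cen (Inl B)) y < rad (Inl B)" if "B \<in> \<U>" for B y
  proof -
    have "B = ball (cen (Inl B)) (rad (Inl B))" using q that by (simp add: cen_def rad_def)
    then show ?thesis by (metis mem_ball)
  qed
  have fixed: "\<exists>y\<in>Y. \<forall>B\<in>s. y \<in> B" if s: "s \<subseteq> UH" and z: "\<And>B. B \<in> s \<Longrightarrow> z \<in> B" for s z
  proof -
    have inv: "\<phi> h ` B = B" if "B \<in> s" "h \<in> H" for B h using s that unfolding UH_def by blast
    have balls: "\<exists>x r. B = ball x r" if "B \<in> s" for B using s that U_ball unfolding UH_def by blast
    obtain y where "\<And>h. h \<in> H \<Longrightarrow> \<phi> h y = y" "\<And>B. B \<in> s \<Longrightarrow> y \<in> B"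
      using fixed_point_in_balls[OF H fin z inv balls] by blast
    then show ?thesis unfolding Y_def by blast
  qed
  interpret bc: ball_cover w Y "Inl ` UH" cen rad
  proof unfold_locales
    have "Y = (\<Inter>h\<in>H. {y. \<phi> h y = y})" by (auto simp: Y_def)
    moreover have "closed {y. \<phi> h y = y}" if h: "h \<in> H" for h
    proof (rule closed_Collect_eq)
      show "continuous_on UNIV (\<phi> h)"
        unfolding continuous_on_iff using act_dist[OF Hc[OF h]] by auto
    qed (rule continuous_on_id)
    ultimately show "closed Y" by (simp add: closed_INT)
    show "cconvex Y"
      unfolding cconvex_def
    proof (intro ballI allI impI)
      fix x y s assume xy: "x \<in> Y" "y \<in> Y" and s: "0 \<le> s" "s \<le> (1::real)"
      have "\<phi> h (w x y s) = w x y s" if h: "h \<in> H" for h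
      proof (rule w_unique[OF s])
        have x: "\<phi> h x = x" and y: "\<phi> h y = y" using xy h unfolding Y_def by blast+
        show "dist x (\<phi> h (w x y s)) = s * dist x y"
          using act_dist[OF Hc[OF h], of x "w x y s"] dist_w_left[OF s, of x y] x by simp
        show "dist y (\<phi> h (w x y s)) = (1 - s) * dist x y"
          using act_dist[OF Hc[OF h], of y "w x y s"] dist_w_right[OF s, of y x] y by simp
      qed
      then show "w x y s \<in> Y" unfolding Y_def by blast
    qed
    \<comment> \<open>The empty family imposes no ball, so this is the fixed point theorem for
      finite groups.\<close>
    show "Y \<noteq> {}" using fixed[of "{}"] by blast
    show "0 < rad v" if "v \<in> Inl ` UH" for v using that q by (auto simp: UH_def rad_def)
    show "\<exists>v\<in>Inl ` UH. dist (cen v) y < rad v" if y: "y \<in> Y" for y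
    proof -
      have "\<Union>\<U> = UNIV" by (rule good_coverD(2)[OF U])
      then have "y \<in> \<Union>\<U>" by simp
      then obtain B where B: "B \<in> \<U>" "y \<in> B" by (elim UnionE)
      \<comment> \<open>A ball with a point fixed by H meets its translates and is invariant, so the
        invariant balls cover Y.\<close>
      have "\<phi> h ` B = B" if h: "h \<in> H" for h
        by (rule good_cover_fixed[OF U B(1) Hc[OF h] B(2)]) (use y h in \<open>auto simp: Y_def\<close>)
      then have "B \<in> UH" using B(1) by (simp add: UH_def)
      then show ?thesis using ball[OF B(1)] B(2) by blast
    qed
  qed
  have eq: "bc.ncomplex = {\<sigma> \<in> JH H. \<sigma> \<subseteq> range Inl}"
  proof (intro equalityI subsetI)
    fix \<sigma> assume "\<sigma> \<in> bc.ncomplex"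
    then obtain y where \<sigma>: "\<sigma> \<subseteq> Inl ` UH" "finite \<sigma>" "\<sigma> \<noteq> {}" and y: "\<forall>v\<in>\<sigma>. dist (cen v) y < rad v"
      unfolding bc.ncomplex_def by blast
    have r: "Inr -` \<sigma> = {}" using \<sigma>(1) by auto
    have s: "Inl -` \<sigma> \<subseteq> UH" using \<sigma>(1) by auto
    have "y \<in> B" if "B \<in> Inl -` \<sigma>" for B
      using ball[of B y] y s that unfolding UH_def by auto
    then have "\<Inter>(Inl -` \<sigma>) \<noteq> {}" by blast
    moreover have "finite (Inl -` \<sigma>)" using \<sigma>(2) by (intro finite_vimageI) auto
    moreover have "Inl -` \<sigma> \<noteq> {}" using \<sigma>(3) r sum_set_split[of \<sigma>] by (metis Un_empty image_empty)
    ultimately have "Inl -` \<sigma> \<in> nerve \<U>" unfolding nerve_def using s by (auto simp: UH_def)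
    then have "\<sigma> \<in> J" unfolding J_def sjoin_iff using r \<sigma>(3) by blast
    moreover have "join_act \<phi> h v = v" if "h \<in> H" "v \<in> \<sigma>" for h v
      using that \<sigma>(1) by (auto simp: UH_def)
    ultimately show "\<sigma> \<in> {\<sigma> \<in> JH H. \<sigma> \<subseteq> range Inl}" unfolding JH_def using \<sigma>(1) by blast
  next
    fix \<sigma> assume "\<sigma> \<in> {\<sigma> \<in> JH H. \<sigma> \<subseteq> range Inl}"
    then have \<sigma>: "\<sigma> \<in> JH H" "\<sigma> \<subseteq> range Inl" by auto
    have \<sigma>f: "finite \<sigma>" "\<sigma> \<noteq> {}" using scomplex_JH \<sigma>(1) unfolding scomplex_def by blast+
    have s: "Inl -` \<sigma> \<subseteq> UH"
    proof
      fix B assume "B \<in> Inl -` \<sigma>"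
      then have "Inl B \<in> \<sigma>" by simp
      note JH_Inl_finite(2,3)[OF H \<sigma>(1) this]
      then show "B \<in> UH" unfolding UH_def by blast
    qed
    have sub: "\<sigma> \<subseteq> Inl ` UH"
    proof
      fix v assume v: "v \<in> \<sigma>"
      then obtain B where B: "v = Inl B" using \<sigma>(2) by blast
      then have "B \<in> Inl -` \<sigma>" using v by simp
      then show "v \<in> Inl ` UH" using s B by blast
    qed
    obtain v0 where "v0 \<in> \<sigma>" using \<sigma>f(2) by blast
    moreover obtain B0 where "v0 = Inl B0" using calculation \<sigma>(2) by blast
    ultimately have "B0 \<in> Inl -` \<sigma>" by simp
    then have "Inl -` \<sigma> \<in> nerve \<U>" using \<sigma>(1) unfolding JH_def J_def sjoin_iff by blast
    then obtain z where "\<And>B. B \<in> Inl -` \<sigma> \<Longrightarrow> z \<in> B" unfolding nerve_def by blast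
    then obtain y where y: "y \<in> Y" "\<forall>B\<in>Inl -` \<sigma>. y \<in> B" using fixed[OF s] by blast
    have "dist (cen v) y < rad v" if v: "v \<in> \<sigma>" for v
    proof -
      obtain B where B: "v = Inl B" "B \<in> UH" using sub v by blast
      then show ?thesis using ball[of B y] y(2) v unfolding UH_def by auto
    qed
    then show "\<sigma> \<in> bc.ncomplex" unfolding bc.ncomplex_def using sub \<sigma>f y(1) by blast
  qed
  show ?thesis
  proof (rule fin_contractible_join[OF scomplex_JH eq bc.fin_contractible_ncomplex])
    fix \<sigma> \<tau> assume \<sigma>: "\<sigma> \<in> bc.ncomplex" and \<tau>: "\<tau> \<in> JH H" "\<tau> \<inter> range Inl = {}"
    have \<sigma>': "\<sigma> \<in> JH H" "\<sigma> \<subseteq> range Inl" using \<sigma> unfolding eq by auto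
    have "Inl -` (\<sigma> \<union> \<tau>) = Inl -` \<sigma>" using \<tau>(2) by auto
    moreover have "Inr -` (\<sigma> \<union> \<tau>) = Inr -` \<tau>" using \<sigma>'(2) by auto
    ultimately have "\<sigma> \<union> \<tau> \<in> J" using \<sigma>'(1) \<tau>(1) unfolding JH_def J_def sjoin_iff by auto
    then show "\<sigma> \<union> \<tau> \<in> JH H" using \<sigma>'(1) \<tau>(1) unfolding JH_def by blast
  qed
qed

text \<open>The lines invariant under H form a single parallel family, so one cross-section at c0
  sees them all, and invariant balls of lines become metric balls in it.\<close>

lemma fin_contractible_JH_infinite:
  assumes vc: "virtually_cyclic G H" and inf: "infinite H"
  shows "fin_contractible (JH H)"
proof -
  have H: "subgroup H G" using vc by (simp add: virtually_cyclic_def)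
  note Hc = subgroup_carrier[OF H]
  note fixed_lines = infinite_virtually_cyclic_fixed_lines[OF vc inf]
  define AH where "AH = {l \<in> \<A>. \<forall>h\<in>H. \<phi> h ` l = l}"
  define VH where "VH = {B \<in> \<V>. \<forall>h\<in>H. (\<lambda>l. \<phi> h ` l) ` B = B}"
  have AHl: "l \<in> lines" if "l \<in> AH" for l using that A_lines unfolding AH_def by blast
  have AHfix: "\<phi> h ` l = l" if "l \<in> AH" "h \<in> H" for l h using that unfolding AH_def by blast
  obtain m0 where m0: "m0 \<in> AH" using fixed_lines(1) unfolding AH_def by blast
  obtain c0 where c0: "geodesic_line c0" "m0 = range c0" using AHl[OF m0] by (auto simp: lines_def)
  have par: "line_dist m0 l < \<infinity>" if "l \<in> AH" for l
    using fixed_lines(2)[OF AHl[OF m0] AHl[OF that]] AHfix[OF m0] AHfix[OF that] by blast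
  have foot: "\<exists>c. sync c0 c \<and> range c = l" if "line_dist m0 l < \<infinity>" for l
    using line_dist_finiteE[of c0 l] that c0 by blast
  define Y where "Y = cross_section c0 AH"
  have YE: "\<exists>c. y = c 0 \<and> sync c0 c \<and> range c \<in> AH" if "y \<in> Y" for y
    using that unfolding Y_def cross_section_def by blast
  have fixed: "\<exists>m\<in>AH. \<forall>B\<in>s. m \<in> B" if s: "s \<subseteq> VH" "s \<noteq> {}" and l: "\<And>B. B \<in> s \<Longrightarrow> l \<in> B" for s l
  proof -
    have sV: "s \<subseteq> \<V>" using s(1) unfolding VH_def by blast
    have inv: "(\<lambda>l. \<phi> h ` l) ` B = B" if "B \<in> s" "h \<in> H" for B h using s(1) that unfolding VH_def by blast
    obtain m where "m \<in> \<A>" "\<And>h. h \<in> H \<Longrightarrow> \<phi> h ` m = m" "\<And>B. B \<in> s \<Longrightarrow> m \<in> B"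
      using fixed_line_in_line_balls[OF H sV s(2) l inv] by blast
    then show ?thesis unfolding AH_def by blast
  qed
  have "\<forall>B\<in>VH. \<exists>p. 0 < snd p \<and> (\<forall>c. sync c0 c \<longrightarrow> range c \<in> \<A> \<longrightarrow> (dist (fst p) (c 0) < snd p \<longleftrightarrow> range c \<in> B))"
  proof
    fix B assume B: "B \<in> VH"
    then have "B \<in> \<V>" unfolding VH_def by blast
    then obtain k r where k: "k \<in> \<A>" "0 < r" "B = line_ball \<A> k r" using V_ball by blast
    have kB: "k \<in> B" unfolding k(3) line_ball_def using k(1,2) line_dist_self[OF A_lines[OF k(1)]] by (simp add: zero_ereal_def)
    \<comment> \<open>The centre k of an invariant ball need not be invariant, but an invariant line
      in the ball shows that k is parallel to m0. So k has a base point \<open>ck 0\<close>, which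
      serves as metric centre.\<close>
    have "\<exists>m\<in>AH. \<forall>B'\<in>{B}. m \<in> B'" by (rule fixed[of _ k]) (use B kB in auto)
    then obtain m where m: "m \<in> AH" "m \<in> B" by blast
    have "line_dist k m < ereal r" using m(2) unfolding k(3) line_ball_def by blast
    then have "line_dist k m < \<infinity>" by (rule less_trans) simp
    then have "line_dist m k < \<infinity>" using line_dist_finite_sym[OF _ A_lines[OF k(1)]] by simp
    then have "line_dist m0 k < \<infinity>" by (rule line_dist_finite_trans[OF AHl[OF m0] par[OF m(1)]])
    then obtain ck where ck: "sync c0 ck" "range ck = k" using foot by blast
    have "dist (ck 0) (c 0) < r \<longleftrightarrow> range c \<in> B" if "sync c0 c" "range c \<in> \<A>" for c
      using cross_section_line_dist[OF ck(1) that(1)] that(2) unfolding k(3) line_ball_def ck(2) by simp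
    then show "\<exists>p. 0 < snd p \<and> (\<forall>c. sync c0 c \<longrightarrow> range c \<in> \<A> \<longrightarrow> (dist (fst p) (c 0) < snd p \<longleftrightarrow> range c \<in> B))"
      using k(2) by (intro exI[of _ "(ck 0, r)"]) auto
  qed
  from bchoice[OF this] obtain q where q: "\<forall>B\<in>VH. 0 < snd (q B) \<and>
      (\<forall>c. sync c0 c \<longrightarrow> range c \<in> \<A> \<longrightarrow> (dist (fst (q B)) (c 0) < snd (q B) \<longleftrightarrow> range c \<in> B))" ..
  define cen :: "'a set + 'a set set \<Rightarrow> 'a" where "cen v = fst (q (projr v))" for v
  define rad :: "'a set + 'a set set \<Rightarrow> real" where "rad v = snd (q (projr v))" for v
  have ball: "dist (cen (Inr B)) (c 0) < rad (Inr B) \<longleftrightarrow> range c \<in> B" if "B \<in> VH" "sync c0 c" "range c \<in> AH" for B c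
    using q that unfolding AH_def by (simp add: cen_def rad_def)
  interpret bc: ball_cover w Y "Inr ` VH" cen rad
  proof unfold_locales
    have "lines_closed AH"
      unfolding lines_closed_def
    proof (intro conjI allI impI)
      show "AH \<subseteq> lines" using AHl by blast
      fix s l assume "(\<forall>n. s n \<in> AH) \<and> l \<in> lines \<and> ((\<lambda>n. line_dist (s n) l) \<longlongrightarrow> 0) sequentially"
      then have s: "\<forall>n. s n \<in> AH" and l: "l \<in> lines" and lim: "(\<lambda>n. line_dist (s n) l) \<longlonglongrightarrow> 0" by simp_all
      have "\<forall>n. s n \<in> \<A>" using s unfolding AH_def by blast
      then have lA: "l \<in> \<A>" using A_closed l lim unfolding lines_closed_def by blast
      have "\<phi> h ` l = l" if h: "h \<in> H" for h
      proof -
        have hl: "\<phi> h ` l \<in> lines" using act_lines[OF Hc[OF h] l] .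
        have le: "line_dist (\<phi> h ` l) l \<le> line_dist (s n) l + line_dist (s n) l" for n
        proof -
          have sn: "s n \<in> AH" using s by blast
          have "line_dist (\<phi> h ` l) (s n) = line_dist (\<phi> h ` l) (\<phi> h ` s n)" using AHfix[OF sn h] by simp
          also have "\<dots> = line_dist l (s n)" by (rule line_dist_act[OF Hc[OF h] l])
          also have "\<dots> = line_dist (s n) l" by (rule line_dist_commute[OF AHl[OF sn] l])
          finally show ?thesis using line_dist_triangle[OF hl, of l "s n"] by simp
        qed
        have "(\<lambda>n. line_dist (s n) l + line_dist (s n) l) \<longlonglongrightarrow> 0 + 0"
          by (rule tendsto_add_ereal[OF _ _ lim lim]) auto
        then have "line_dist (\<phi> h ` l) l \<le> 0" using le by (intro LIMSEQ_le_const) auto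
        moreover have "0 \<le> line_dist (\<phi> h ` l) l"
          unfolding line_dist_def by (rule Inf_greatest) (auto simp: flat_strip_def)
        ultimately have "line_dist (\<phi> h ` l) l = 0" by (rule order_antisym)
        then show ?thesis using line_dist_zeroD[OF _ hl] by blast
      qed
      then show "l \<in> AH" unfolding AH_def using lA by blast
    qed
    then show "closed Y" unfolding Y_def by (rule closed_cross_section)
    show "cconvex Y"
      unfolding cconvex_def
    proof (intro ballI allI impI)
      fix x y s assume xy: "x \<in> Y" "y \<in> Y" and s: "0 \<le> s" "s \<le> (1::real)"
      obtain c where c: "x = c 0" "sync c0 c" "range c \<in> AH" using YE[OF xy(1)] by blast
      obtain d where d: "y = d 0" "sync c0 d" "range d \<in> AH" using YE[OF xy(2)] by blast
      have "x \<in> cross_section c0 \<A>" "y \<in> cross_section c0 \<A>"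
        using c d unfolding cross_section_def AH_def by blast+
      then have "w x y s \<in> cross_section c0 \<A>" using cconvexD[OF cconvex_cross_section[OF A_convex]] s by blast
      then obtain e where e: "w x y s = e 0" "sync c0 e" "range e \<in> \<A>" unfolding cross_section_def by blast
      have "\<phi> h ` range e = range e" if h: "h \<in> H" for h
      proof -
        have le: "line_dist m0 (range e) < \<infinity>" using line_dist_sync[OF e(2)] c0(2) by simp
        have "line_dist (\<phi> h ` m0) (\<phi> h ` range e) = line_dist m0 (range e)"
          by (rule line_dist_act[OF Hc[OF h] AHl[OF m0]])
        then have "line_dist m0 (\<phi> h ` range e) < \<infinity>" using le AHfix[OF m0 h] by simp
        then obtain e' where e': "sync c0 e'" "range e' = \<phi> h ` range e" using foot by blast
        have pres: "dist (b 0) (e' 0) = dist (b 0) (e 0)" if b: "sync c0 b" "range b \<in> AH" for b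
        proof -
          have "line_dist (range b) (range e') = line_dist (\<phi> h ` range b) (\<phi> h ` range e)"
            using AHfix[OF b(2) h] e'(2) by simp
          also have "\<dots> = line_dist (range b) (range e)" by (rule line_dist_act[OF Hc[OF h] AHl[OF b(2)]])
          finally show ?thesis
            unfolding cross_section_line_dist[OF b(1) e'(1)] cross_section_line_dist[OF b(1) e(2)] by simp
        qed
        \<comment> \<open>The translate by h keeps its distances to the invariant lines c and d, and
          these distances determine a point between x and y.\<close>
        have "e' 0 = w x y s"
        proof (rule w_unique[OF s])
          show "dist x (e' 0) = s * dist x y"
            using pres[OF c(2,3)] dist_w_left[OF s, of x y] unfolding c(1)[symmetric] e(1)[symmetric] by simp
          show "dist y (e' 0) = (1 - s) * dist x y"
            using pres[OF d(2,3)] dist_w_right[OF s, of y x] unfolding d(1)[symmetric] e(1)[symmetric] by simp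
        qed
        then have "e' = e" using cross_section_inj[OF e'(1) e(2)] e(1) by simp
        then show ?thesis using e'(2) by simp
      qed
      then have "range e \<in> AH" unfolding AH_def using e(3) by blast
      then show "w x y s \<in> Y" unfolding Y_def cross_section_def e(1) using e(2) by blast
    qed
    show "Y \<noteq> {}" unfolding Y_def cross_section_def using sync_refl[OF c0(1)] m0 c0(2) by blast
    show "0 < rad v" if "v \<in> Inr ` VH" for v using that q by (auto simp: rad_def)
    show "\<exists>v\<in>Inr ` VH. dist (cen v) y < rad v" if y: "y \<in> Y" for y
    proof -
      obtain c where c: "y = c 0" "sync c0 c" "range c \<in> AH" using YE[OF y] by blast
      have "\<Union>\<V> = \<A>" by (rule good_coverD(2)[OF V])
      then have "range c \<in> \<Union>\<V>" using c(3) unfolding AH_def by simp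
      then obtain B where B: "B \<in> \<V>" "range c \<in> B" by (elim UnionE)
      have "(\<lambda>l. \<phi> h ` l) ` B = B" if h: "h \<in> H" for h
        by (rule good_cover_fixed[OF V B(1) Hc[OF h] B(2) AHfix[OF c(3) h]])
      then have BH: "B \<in> VH" using B(1) by (simp add: VH_def)
      then have "dist (cen (Inr B)) y < rad (Inr B)" using ball[OF BH c(2,3)] B(2) c(1) by simp
      then show ?thesis using BH by blast
    qed
  qed
  have "bc.ncomplex = JH H"
  proof (intro equalityI subsetI)
    fix \<sigma> assume "\<sigma> \<in> bc.ncomplex"
    then obtain y where \<sigma>: "\<sigma> \<subseteq> Inr ` VH" "finite \<sigma>" "\<sigma> \<noteq> {}" and y: "y \<in> Y" "\<forall>v\<in>\<sigma>. dist (cen v) y < rad v"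
      unfolding bc.ncomplex_def by blast
    obtain c where c: "y = c 0" "sync c0 c" "range c \<in> AH" using YE[OF y(1)] by blast
    have r: "Inl -` \<sigma> = {}" using \<sigma>(1) by auto
    have s: "Inr -` \<sigma> \<subseteq> VH" using \<sigma>(1) by auto
    have "range c \<in> B" if B: "B \<in> Inr -` \<sigma>" for B
    proof -
      have "dist (cen (Inr B)) y < rad (Inr B)" using y(2) B by blast
      moreover have "B \<in> VH" using s B by blast
      ultimately show ?thesis using ball[OF _ c(2,3)] c(1) by simp
    qed
    then have "\<Inter>(Inr -` \<sigma>) \<noteq> {}" by blast
    moreover have "finite (Inr -` \<sigma>)" using \<sigma>(2) by (intro finite_vimageI) auto
    moreover have "Inr -` \<sigma> \<noteq> {}" using \<sigma>(3) r sum_set_split[of \<sigma>] by (metis Un_empty image_empty)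
    ultimately have "Inr -` \<sigma> \<in> nerve \<V>" unfolding nerve_def using s by (auto simp: VH_def)
    then have "\<sigma> \<in> J" unfolding J_def sjoin_iff using r \<sigma>(3) by blast
    moreover have "join_act \<phi> h v = v" if hv: "h \<in> H" "v \<in> \<sigma>" for h v
    proof -
      obtain B where "v = Inr B" "B \<in> VH" using \<sigma>(1) hv(2) by blast
      then show ?thesis using hv(1) by (simp add: VH_def)
    qed
    ultimately show "\<sigma> \<in> JH H" unfolding JH_def by blast
  next
    fix \<sigma> assume \<sigma>: "\<sigma> \<in> JH H"
    have \<sigma>f: "finite \<sigma>" "\<sigma> \<noteq> {}" using scomplex_JH \<sigma> unfolding scomplex_def by blast+
    \<comment> \<open>A fixed vertex of the first nerve would force H to be finite.\<close>
    have noInl: "Inl B \<notin> \<sigma>" for B using JH_Inl_finite(1)[OF H \<sigma>] inf by blast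
    have s: "Inr -` \<sigma> \<subseteq> VH"
    proof
      fix B assume "B \<in> Inr -` \<sigma>"
      then have "Inr B \<in> \<sigma>" by simp
      note JH_Inr[OF \<sigma> this]
      then show "B \<in> VH" unfolding VH_def by blast
    qed
    have sub: "\<sigma> \<subseteq> Inr ` VH"
    proof
      fix v assume "v \<in> \<sigma>"
      then show "v \<in> Inr ` VH" using noInl s by (cases v) auto
    qed
    obtain v0 where "v0 \<in> \<sigma>" using \<sigma>f(2) by blast
    moreover obtain B0 where "v0 = Inr B0" using calculation sub by blast
    ultimately have "B0 \<in> Inr -` \<sigma>" by simp
    then have ne: "Inr -` \<sigma> \<noteq> {}" by blast
    then have "Inr -` \<sigma> \<in> nerve \<V>" using \<sigma> unfolding JH_def J_def sjoin_iff by blast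
    then obtain l where "\<And>B. B \<in> Inr -` \<sigma> \<Longrightarrow> l \<in> B" unfolding nerve_def by blast
    then obtain m where m: "m \<in> AH" "\<forall>B\<in>Inr -` \<sigma>. m \<in> B" using fixed[OF s ne] by blast
    obtain c where c: "sync c0 c" "range c = m" using foot[OF par[OF m(1)]] by blast
    have "c 0 \<in> Y" unfolding Y_def cross_section_def using c m(1) by blast
    moreover have "dist (cen v) (c 0) < rad v" if v: "v \<in> \<sigma>" for v
    proof -
      obtain B where B: "v = Inr B" "B \<in> VH" using sub v by blast
      then have "m \<in> B" using m(2) v by blast
      then show ?thesis unfolding B(1) using ball[OF B(2) c(1)] c(2) m(1) by blast
    qed
    ultimately show "\<sigma> \<in> bc.ncomplex" unfolding bc.ncomplex_def using sub \<sigma>f by blast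
  qed
  then show ?thesis using bc.fin_contractible_ncomplex by simp
qed

text \<open>A fixed vertex of the first kind makes H finite, one of the second kind provides an
  invariant line; either way H is virtually cyclic.\<close>

lemma JH_empty:
  assumes H: "subgroup H G" and nvc: "\<not> virtually_cyclic G H"
  shows "JH H = {}"
proof (rule ccontr)
  assume "JH H \<noteq> {}"
  then obtain \<sigma> where \<sigma>: "\<sigma> \<in> JH H" by blast
  then have "\<sigma> \<noteq> {}" using scomplex_JH unfolding scomplex_def by blast
  then obtain v where v: "v \<in> \<sigma>" by blast
  show False
  proof (cases v)
    case (Inl B)
    then have "finite H" using JH_Inl_finite(1)[OF H \<sigma>] v by blast
    then show False using virtually_cyclic_finite[OF H] nvc by blast
  next
    case (Inr B)
    then have B: "B \<in> \<V>" "\<And>h. h \<in> H \<Longrightarrow> (\<lambda>l. \<phi> h ` l) ` B = B" using JH_Inr[OF \<sigma>] v by auto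
    obtain k r where k: "k \<in> \<A>" "0 < r" "B = line_ball \<A> k r" using V_ball[OF B(1)] by blast
    have kB: "k \<in> B" unfolding k(3) line_ball_def using k(1,2) line_dist_self[OF A_lines[OF k(1)]] by (simp add: zero_ereal_def)
    have s: "{B} \<subseteq> \<V>" "{B} \<noteq> {}" using B(1) by simp_all
    have kB': "k \<in> B'" if "B' \<in> {B}" for B' using kB that by simp
    have inv: "(\<lambda>l. \<phi> h ` l) ` B' = B'" if "B' \<in> {B}" "h \<in> H" for B' h using B(2) that by simp
    show False
    proof (rule fixed_line_in_line_balls[OF H s kB' inv])
      fix m assume m: "m \<in> \<A>" "\<And>h. h \<in> H \<Longrightarrow> \<phi> h ` m = m"
      obtain c where c: "geodesic_line c" "m = range c" using A_lines[OF m(1)] by (auto simp: lines_def)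
      have "virtually_cyclic G H" using virtually_cyclic_if_fixes_line[OF H c(1)] m(2) c(2) by blast
      then show False using nvc by blast
    qed
  qed
qed

theorem E_VC_complex_join: "E_VC_complex G (join_act \<phi>) (sjoin (nerve \<U>) (nerve \<V>))"
proof -
  have fc: "fin_contractible (JH H)" if "virtually_cyclic G H" for H
    using fin_contractible_JH_finite[of H] fin_contractible_JH_infinite[OF that] that
    unfolding virtually_cyclic_def by blast
  have cases: "if virtually_cyclic G H
      then fixed_set G (join_act \<phi>) J H \<noteq> {} \<and>
           contractible_space (subtopology (realization_top J) (fixed_set G (join_act \<phi>) J H))
      else fixed_set G (join_act \<phi>) J H = {}" if H: "subgroup H G" for H
  proof (cases "virtually_cyclic G H")
    case True
    have "realization (JH H) \<noteq> {}" using fc[OF True] unfolding fin_contractible_def by blast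
    moreover have "contractible_space (realization_top (JH H))"
      by (rule fin_contractible_imp_contractible_space[OF scomplex_JH fc[OF True]])
    moreover have "subtopology (realization_top J) (realization (JH H)) = realization_top (JH H)"
      by (rule subtopology_realization_top[OF scomplex_J scomplex_JH]) (auto simp: JH_def)
    ultimately show ?thesis unfolding fixed_set_eq[OF H] using True by simp
  next
    case False
    then show ?thesis unfolding fixed_set_eq[OF H] JH_empty[OF H False] by (simp add: realization_def)
  qed
  have t: "subgroup {\<one>} G" by (rule triv_subgroup)
  \<comment> \<open>Contractibility of the whole join is the case of the trivial subgroup, which is
    finite.\<close>
  have "JH {\<one>} = J" by (simp add: JH_def join_act_one)
  moreover have "fin_contractible (JH {\<one>})" by (rule fin_contractible_JH_finite[OF t]) simp
  ultimately have J: "fin_contractible J" by simp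
  then have "realization J \<noteq> {}" unfolding fin_contractible_def by blast
  moreover have "contractible_space (realization_top J)"
    by (rule fin_contractible_imp_contractible_space[OF scomplex_J J])
  ultimately have "E_VC_complex G (join_act \<phi>) J"
    unfolding E_VC_complex_def using J_act J_rigid cases by simp
  then show ?thesis unfolding J_def .
qed

end

theorem theorem5p1:
  fixes G :: "('g, 'm) monoid_scheme" and \<phi> :: "'g \<Rightarrow> 'a::metric_space \<Rightarrow> 'a"
    and \<A> :: "'a set set"
  assumes "proper_space TYPE('a)" and "CAT0_space TYPE('a)"
    and "group_action G (UNIV :: 'a set) \<phi>"
    and "isometric_action G \<phi>" and "proper_action G \<phi>" and "semisimple_action G \<phi>"
    and "well_behaved_axes G \<phi> \<A>"
  shows "(\<exists>\<U>. good_cover G \<phi> UNIV ball \<U>) \<and>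
         (\<exists>\<V>. good_cover G (\<lambda>g l. \<phi> g ` l) \<A> (line_ball \<A>) \<V>) \<and>
         (\<forall>\<U> \<V>. good_cover G \<phi> UNIV ball \<U> \<longrightarrow>
                 good_cover G (\<lambda>g l. \<phi> g ` l) \<A> (line_ball \<A>) \<V> \<longrightarrow>
                 E_VC_complex G (join_act \<phi>) (sjoin (nerve \<U>) (nerve \<V>)))"
proof -
  obtain w :: "'a \<Rightarrow> 'a \<Rightarrow> real \<Rightarrow> 'a" where w: "hadamard w"
    using CAT0_imp_hadamard[OF assms(2,1)] by blast
  interpret cat0_action w G \<phi> \<A>
    using w assms(3-7) by (intro cat0_action.intro cat0_action_axioms.intro)
  have "E_VC_complex G (join_act \<phi>) (sjoin (nerve \<U>) (nerve \<V>))"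
    if "good_cover G \<phi> UNIV ball \<U>" "good_cover G (\<lambda>g l. \<phi> g ` l) \<A> (line_ball \<A>) \<V>" for \<U> \<V>
  proof -
    interpret cat0_covers w G \<phi> \<A> \<U> \<V>
      using that by unfold_locales
    show ?thesis by (rule E_VC_complex_join)
  qed
  then show ?thesis using good_cover_points good_cover_lines by blast
qed

end
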